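(* Let $k\ge 1$ be an integer and let $P_k(x)$ be defined by the $2k$-fold residue $$P_k(x)= \frac{(-1)^k}{k!^2}\frac{1}{(2\pi i)^{2k}} \oint\cdots \oint \frac{G(z_1, \dots,z_{2k})\,\Delta(z_1,\dots,z_{2k})^2}{\prod_{j=1}^{2k} z_j^{2k}}\; e^{\frac x2 \sum_{j=1}^{k}(z_j-z_{k+j})}\,dz_1\cdots dz_{2k},$$ where each variable is integrated over a small positively oriented circle about $0$ and $$G(z_1,\dots,z_{2k})= A_k(z_1,\dots,z_{2k})\prod_{i=1}^k\prod_{j=1}^k\zeta(1+z_i-z_{k+j}).$$ Then $P_k(x)$ is a polynomial in $x$ of degree $k^2$, and its leading coefficient is $$\lim_{x\to\infty}\frac{P_k(x)}{x^{k^2}} = a_k\prod_{\ell=0}^{k-1}\frac{\ell!}{(k+\ell)!},\qquad\text{where}\qquad a_k=A_k(0,\dots,0)=\prod_p\left(1-\frac1p\right)^{(k-1)^2}\sum_{m=0}^{k-1}\binom{k-1}{m}^2p^{-m},$$ the product being over all primes $p$.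
   Context: $\zeta$ is the Riemann zeta-function, $e(\theta)=e^{2\pi i\theta}$, and $\Delta(z_1,\dots,z_m)=\prod_{1\le i<j\le m}(z_j-z_i)$. The function $A_k$ is the Euler product, convergent and analytic for $(z_1,\dots,z_{2k})$ in a neighborhood of $(0,\dots,0)$, $$A_k(z_1,\dots,z_{2k}) =\prod_p \left(\prod_{i=1}^k\prod_{j=1}^k\left(1-\frac{1}{p^{1+z_i-z_{k+j}}}\right)\right) \int_0^1 \prod_{j=1}^k\left(1-\frac{e(\theta)}{p^{\frac12 +z_j}}\right)^{-1}\left(1-\frac{e(-\theta)}{p^{\frac12 -z_{k+j}}}\right)^{-1}\,d\theta .$$ The simple poles of the zeta factors at $z_i=z_{k+j}$ are cancelled by the factor $\Delta(z_1,\dots,z_{2k})^2$, so the integrand is regular there (extended by continuity). *)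

theory Defs
  imports
    "HOL-Complex_Analysis.Complex_Analysis"
    "HOL-Computational_Algebra.Computational_Algebra"
begin

text \<open>
  The Riemann zeta function: the analytic continuation of the Dirichlet series to the plane
  without \<open>1\<close>. The conditions determine it everywhere except at the pole \<open>1\<close>, where its value
  is left unspecified.
\<close>

definition zeta :: "complex \<Rightarrow> complex" where
  "zeta = (SOME f. f holomorphic_on (- {1}) \<and>
             (\<forall>s. Re s > 1 \<longrightarrow> (\<lambda>n. 1 / of_nat (Suc n) powr s) sums f s))"

definition e :: "real \<Rightarrow> complex" where
  "e \<theta> = exp (2 * of_real pi * \<i> * of_real \<theta>)"

text \<open>
  Tuples \<open>(z\<^sub>1, \<dots>, z\<^sub>m)\<close> are functions on \<open>nat\<close>, of which only the values at \<open>1, \<dots>, m\<close> matter.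
\<close>

definition Delta :: "nat \<Rightarrow> (nat \<Rightarrow> complex) \<Rightarrow> complex" where
  "Delta m z = (\<Prod>j\<in>{1..m}. \<Prod>i\<in>{1..<j}. z j - z i)"

definition local_factor :: "nat \<Rightarrow> (nat \<Rightarrow> complex) \<Rightarrow> nat \<Rightarrow> complex" where
  "local_factor k z p =
     (\<Prod>i\<in>{1..k}. \<Prod>j\<in>{1..k}. 1 - 1 / of_nat p powr (1 + z i - z (k + j))) *
     integral {0..1} (\<lambda>\<theta>. \<Prod>j\<in>{1..k}.
        inverse (1 - e \<theta> / of_nat p powr (1/2 + z j)) *
        inverse (1 - e (- \<theta>) / of_nat p powr (1/2 - z (k + j))))"

definition A :: "nat \<Rightarrow> (nat \<Rightarrow> complex) \<Rightarrow> complex" where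
  "A k z = (\<Prod>p. if prime p then local_factor k z p else 1)"

definition G :: "nat \<Rightarrow> (nat \<Rightarrow> complex) \<Rightarrow> complex" where
  "G k z = A k z * (\<Prod>i\<in>{1..k}. \<Prod>j\<in>{1..k}. zeta (1 + z i - z (k + j)))"

text \<open>
  The \<open>n\<close>-fold iterated integral of \<open>F(z\<^sub>1, \<dots>, z\<^sub>n)\<close>, with \<open>z\<^sub>j\<close> running over the positively
  oriented circle of radius \<open>r\<^sub>j\<close> about \<open>0\<close>; the innermost integration is over \<open>z\<^sub>1\<close>.
\<close>

primrec multi_circle_integral ::
    "nat \<Rightarrow> (nat \<Rightarrow> real) \<Rightarrow> ((nat \<Rightarrow> complex) \<Rightarrow> complex) \<Rightarrow> complex" where
  "multi_circle_integral 0 r F = F (\<lambda>_. 0)"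
| "multi_circle_integral (Suc n) r F =
     contour_integral (circlepath 0 (r (Suc n)))
       (\<lambda>w. multi_circle_integral n r (\<lambda>z. F (z(Suc n := w))))"

text \<open>
  Where \<open>z\<^sub>i = z\<^sub>k\<^sub>+\<^sub>j\<close>, the square of \<open>Delta\<close> has a double zero for each simple pole of a zeta
  factor, so the continuous extension of the integrand is \<open>0\<close> there. The expression below is
  also \<open>0\<close> there, whatever the value of \<open>zeta 1\<close>.
\<close>

definition P_integrand :: "nat \<Rightarrow> real \<Rightarrow> (nat \<Rightarrow> complex) \<Rightarrow> complex" where
  "P_integrand k x z =
     G k z * (Delta (2 * k) z)\<^sup>2 / (\<Prod>j\<in>{1..2 * k}. z j ^ (2 * k)) *
     exp (of_real x / 2 * (\<Sum>j\<in>{1..k}. z j - z (k + j)))"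

definition P :: "nat \<Rightarrow> (nat \<Rightarrow> real) \<Rightarrow> real \<Rightarrow> complex" where
  "P k r x =
     (- 1) ^ k / (fact k)\<^sup>2 * (1 / (2 * of_real pi * \<i>) ^ (2 * k)) *
     multi_circle_integral (2 * k) r (P_integrand k x)"

end

theory Submission
  imports Defs "HOL-Real_Asymp.Real_Asymp" "Jordan_Normal_Form.Determinant"
begin

text \<open>
  Parametrising the circles turns \<open>P k r x\<close> into an average over the torus of
  \<open>H(z) K(z) exp (x l(z) / 2)\<close>, where \<open>l(z)\<close> is the sum of the \<open>z\<^sub>j - z\<^sub>k\<^sub>+\<^sub>j\<close>, \<open>H\<close> (the Euler
  product times the entire factors \<open>(s - 1) zeta s\<close>) is regular near \<open>0\<close> with \<open>H(0) = a\<close>, and \<open>K\<close>,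
  the product of three Vandermonde determinants over the \<open>z\<^sub>j ^ (2 k - 1)\<close>, is homogeneous of
  degree \<open>- k\<^sup>2\<close>. The average does not depend on the radii. Letting them shrink to \<open>0\<close> kills the
  terms of the exponential series of order above \<open>k\<^sup>2\<close>, so \<open>P\<close> is a polynomial, and evaluates the
  term of order \<open>k\<^sup>2\<close> as \<open>H(0)\<close> times the average of \<open>K exp (l / 2)\<close>. Expanding the Vandermonde
  determinants, that average is \<open>k!\<^sup>2\<close> times a determinant of Taylor coefficients of
  \<open>exp (\<plusminus> z / 2)\<close>, which reduces to \<open>det (1 / (k + i - j)!)\<close>.
\<close>

section \<open>Analytic continuation of the zeta function\<close>

text \<open>\<open>zeta\<close> is picked by \<open>SOME\<close>, so nothing can be said about it
  before a function with the two defining properties has been constructed and shown to be unique.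
  Afterwards it enters only through the entire function \<open>(s - 1) zeta s\<close> and its value
  1 at 1. The multiple integral is handled one variable at a time: joint continuity gives Fubini,
  and holomorphy in each variable separately gives independence of the radius of that variable, by
  the residue theorem. The radius 1/12 comes from the Euler product: the relevant powers of
  \<open>p\<close> are then at most \<open>p powr (- 5 / 12)\<close>, and an error of third order is
  summable since 3 * 5/12 = 5/4 > 1; any radius below 1/6 would serve. The degree of homogeneity is
  the count k(2k - 1) + k(k - 1) - 2k(2k - 1) = - k^2. That the degree of \<open>P\<close> is
  exactly k^2 rests on the Euler product being nonzero at the origin, where it converges and all its
  factors are nonzero.\<close>

definition dirichlet_zeta :: "complex \<Rightarrow> complex" where
  "dirichlet_zeta s = (\<Sum>n. 1 / of_nat (Suc n) powr s)"

definition powr_deriv :: "complex \<Rightarrow> nat \<Rightarrow> complex \<Rightarrow> complex" where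
  "powr_deriv c i x = (\<Prod>l<i. c - of_nat l) * x powr (c - of_nat i)"

text \<open>The error of the Taylor expansion of order \<open>M\<close> of \<open>x powr c\<close>
  about \<open>n + 1\<close>, evaluated one unit further, at \<open>n + 2\<close>.\<close>

definition powr_remainder :: "nat \<Rightarrow> complex \<Rightarrow> nat \<Rightarrow> complex" where
  "powr_remainder M c n =
     powr_deriv c 0 (of_nat (Suc (Suc n))) - (\<Sum>i\<le>M. powr_deriv c i (of_nat (Suc n)) / fact i)"

lemma norm_of_real_powr: "t > 0 \<Longrightarrow> norm (complex_of_real t powr s) = t powr Re s"
  by (simp add: norm_powr_real_powr)

lemma summable_dirichlet:
  assumes "Re s > 1"
  shows "summable (\<lambda>n. norm (1 / of_nat (Suc n) powr s :: complex))"
proof -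
  have "summable (\<lambda>n. real n powr (- Re s))" using assms by (simp add: summable_real_powr_iff)
  hence "summable (\<lambda>n. real (Suc n) powr (- Re s))" by (subst summable_Suc_iff)
  moreover have "norm (1 / of_nat (Suc n) powr s :: complex) = real (Suc n) powr (- Re s)" for n
  proof -
    have "norm (of_nat (Suc n) powr s :: complex) = real (Suc n) powr Re s"
      using norm_of_real_powr[of "real (Suc n)" s] by simp
    thus ?thesis by (simp add: norm_divide powr_minus field_simps del: of_nat_Suc)
  qed
  ultimately show ?thesis by simp
qed

lemma dirichlet_zeta_sums:
  "Re s > 1 \<Longrightarrow> (\<lambda>n. 1 / of_nat (Suc n) powr s) sums dirichlet_zeta s"
  unfolding dirichlet_zeta_def
  by (rule summable_sums[OF summable_norm_cancel[OF summable_dirichlet]])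

lemma powr_deriv_has_derivative:
  assumes "x \<notin> \<real>\<^sub>\<le>\<^sub>0"
  shows "(powr_deriv c i has_field_derivative powr_deriv c (Suc i) x) (at x within S)"
  unfolding powr_deriv_def
  by (rule derivative_eq_intros assms refl | simp add: assms algebra_simps)+

text \<open>Taylor's theorem on the segment from \<open>n + 1\<close> to \<open>n + 2\<close>. The
  hypothesis makes the exponent of the next derivative nonpositive, so its modulus is largest at the
  left end; majorising the product by \<open>norm c\<close> keeps the bound uniform for bounded
  \<open>c\<close>.\<close>

lemma norm_powr_remainder_le:
  assumes "Re c \<le> real M + 1"
  shows "norm (powr_remainder M c n)
     \<le> (\<Prod>l<Suc M. norm c + real l) / fact M * real (Suc n) powr (Re c - real M - 1)"
proof -
  let ?a = "of_nat (Suc n) :: complex" and ?b = "of_nat (Suc (Suc n)) :: complex"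
  let ?S = "closed_segment ?a ?b"
  let ?B = "(\<Prod>l<Suc M. norm c + real l) * real (Suc n) powr (Re c - real M - 1)"
  have S: "\<exists>t. x = of_real t \<and> t \<ge> real (Suc n)" if "x \<in> ?S" for x
  proof -
    have "x \<in> closed_segment (complex_of_real (real (Suc n))) (of_real (real (Suc (Suc n))))"
      using that by simp
    then obtain t where "x = of_real t" "t \<in> closed_segment (real (Suc n)) (real (Suc (Suc n)))"
      unfolding closed_segment_of_real by blast
    thus ?thesis by (auto simp: closed_segment_eq_real_ivl)
  qed
  have "norm (powr_deriv c 0 ?b - (\<Sum>i\<le>M. powr_deriv c i ?a * (?b - ?a) ^ i / fact i))
     \<le> ?B * norm (?b - ?a) ^ Suc M / fact M"
  proof (rule complex_Taylor[of ?S])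
    fix i x assume "x \<in> ?S"
    then obtain t where "x = of_real t" "t \<ge> real (Suc n)" using S by blast
    thus "(powr_deriv c i has_field_derivative powr_deriv c (Suc i) x) (at x within ?S)"
      by (intro powr_deriv_has_derivative) (auto simp: complex_nonpos_Reals_iff)
  next
    fix x assume "x \<in> ?S"
    then obtain t where t: "x = of_real t" "t \<ge> real (Suc n)" using S by blast
    have "norm (\<Prod>l<Suc M. c - of_nat l) \<le> (\<Prod>l<Suc M. norm c + real l)"
      unfolding prod_norm[symmetric]
      by (intro prod_mono) (auto intro: order_trans[OF norm_triangle_ineq4])
    moreover have "norm (x powr (c - of_nat (Suc M))) = t powr (Re c - real M - 1)"
    proof -
      have "norm (x powr (c - of_nat (Suc M))) = t powr (Re (c - of_nat (Suc M)))"
        using t norm_of_real_powr[of t "c - of_nat (Suc M)"] by simp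
      thus ?thesis by (simp add: algebra_simps)
    qed
    moreover have "t powr (Re c - real M - 1) \<le> real (Suc n) powr (Re c - real M - 1)"
      using t assms by (intro powr_mono2') auto
    ultimately show "norm (powr_deriv c (Suc M) x) \<le> ?B"
      unfolding powr_deriv_def norm_mult by (intro mult_mono prod_nonneg) auto
  qed auto
  moreover have "?b - ?a = 1" by simp
  ultimately show ?thesis unfolding powr_remainder_def by simp
qed

lemma powr_remainder_holomorphic: "(\<lambda>s. powr_remainder M (1 - s) n) holomorphic_on S"
  unfolding powr_remainder_def powr_deriv_def by (intro holomorphic_intros) auto

text \<open>With \<open>c = 1 - s\<close> the terms are bounded by a constant times
  \<open>n + 1\<close> to the power \<open>- Re s - M\<close>, which is summable precisely in this
  half-plane, and locally uniformly there.\<close>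

lemma suminf_powr_remainder_holomorphic:
  "(\<lambda>s. \<Sum>n. powr_remainder M (1 - s) n) holomorphic_on {s. Re s > 1 - real M}"
proof (rule holomorphic_uniform_sequence)
  show "open {s. Re s > 1 - real M}" by (rule open_halfspace_Re_gt)
  show "(\<lambda>s. \<Sum>n<N. powr_remainder M (1 - s) n) holomorphic_on {s. Re s > 1 - real M}" for N
    by (intro holomorphic_intros powr_remainder_holomorphic)
  fix z assume z: "z \<in> {s. Re s > 1 - real M}"
  \<comment> \<open>Half the distance from \<open>z\<close> to the boundary line, so that the
    exponent is at most \<open>- 1 - d\<close> on the whole closed disc.\<close>
  define d where "d = (Re z - (1 - real M)) / 2"
  have d: "d > 0" using z by (simp add: d_def)
  have cb: "Re s \<ge> 1 - real M + d" "norm (1 - s) \<le> 1 + norm z + d" if "s \<in> cball z d" for s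
  proof -
    have "\<bar>Re (z - s)\<bar> \<le> norm (z - s)" by (rule abs_Re_le_cmod)
    hence "\<bar>Re z - Re s\<bar> \<le> d" using that by (simp add: dist_norm)
    hence "Re z - Re s \<le> d" by linarith
    moreover have "2 * d = Re z - (1 - real M)" by (simp add: d_def)
    ultimately show "Re s \<ge> 1 - real M + d" by linarith
    have "norm (1 - s) = norm (1 - z + (z - s))" by simp
    also have "\<dots> \<le> norm (1 - z) + norm (z - s)" by (rule norm_triangle_ineq)
    also have "norm (1 - z) \<le> 1 + norm z" using norm_triangle_ineq4[of 1 z] by simp
    finally show "norm (1 - s) \<le> 1 + norm z + d" using that by (simp add: dist_norm)
  qed
  have "uniform_limit (cball z d) (\<lambda>N s. \<Sum>n<N. powr_remainder M (1 - s) n)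
      (\<lambda>s. \<Sum>n. powr_remainder M (1 - s) n) sequentially"
  proof (rule Weierstrass_m_test)
    fix n s assume s: "s \<in> cball z d"
    have "norm (powr_remainder M (1 - s) n)
        \<le> (\<Prod>l<Suc M. norm (1 - s) + real l) / fact M * real (Suc n) powr (Re (1 - s) - real M - 1)"
      using cb(1)[OF s] d by (intro norm_powr_remainder_le) auto
    also have "\<dots> \<le> (\<Prod>l<Suc M. 1 + norm z + d + real l) / fact M * real (Suc n) powr (- 1 - d)"
      using cb[OF s] d
      by (intro mult_mono divide_right_mono prod_mono powr_mono divide_nonneg_nonneg prod_nonneg) auto
    finally show "norm (powr_remainder M (1 - s) n)
       \<le> (\<Prod>l<Suc M. 1 + norm z + d + real l) / fact M * real (Suc n) powr (- 1 - d)" .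
  next
    have "summable (\<lambda>n. real n powr (- 1 - d))" using d by (simp add: summable_real_powr_iff)
    hence "summable (\<lambda>n. real (Suc n) powr (- 1 - d))" by (subst summable_Suc_iff)
    thus "summable (\<lambda>n. (\<Prod>l<Suc M. 1 + norm z + d + real l) / fact M * real (Suc n) powr (- 1 - d))"
      by (rule summable_mult)
  qed
  moreover have "cball z d \<subseteq> {s. Re s > 1 - real M}" using cb(1) d by force
  ultimately show "\<exists>d>0. cball z d \<subseteq> {s. Re s > 1 - real M} \<and>
      uniform_limit (cball z d) (\<lambda>N s. \<Sum>n<N. powr_remainder M (1 - s) n)
      (\<lambda>s. \<Sum>n. powr_remainder M (1 - s) n) sequentially" using d by blast
qed

lemma powr_telescope:
  assumes "Re c < 0"
  shows "(\<lambda>n. (of_nat (Suc (Suc n)) :: complex) powr c - of_nat (Suc n) powr c) sums (- 1)"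
proof -
  have "(\<lambda>n. real (Suc n) powr (Re c)) \<longlonglongrightarrow> 0"
    using assms by real_asymp
  hence "(\<lambda>n. norm ((of_nat (Suc n) :: complex) powr c)) \<longlonglongrightarrow> 0"
    using norm_of_real_powr[of "real (Suc n)" c for n] by simp
  hence "(\<lambda>n. (of_nat (Suc n) :: complex) powr c) \<longlonglongrightarrow> 0" by (rule tendsto_norm_zero_cancel)
  from telescope_sums[OF this] show ?thesis by simp
qed

text \<open>
  Summing the Taylor expansions of \<open>(n + 1) powr (1 - s)\<close> about \<open>n\<close> makes the left-hand sides
  telescope. With \<open>c = 1 - s\<close>, the last factor \<open>c - m\<close> of the binomial coefficient is
  \<open>- (s + m - 1)\<close>, which cancels the pole of the shifted zeta function.
\<close>
lemma dirichlet_zeta_recurrence: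
  assumes s: "Re s > 1" and M: "M \<ge> 1"
  shows "(s - 1) * dirichlet_zeta s = 1 + (\<Sum>n. powr_remainder M (1 - s) n)
    - (\<Sum>m\<in>{1..<M}. (\<Prod>l<m. 1 - s - of_nat l) / fact (Suc m)
         * ((s + of_nat m - 1) * dirichlet_zeta (s + of_nat m)))"
proof -
  define c where "c = 1 - s"
  have c: "Re c < 0" using s by (simp add: c_def)
  have dz: "(\<lambda>n. powr_deriv c (Suc m) (of_nat (Suc n)) / fact (Suc m)) sums
      (- ((\<Prod>l<m. c - of_nat l) / fact (Suc m) * ((s + of_nat m - 1) * dirichlet_zeta (s + of_nat m))))" for m
  proof -
    have "(\<lambda>n. (\<Prod>l<Suc m. c - of_nat l) / fact (Suc m) * (1 / of_nat (Suc n) powr (s + of_nat m)))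
       sums ((\<Prod>l<Suc m. c - of_nat l) / fact (Suc m) * dirichlet_zeta (s + of_nat m))"
      by (intro sums_mult dirichlet_zeta_sums) (use s in simp)
    moreover have "1 / of_nat (Suc n) powr (s + of_nat m) = (of_nat (Suc n) :: complex) powr (c - of_nat (Suc m))" for n
      unfolding c_def by (simp add: powr_minus[symmetric] inverse_eq_divide[symmetric] algebra_simps del: of_nat_Suc) (simp add: algebra_simps)
    moreover have "(\<Prod>l<Suc m. c - of_nat l) / fact (Suc m) * dirichlet_zeta (s + of_nat m) =
       - ((\<Prod>l<m. c - of_nat l) / fact (Suc m) * ((s + of_nat m - 1) * dirichlet_zeta (s + of_nat m)))"
    proof -
      have "c - of_nat m = - (s + of_nat m - 1)" by (simp add: c_def)
      hence "(\<Prod>l<Suc m. c - of_nat l) = - ((\<Prod>l<m. c - of_nat l) * (s + of_nat m - 1))"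
        unfolding prod.lessThan_Suc by (simp only: mult_minus_right)
      thus ?thesis by (simp only: minus_divide_left minus_mult_left times_divide_eq_left mult.assoc)
    qed
    ultimately show ?thesis unfolding powr_deriv_def by (simp del: fact_Suc of_nat_Suc prod.lessThan_Suc)
  qed
  have "(\<lambda>n. (of_nat (Suc (Suc n)) powr c - of_nat (Suc n) powr c)
      - (\<Sum>m<M. powr_deriv c (Suc m) (of_nat (Suc n)) / fact (Suc m)))
     sums (- 1 - (\<Sum>m<M. - ((\<Prod>l<m. c - of_nat l) / fact (Suc m) * ((s + of_nat m - 1) * dirichlet_zeta (s + of_nat m)))))"
    by (intro sums_diff powr_telescope sums_sum dz c)
  moreover have "(of_nat (Suc (Suc n)) powr c - of_nat (Suc n) powr c)
      - (\<Sum>m<M. powr_deriv c (Suc m) (of_nat (Suc n)) / fact (Suc m)) = powr_remainder M c n" for n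
  proof -
    have "(\<Sum>i\<le>M. powr_deriv c i (of_nat (Suc n)) / fact i) = powr_deriv c 0 (of_nat (Suc n)) / fact 0
       + (\<Sum>m<M. powr_deriv c (Suc m) (of_nat (Suc n)) / fact (Suc m))"
      by (rule sum.atMost_shift)
    thus ?thesis unfolding powr_remainder_def by (simp add: powr_deriv_def)
  qed
  ultimately have "(\<Sum>n. powr_remainder M c n) = - 1 + (\<Sum>m<M. (\<Prod>l<m. c - of_nat l) / fact (Suc m) * ((s + of_nat m - 1) * dirichlet_zeta (s + of_nat m)))"
    by (simp add: sums_iff sum_negf)
  \<comment> \<open>The term \<open>m = 0\<close> has an empty product and factorial 1: it is
    \<open>(s - 1) * dirichlet_zeta s\<close> itself, for which the identity is solved.\<close>
  moreover have "{..<M} = insert 0 {1..<M}" using M by auto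
  ultimately show ?thesis by (simp add: c_def)
qed

text \<open>For exponent 0 the expanded function is constant, so the expansion is exact. This is the
  case \<open>s = 1\<close> of the recurrence and yields the value 1 of the continuation
  there.\<close>

lemma powr_remainder_0: "powr_remainder M 0 n = 0"
proof -
  have "(\<Sum>i\<le>M. powr_deriv 0 i (of_nat (Suc n)) / fact i) = (\<Sum>i\<in>{0}. powr_deriv 0 i (of_nat (Suc n)) / fact i)"
    by (rule sum.mono_neutral_right) (auto simp: powr_deriv_def prod_zero_iff)
  thus ?thesis by (simp add: powr_remainder_def powr_deriv_def del: of_nat_Suc)
qed

text \<open>The recurrence read as a definition: its right-hand side at \<open>s\<close> uses
  \<open>W\<close> only at \<open>s + m\<close> with \<open>m >= 1\<close>, where it is already
  known.\<close>

lemma zeta_continuation_step: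
  assumes M: "M \<ge> 1"
    and hol: "\<And>m. m \<in> {1..<M} \<Longrightarrow> (\<lambda>s. W (s + of_nat m)) holomorphic_on {s. Re s > 1 - real M}"
    and W: "\<And>s. Re s > 1 \<Longrightarrow> W s = (s - 1) * dirichlet_zeta s"
  shows "\<exists>W'. W' holomorphic_on {s. Re s > 1 - real M} \<and> W' 1 = 1 \<and>
           (\<forall>s. Re s > 1 \<longrightarrow> W' s = (s - 1) * dirichlet_zeta s)"
proof (intro exI conjI allI impI)
  let ?W = "\<lambda>s. 1 + (\<Sum>n. powr_remainder M (1 - s) n)
    - (\<Sum>m\<in>{1..<M}. (\<Prod>l<m. 1 - s - of_nat l) / fact (Suc m) * W (s + of_nat m))"
  show "?W holomorphic_on {s. Re s > 1 - real M}"
    by (intro holomorphic_intros suminf_powr_remainder_holomorphic hol) auto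
  \<comment> \<open>At \<open>s = 1\<close> the factor \<open>l = 0\<close> vanishes.\<close>
  have "(\<Prod>l<m. 1 - 1 - of_nat l) = (0::complex)" if "m \<in> {1..<M}" for m
    using that by (intro prod_zero) (auto intro!: bexI[of _ 0])
  hence "(\<Sum>m\<in>{1..<M}. (\<Prod>l<m. 1 - 1 - of_nat l) / fact (Suc m) * W (1 + of_nat m)) = 0"
    by (intro sum.neutral) (simp del: fact_Suc)
  moreover have "(\<Sum>n. powr_remainder M (1 - 1) n) = 0" by (simp add: powr_remainder_0)
  ultimately show "?W 1 = 1" by (simp only:) simp
  fix s :: complex assume s: "Re s > 1"
  show "?W s = (s - 1) * dirichlet_zeta s"
    unfolding dirichlet_zeta_recurrence[OF s M]
    using s by (simp add: W del: fact_Suc)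
qed

text \<open>The half-plane for \<open>N\<close> uses Taylor order \<open>M = N + 1\<close>, since
  then \<open>1 - M = - N\<close>. For \<open>M = 1\<close> the sum over \<open>m\<close> is empty,
  so the base case requires no earlier continuation.\<close>

lemma zeta_continuation_halfplane:
  "\<exists>W. W holomorphic_on {s. Re s > - real N} \<and> W 1 = 1 \<and>
       (\<forall>s. Re s > 1 \<longrightarrow> W s = (s - 1) * dirichlet_zeta s)"
proof (induction N)
  case 0
  show ?case using zeta_continuation_step[of 1 "\<lambda>s. (s - 1) * dirichlet_zeta s"] by simp
next
  case (Suc N)
  then obtain W where W: "W holomorphic_on {s. Re s > - real N}"
      "\<And>s. Re s > 1 \<Longrightarrow> W s = (s - 1) * dirichlet_zeta s" by blast
  have "(\<lambda>s. W (s + of_nat m)) holomorphic_on {s. Re s > 1 - real (Suc (Suc N))}" if m: "m \<in> {1..<Suc (Suc N)}" for m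
  proof -
    have "(\<lambda>s. s + of_nat m) holomorphic_on {s. Re s > 1 - real (Suc (Suc N))}"
      by (intro holomorphic_intros)
    moreover have "(\<lambda>s. s + of_nat m) ` {s. Re s > 1 - real (Suc (Suc N))} \<subseteq> {s. Re s > - real N}"
      using m by auto
    ultimately show ?thesis using holomorphic_on_compose_gen[OF _ W(1)] by (simp add: o_def)
  qed
  from zeta_continuation_step[OF _ this W(2)] show ?case by simp
qed

lemma zeta_continuation:
  "\<exists>W. W holomorphic_on UNIV \<and> W 1 = 1 \<and> (\<forall>s. Re s > 1 \<longrightarrow> W s = (s - 1) * dirichlet_zeta s)"
proof -
  obtain W where W: "\<And>N::nat. W N holomorphic_on {s. Re s > - real N}" "\<And>N. W N 1 = 1"
     "\<And>N s. Re s > 1 \<Longrightarrow> W N s = (s - 1) * dirichlet_zeta s"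
    using zeta_continuation_halfplane by metis
  have eq: "W N s = W M s" if s: "Re s > - real N" "Re s > - real M" for N M s
  proof (rule analytic_continuation_open[where f = "W N" and g = "W M" and z = s
        and s = "{s. Re s > 1}" and s' = "{s. Re s > - real (min N M)}"])
    show "connected {s. Re s > - real (min N M)}"
      by (intro convex_connected convex_halfspace_Re_gt)
    show "s \<in> {s. Re s > - real (min N M)}" using s by (auto simp: min_def)
    show "{s. Re s > 1} \<noteq> {}" by (auto intro!: exI[of _ 2])
    show "W N holomorphic_on {s. Re s > - real (min N M)}"
      by (rule holomorphic_on_subset[OF W(1)]) auto
    show "W M holomorphic_on {s. Re s > - real (min N M)}"
      by (rule holomorphic_on_subset[OF W(1)]) auto
  qed (auto simp: W(3) open_halfspace_Re_gt)
  \<comment> \<open>By \<open>eq\<close> the value is the same for every half-plane containing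
    \<open>s\<close>; this index is one explicit choice.\<close>
  define V where "V s = W (nat \<lceil>\<bar>Re s\<bar>\<rceil> + 1) s" for s
  have VW: "V s = W N s" if s: "Re s > - real N" for N s
  proof -
    have "Re s > - real (nat \<lceil>\<bar>Re s\<bar>\<rceil> + 1)" by linarith
    from eq[OF this s] show ?thesis by (simp add: V_def)
  qed
  show ?thesis
  proof (intro exI[of _ V] conjI allI impI)
    have "V holomorphic_on (\<Union>N::nat. {s. Re s > - real N})"
    proof (rule holomorphic_on_UN_open)
      fix N :: nat
      show "V holomorphic_on {s. Re s > - real N}"
        using W(1)[of N] by (rule holomorphic_transform) (simp add: VW)
    qed (rule open_halfspace_Re_gt)
    moreover have "(\<Union>N::nat. {s. Re s > - real N}) = UNIV"
    proof -
      have "\<exists>N::nat. Re s > - real N" for s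
      proof -
        obtain N :: nat where "- Re s < real N" using reals_Archimedean2 by blast
        hence "Re s > - real N" by linarith
        thus ?thesis ..
      qed
      thus ?thesis by auto
    qed
    ultimately show "V holomorphic_on UNIV" by simp
    show "V 1 = 1" by (simp add: V_def W(2))
    show "V s = (s - 1) * dirichlet_zeta s" if "Re s > 1" for s using that by (simp add: V_def W(3))
  qed
qed

text \<open>Existence of the continuation makes the conditions behind \<open>SOME\<close>
  satisfiable; the identity theorem on the connected set \<open>- {1}\<close> then identifies the
  chosen function with \<open>W s / (s - 1)\<close>.\<close>

lemma zeta_times_minus_one_entire:
  "\<exists>W. W holomorphic_on UNIV \<and> W 1 = 1 \<and> (\<forall>s. s \<noteq> 1 \<longrightarrow> W s = (s - 1) * zeta s)"
proof -
  obtain W where W: "W holomorphic_on UNIV" "W 1 = 1"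
      "\<And>s. Re s > 1 \<Longrightarrow> W s = (s - 1) * dirichlet_zeta s"
    using zeta_continuation by blast
  let ?P = "\<lambda>f. f holomorphic_on (- {1}) \<and>
             (\<forall>s. Re s > 1 \<longrightarrow> (\<lambda>n. 1 / of_nat (Suc n) powr s) sums f s)"
  have "?P (\<lambda>s. W s / (s - 1))"
  proof (intro conjI allI impI)
    show "(\<lambda>s. W s / (s - 1)) holomorphic_on - {1}"
      by (intro holomorphic_intros holomorphic_on_subset[OF W(1)]) auto
    fix s :: complex assume "Re s > 1"
    moreover have "s \<noteq> 1" using \<open>Re s > 1\<close> by auto
    ultimately show "(\<lambda>n. 1 / of_nat (Suc n) powr s) sums (W s / (s - 1))"
      using dirichlet_zeta_sums[of s] by (simp add: W(3))
  qed
  note z = someI[of ?P, OF this, folded zeta_def]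
  have "W s / (s - 1) = zeta s" if "s \<noteq> 1" for s
  proof (rule analytic_continuation_open[where f = "\<lambda>s. W s / (s - 1)" and g = zeta and z = s
        and s = "{s. Re s > 1}" and s' = "- {1}"])
    show "{s. Re s > 1} \<noteq> {}" by (auto intro!: exI[of _ 2])
    show "connected (- {1::complex})" by (rule connected_punctured_universe) simp
    show "(\<lambda>s. W s / (s - 1)) holomorphic_on - {1}"
      by (intro holomorphic_intros holomorphic_on_subset[OF W(1)]) auto
    fix w :: complex assume w: "w \<in> {s. Re s > 1}"
    moreover have "w \<noteq> 1" using w by auto
    moreover have "dirichlet_zeta w = zeta w" using z dirichlet_zeta_sums[of w] w sums_unique2 by blast
    ultimately show "W w / (w - 1) = zeta w" by (simp add: W(3))
  qed (use z that in \<open>auto simp: open_halfspace_Re_gt\<close>)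
  hence "W s = (s - 1) * zeta s" if "s \<noteq> 1" for s using that by (simp add: field_simps)
  with W(1,2) show ?thesis by blast
qed

section \<open>Determinants\<close>

abbreviation square_mat :: "nat \<Rightarrow> (nat \<Rightarrow> nat \<Rightarrow> 'a) \<Rightarrow> 'a Matrix.mat" where
  "square_mat n f \<equiv> Matrix.mat n n (\<lambda>(i, j). f i j)"

lemma square_mat_times:
  "square_mat n f * square_mat n g = square_mat n (\<lambda>i j. \<Sum>l<n. f i l * g l j)"
  by (rule eq_matI) (auto simp: scalar_prod_def lessThan_atLeast0)

lemma det_square_mat_upper:
  fixes f :: "nat \<Rightarrow> nat \<Rightarrow> 'a::comm_ring_1"
  assumes "\<And>i j. j < i \<Longrightarrow> i < n \<Longrightarrow> f i j = 0"
  shows "Determinant.det (square_mat n f) = (\<Prod>i<n. f i i)"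
  using assms by (subst det_upper_triangular[of _ n])
     (auto simp: prod_list_diag_prod lessThan_atLeast0 intro!: upper_triangularI prod.cong)

lemma det_square_mat_lower:
  fixes f :: "nat \<Rightarrow> nat \<Rightarrow> 'a::comm_ring_1"
  assumes "\<And>i j. i < j \<Longrightarrow> j < n \<Longrightarrow> f i j = 0"
  shows "Determinant.det (square_mat n f) = (\<Prod>i<n. f i i)"
  using assms by (subst det_lower_triangular[of n])
     (auto simp: prod_list_diag_prod lessThan_atLeast0 intro!: prod.cong)

lemma det_square_mat:
  "Determinant.det (square_mat n f) =
     (\<Sum>p | p permutes {0..<n}. signof p * (\<Prod>i<n. f i (p i)))"
proof -
  have "(\<Prod>i=0..<n. square_mat n f $$ (i, p i)) = (\<Prod>i<n. f i (p i))" if "p permutes {0..<n}" for p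
  proof -
    have "p i < n" if "i < n" for i
      using permutes_in_image[OF \<open>p permutes _\<close>, of i] that by simp
    thus ?thesis by (auto intro!: prod.cong simp: lessThan_atLeast0)
  qed
  thus ?thesis by (subst det_def'[of _ n]) (auto intro!: sum.cong)
qed

text \<open>The matrix of values is the matrix of monomials times the matrix of coefficients, and
  the latter is upper triangular with ones on the diagonal.\<close>

lemma det_monic_poly_eq_monomials:
  fixes x :: "nat \<Rightarrow> 'a::idom"
  assumes p: "\<And>j. j < n \<Longrightarrow> degree (p j) = j \<and> coeff (p j) j = 1"
  shows "Determinant.det (square_mat n (\<lambda>i j. poly (p j) (x i))) =
         Determinant.det (square_mat n (\<lambda>i j. x i ^ j))"
proof -
  have "(\<Sum>l<n. x i ^ l * coeff (p j) l) = poly (p j) (x i)" if "j < n" for i j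
  proof -
    have "poly (p j) (x i) = (\<Sum>l\<le>j. coeff (p j) l * x i ^ l)"
      using p[OF that] by (simp add: poly_altdef)
    also have "\<dots> = (\<Sum>l<n. coeff (p j) l * x i ^ l)"
      using p[OF that] that by (intro sum.mono_neutral_left) (auto intro: coeff_eq_0)
    finally show ?thesis by (simp add: mult.commute)
  qed
  hence "square_mat n (\<lambda>i j. poly (p j) (x i)) =
      square_mat n (\<lambda>i j. x i ^ j) * square_mat n (\<lambda>l j. coeff (p j) l)"
    unfolding square_mat_times by (intro eq_matI) auto
  hence "Determinant.det (square_mat n (\<lambda>i j. poly (p j) (x i))) =
      Determinant.det (square_mat n (\<lambda>i j. x i ^ j)) * Determinant.det (square_mat n (\<lambda>l j. coeff (p j) l))"
    by (simp add: Determinant.det_mult[of _ n])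
  moreover have "Determinant.det (square_mat n (\<lambda>l j. coeff (p j) l)) = 1"
    using p by (subst det_square_mat_upper) (auto intro!: coeff_eq_0)
  ultimately show ?thesis by simp
qed

lemma monic_prod_linear:
  fixes y :: "nat \<Rightarrow> 'a::idom"
  shows "degree (\<Prod>l<j. [:- y l, 1:]) = j \<and> coeff (\<Prod>l<j. [:- y l, 1:]) j = 1"
proof -
  have d: "degree (\<Prod>l<j. [:- y l, 1:]) = j"
    by (subst degree_prod_eq_sum_degree) auto
  moreover have "lead_coeff (\<Prod>l<j. [:- y l, 1:]) = 1"
    by (simp add: lead_coeff_prod)
  ultimately show ?thesis by simp
qed

text \<open>In the Newton basis, whose \<open>j\<close>-th element is the product of the
  \<open>X - x l\<close> with \<open>l < j\<close>, the matrix of values is lower triangular: for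
  \<open>i < j\<close> the entry contains the factor \<open>x i - x i\<close>.\<close>

lemma det_vandermonde:
  fixes x :: "nat \<Rightarrow> 'a::idom"
  shows "Determinant.det (square_mat n (\<lambda>i j. x i ^ j)) = (\<Prod>j<n. \<Prod>i<j. x j - x i)"
proof -
  have "Determinant.det (square_mat n (\<lambda>i j. x i ^ j)) =
      Determinant.det (square_mat n (\<lambda>i j. poly (\<Prod>l<j. [:- x l, 1:]) (x i)))"
    by (rule det_monic_poly_eq_monomials[symmetric]) (rule monic_prod_linear)
  also have "\<dots> = (\<Prod>j<n. poly (\<Prod>l<j. [:- x l, 1:]) (x j))"
    by (rule det_square_mat_lower) (auto simp: poly_prod)
  finally show ?thesis by (simp add: poly_prod)
qed

text \<open>Up to the row factor \<open>1 / fact (k + i)\<close> the entry is the falling factorial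
  of length \<open>j\<close> at \<open>k + i\<close>, a monic polynomial of degree \<open>j\<close>.
  What remains is the Vandermonde determinant of \<open>k\<close> consecutive integers, the product
  of the \<open>fact j\<close>.\<close>

lemma det_inverse_factorial:
  "Determinant.det (square_mat k (\<lambda>i j. 1 / fact (k + i - j))) =
     (\<Prod>l<k. fact l / fact (k + l) :: 'a::field_char_0)"
proof -
  let ?p = "\<lambda>j. \<Prod>l<j. [:- of_nat l, 1 :: 'a:]"
  let ?x = "\<lambda>i. of_nat (k + i) :: 'a"
  have fall: "fact (k + i) = fact (k + i - j) * (\<Prod>l<j. ?x i - of_nat l)" if "j \<le> k" for i j
    using that
  proof (induction j)
    case (Suc j)
    hence "fact (k + i - j) = (of_nat (k + i - j) :: 'a) * fact (k + i - Suc j)"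
      by (metis Suc_diff_Suc fact_Suc le_add1 less_le_trans order.strict_trans2 Suc_le_lessD)
    moreover have "(of_nat (k + i - j) :: 'a) = ?x i - of_nat j" using Suc.prems by (subst of_nat_diff) auto
    ultimately show ?case using Suc by simp
  qed simp
  have "square_mat k (\<lambda>i j. 1 / fact (k + i - j)) =
      square_mat k (\<lambda>i l. if i = l then 1 / fact (k + i) else 0) * square_mat k (\<lambda>i j. poly (?p j) (?x i))"
    unfolding square_mat_times
  proof (intro eq_matI)
    fix i j assume "i < dim_row (square_mat k (\<lambda>i j. \<Sum>l<k. (if i = l then 1 / fact (k + i) else 0) * poly (?p j) (?x l)))"
        "j < dim_col (square_mat k (\<lambda>i j. \<Sum>l<k. (if i = l then 1 / fact (k + i) else 0) * poly (?p j) (?x l)))"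
    hence ij: "i < k" "j < k" by auto
    have "(\<Sum>l<k. (if i = l then 1 / fact (k + i) else 0) * poly (?p j) (?x l))
        = (\<Sum>l<k. if l = i then 1 / fact (k + i) * poly (?p j) (?x i) else 0)"
      by (rule sum.cong) auto
    also have "\<dots> = 1 / fact (k + i) * poly (?p j) (?x i)" using ij by simp
    also have "\<dots> = 1 / fact (k + i - j)"
    proof -
      have "poly (?p j) (?x i) = (\<Prod>l<j. ?x i - of_nat l)" by (simp add: poly_prod)
      moreover from this have "(\<Prod>l<j. ?x i - of_nat l) \<noteq> 0" using fall[of j i] ij
        by (metis fact_nonzero less_imp_le mult_zero_right)
      ultimately show ?thesis using fall[of j i] ij by simp
    qed
    finally show "square_mat k (\<lambda>i j. 1 / fact (k + i - j)) $$ (i, j) =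
       square_mat k (\<lambda>i j. \<Sum>l<k. (if i = l then 1 / fact (k + i) else 0) * poly (?p j) (?x l)) $$ (i, j)"
      using ij by simp
  qed auto
  hence "Determinant.det (square_mat k (\<lambda>i j. 1 / fact (k + i - j))) =
      (\<Prod>i<k. 1 / fact (k + i)) * Determinant.det (square_mat k (\<lambda>i j. poly (?p j) (?x i)))"
    by (simp add: Determinant.det_mult[of _ k] det_square_mat_upper)
  also have "Determinant.det (square_mat k (\<lambda>i j. poly (?p j) (?x i))) = (\<Prod>j<k. \<Prod>i<j. ?x j - ?x i)"
    unfolding det_vandermonde[symmetric]
    by (rule det_monic_poly_eq_monomials) (rule monic_prod_linear)
  also have "\<dots> = (\<Prod>j<k. fact j)"
  proof (rule prod.cong)
    fix j
    have "(\<Prod>i<j. ?x j - ?x i) = (\<Prod>i<j. of_nat (j - i))"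
      by (rule prod.cong) (auto simp: of_nat_diff)
    also have "\<dots> = (\<Prod>i<j. of_nat (Suc i))"
      by (rule prod.reindex_bij_witness[of _ "\<lambda>i. j - Suc i" "\<lambda>i. j - Suc i"]) (auto simp: Suc_diff_Suc)
    also have "\<dots> = (fact j :: 'a)" by (induction j) (simp_all add: mult.commute)
    finally show "(\<Prod>i<j. ?x j - ?x i) = fact j" .
  qed simp
  finally show ?thesis by (simp add: prod_dividef prod.distrib[symmetric])
qed

text \<open>The coefficient of degree \<open>m - b\<close> in
  \<open>exp (x z) * exp (y z) = exp ((x + y) z)\<close>, indexed the way it arises in a matrix
  product.\<close>

lemma exp_convolution:
  fixes x y :: "'a::field_char_0"
  assumes "b \<le> m"
  shows "(\<Sum>l=b..m. x ^ (m - l) / fact (m - l) * (y ^ (l - b) / fact (l - b))) = (x + y) ^ (m - b) / fact (m - b)"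
proof -
  have "(\<Sum>l=b..m. x ^ (m - l) / fact (m - l) * (y ^ (l - b) / fact (l - b)))
     = (\<Sum>i\<le>m - b. x ^ (m - b - i) / fact (m - b - i) * (y ^ i / fact i))"
    by (rule sum.reindex_bij_witness[of _ "\<lambda>i. i + b" "\<lambda>l. l - b"]) (use assms in auto)
  also have "\<dots> = (\<Sum>i\<le>m - b. of_nat ((m - b) choose i) * y ^ i * x ^ (m - b - i)) / fact (m - b)"
    unfolding sum_divide_distrib
    by (rule sum.cong) (auto simp: binomial_fact field_simps)
  also have "\<dots> = (y + x) ^ (m - b) / fact (m - b)" by (simp add: binomial_ring)
  finally show ?thesis by (simp add: add.commute)
qed

text \<open>The reversal of \<open>k\<close> rows enters the determinant of \<open>exp_coeff\<close>
  twice, so its sign never has to be computed.\<close>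

lemma det_antidiagonal_square:
  "Determinant.det (square_mat k (\<lambda>i j. if i + j + 1 = k then 1 else 0)) *
   Determinant.det (square_mat k (\<lambda>i j. if i + j + 1 = k then 1 else 0 :: 'a::idom)) = 1"
proof -
  let ?J = "square_mat k (\<lambda>i j. if i + j + 1 = k then 1 else 0 :: 'a)"
  have "?J * ?J = square_mat k (\<lambda>i j. if i = j then 1 else 0)"
    unfolding square_mat_times
  proof (intro eq_matI)
    fix i j assume "i < dim_row (square_mat k (\<lambda>i j. if i = j then 1 else 0 :: 'a))"
       "j < dim_col (square_mat k (\<lambda>i j. if i = j then 1 else 0 :: 'a))"
    hence ij: "i < k" "j < k" by auto
    have "(\<Sum>l<k. (if i + l + 1 = k then 1 else 0) * (if l + j + 1 = k then 1 else 0 :: 'a))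
       = (\<Sum>l<k. if l = k - 1 - i then (if i = j then 1 else 0) else 0)"
      using ij by (intro sum.cong) auto
    thus "square_mat k (\<lambda>i j. \<Sum>l<k. (if i + l + 1 = k then 1 else 0) * (if l + j + 1 = k then 1 else 0 :: 'a)) $$ (i, j)
       = square_mat k (\<lambda>i j. if i = j then 1 else 0) $$ (i, j)" using ij by simp
  qed auto
  moreover have "Determinant.det (?J * ?J) = Determinant.det ?J * Determinant.det ?J"
    by (rule Determinant.det_mult[of _ k]) auto
  ultimately show ?thesis by (simp add: det_square_mat_upper)
qed

section \<open>The determinant of Taylor coefficients and the sum over permutations\<close>

text \<open>The constant term of \<open>z ^ d * exp (z / 2) / z ^ (2 * k - 1)\<close>, with
  \<open>exp (- z / 2)\<close> instead when \<open>a >= k\<close>. Indices start at 0 here: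
  \<open>a\<close> belongs to the variable number \<open>a + 1\<close>.\<close>

definition exp_coeff :: "nat \<Rightarrow> nat \<Rightarrow> nat \<Rightarrow> complex" where
  "exp_coeff k a d = (if d < 2 * k then (if a < k then 1/2 else - 1/2) ^ (2 * k - 1 - d) / fact (2 * k - 1 - d) else 0)"

text \<open>
  Right multiplication by the unipotent matrix of multiplication by \<open>exp (z / 2)\<close> modulo \<open>z ^ (2 * k)\<close>
  turns the rows for \<open>exp (- z / 2)\<close> into monomials.
\<close>
lemma det_exp_coeff:
  "Determinant.det (square_mat (2 * k) (\<lambda>a b. exp_coeff k a (b + (if a < k then a else a - k)))) =
     (\<Prod>l<k. fact l / fact (k + l))"
proof -
  define n where "n = 2 * k"
  define m where "m a = (if a < k then n - 1 - a else n - 1 - (a - k))" for a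
  define eps where "eps a = (if a < k then 1/2 else - 1/2 :: complex)" for a
  let ?R = "\<lambda>a b. exp_coeff k a (b + (if a < k then a else a - k))"
  let ?U = "\<lambda>l b. if b \<le> l then (1/2) ^ (l - b) / fact (l - b) else 0 :: complex"
  let ?N = "\<lambda>a b. if b \<le> m a then (eps a + 1/2) ^ (m a - b) / fact (m a - b) else 0"
  let ?J = "square_mat k (\<lambda>i j. if i + j + 1 = k then 1 else 0 :: complex)"
  let ?M = "square_mat k (\<lambda>i j. 1 / fact (k + i - j) :: complex)"
  have R: "?R a b = (if b \<le> m a then eps a ^ (m a - b) / fact (m a - b) else 0)" if "a < n" for a b
    using that unfolding exp_coeff_def m_def eps_def n_def
    by (auto simp: algebra_simps diff_diff_eq)
  have "(\<Sum>l<n. ?R a l * ?U l b) = ?N a b" if "a < n" "b < n" for a b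
  proof (cases "b \<le> m a")
    case True
    have "m a < n" using that by (auto simp: m_def)
    hence "(\<Sum>l<n. ?R a l * ?U l b) = (\<Sum>l=b..m a. ?R a l * ?U l b)"
      using that by (intro sum.mono_neutral_right) (auto simp: R)
    also have "\<dots> = (\<Sum>l=b..m a. eps a ^ (m a - l) / fact (m a - l) * ((1/2) ^ (l - b) / fact (l - b)))"
      using that by (intro sum.cong) (auto simp: R)
    also have "\<dots> = (eps a + 1/2) ^ (m a - b) / fact (m a - b)" by (rule exp_convolution[OF True])
    finally show ?thesis using True by simp
  next
    case False
    thus ?thesis using that by (auto simp: R intro!: sum.neutral)
  qed
  hence "square_mat n ?R * square_mat n ?U = square_mat n ?N"
    unfolding square_mat_times by (intro eq_matI) auto
  moreover have "Determinant.det (square_mat n ?U) = 1"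
    by (subst det_square_mat_lower) auto
  moreover have "Determinant.det (square_mat n ?R * square_mat n ?U) =
      Determinant.det (square_mat n ?R) * Determinant.det (square_mat n ?U)"
    by (rule Determinant.det_mult[of _ n]) auto
  ultimately have "Determinant.det (square_mat n ?R) = Determinant.det (square_mat n ?N)"
    by simp
  \<comment> \<open>For \<open>a < k\<close> the base \<open>eps a + 1/2\<close> is 1 and the first
    \<open>k\<close> columns hold \<open>?M\<close> with its rows in reverse order, hence
    \<open>?J * ?M\<close>. For \<open>a >= k\<close> the base is 0, and \<open>0 ^ 0 = 1\<close>
    leaves a single 1 in column \<open>m a >= k\<close>, hence the blocks 0 and
    \<open>?J\<close>.\<close>
  also have "square_mat n ?N = four_block_mat (?J * ?M) (Matrix.mat k k (\<lambda>(i, j). ?N i (k + j))) (0\<^sub>m k k) ?J"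
  proof (intro eq_matI)
    fix a b assume "a < dim_row (four_block_mat (?J * ?M) (Matrix.mat k k (\<lambda>(i, j). ?N i (k + j))) (0\<^sub>m k k) ?J)"
       "b < dim_col (four_block_mat (?J * ?M) (Matrix.mat k k (\<lambda>(i, j). ?N i (k + j))) (0\<^sub>m k k) ?J)"
    hence ab: "a < n" "b < n" by (auto simp: n_def)
    have "(?J * ?M) $$ (a, b) = ?N a b" if "a < k" "b < k"
    proof -
      have "(?J * ?M) $$ (a, b) = (\<Sum>l<k. (if a + l + 1 = k then 1 else 0) * (1 / fact (k + l - b)))"
        unfolding square_mat_times using that by simp
      also have "\<dots> = (\<Sum>l<k. if l = k - 1 - a then 1 / fact (k + l - b) else 0)"
        using that by (intro sum.cong) auto
      also have "\<dots> = 1 / fact (k + (k - 1 - a) - b)" using that by simp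
      also have "k + (k - 1 - a) - b = m a - b" using that by (auto simp: m_def n_def)
      finally show ?thesis using that by (auto simp: eps_def m_def n_def)
    qed
    moreover have "?N a b = 0" if "a \<ge> k" "b < k"
    proof -
      have "eps a + 1/2 = 0" "m a - b \<noteq> 0" using that ab by (auto simp: eps_def m_def n_def)
      thus ?thesis by (simp add: power_0_left)
    qed
    moreover have "?N a b = (if a - k + (b - k) + 1 = k then 1 else 0)" if "a \<ge> k" "b \<ge> k"
    proof -
      have e: "eps a + 1/2 = 0" and "(a - k + (b - k) + 1 = k) = (b = m a)"
        using that ab by (auto simp: eps_def m_def n_def)
      thus ?thesis unfolding e by (simp add: power_0_left)
    qed
    ultimately show "square_mat n ?N $$ (a, b) =
       four_block_mat (?J * ?M) (Matrix.mat k k (\<lambda>(i, j). ?N i (k + j))) (0\<^sub>m k k) ?J $$ (a, b)"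
      using ab unfolding n_def by (cases "a < k"; cases "b < k") (simp_all del: split_paired_All)
  qed (auto simp: n_def)
  also have "Determinant.det \<dots> = Determinant.det (?J * ?M) * Determinant.det ?J"
    by (rule det_four_block_mat_lower_left_zero[of _ k _ k]) auto
  also have "Determinant.det (?J * ?M) = Determinant.det ?J * Determinant.det ?M"
    by (rule Determinant.det_mult[of _ k]) auto
  finally have "Determinant.det (square_mat n ?R) = (Determinant.det ?J * Determinant.det ?J) * Determinant.det ?M"
    by (simp only: mult_ac)
  thus ?thesis unfolding det_antidiagonal_square det_inverse_factorial n_def by simp
qed

definition block_permutation :: "nat \<Rightarrow> (nat \<Rightarrow> nat) \<Rightarrow> (nat \<Rightarrow> nat) \<Rightarrow> nat \<Rightarrow> nat" where
  "block_permutation k p q = p \<circ> map_permutation {0..<k} (\<lambda>i. k + i) q"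

lemma block_permutation:
  assumes p: "p permutes {0..<k}" and q: "q permutes {0..<k}"
  shows "block_permutation k p q permutes {0..<2 * k}"
    and "signof (block_permutation k p q) = (signof p * signof q :: 'a::comm_ring_1)"
    and "a < k \<Longrightarrow> block_permutation k p q a = p a"
    and "a < k \<Longrightarrow> block_permutation k p q (k + a) = k + q a"
proof -
  let ?q = "map_permutation {0..<k} (\<lambda>i. k + i) q"
  have bij: "bij_betw (\<lambda>i. k + i) {0..<k} {k..<2 * k}"
    by (rule bij_betwI[of _ _ _ "\<lambda>i. i - k"]) auto
  have inj: "inj_on (\<lambda>i. k + i) {0..<k}" by auto
  have q': "?q permutes {k..<2 * k}"
    using map_permutation_permutes[OF bij q] .
  have q2: "?q permutes {0..<2 * k}" using q' by (rule permutes_subset) auto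
  have p2: "p permutes {0..<2 * k}" using p by (rule permutes_subset) auto
  show "block_permutation k p q permutes {0..<2 * k}"
    unfolding block_permutation_def using q2 p2 by (rule permutes_compose)
  show "signof (block_permutation k p q) = (signof p * signof q :: 'a)"
    unfolding block_permutation_def
    using signof_compose[OF p2 q2] sign_map_permutation[OF inj q] by simp
  show "block_permutation k p q a = p a" if "a < k"
    using permutes_not_in[OF q', of a] that by (simp add: block_permutation_def)
  have "q a < k" if "a < k" using permutes_in_image[OF q, of a] that by simp
  moreover have "?q (k + a) = k + q a" if "a < k"
    using map_permutation_apply[OF inj, of a q] that by simp
  ultimately show "block_permutation k p q (k + a) = k + q a" if "a < k"
    using permutes_not_in[OF p, of "k + q a"] that by (simp add: block_permutation_def)
qed

text \<open>For fixed \<open>p\<close> and \<open>q\<close> the sum over \<open>r\<close> is the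
  determinant of \<open>det_exp_coeff\<close> with its rows permuted inside the two blocks. The
  resulting sign is \<open>signof p * signof q\<close>, which the factor in front cancels, so each
  of the \<open>(fact k)\<^sup>2\<close> pairs contributes the same amount.\<close>

lemma sum_permutations_exp_coeff:
  "(\<Sum>p | p permutes {0..<k}. \<Sum>q | q permutes {0..<k}. \<Sum>r | r permutes {0..<2 * k}.
      signof p * signof q * signof r *
        (\<Prod>a<2 * k. exp_coeff k a (r a + (if a < k then p a else q (a - k))))) =
   (fact k)\<^sup>2 * (\<Prod>l<k. fact l / fact (k + l))"
proof -
  let ?R = "\<lambda>a b. exp_coeff k a (b + (if a < k then a else a - k))"
  let ?d = "Determinant.det (square_mat (2 * k) ?R)"
  have "(\<Sum>r | r permutes {0..<2 * k}. signof p * signof q * signof r *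
        (\<Prod>a<2 * k. exp_coeff k a (r a + (if a < k then p a else q (a - k))))) = ?d"
    if p: "p permutes {0..<k}" and q: "q permutes {0..<k}" for p q
  proof -
    note bp = block_permutation[OF p q]
    let ?f = "\<lambda>a b. exp_coeff k a (b + (if a < k then p a else q (a - k)))"
    have *: "block_permutation k p q a < 2 * k \<and> ?R (block_permutation k p q a) b = ?f a b"
      if "a < 2 * k" for a b
    proof (cases "a < k")
      case True
      thus ?thesis using bp(3)[of a] permutes_in_image[OF p, of a] by (simp add: exp_coeff_def)
    next
      case False
      then obtain a' where a': "a = k + a'" "a' < k" using \<open>a < 2 * k\<close> by (metis add_less_cancel_left le_add_diff_inverse mult_2 not_less)
      thus ?thesis using bp(4)[of a'] permutes_in_image[OF q, of a'] by (simp add: exp_coeff_def)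
    qed
    have "square_mat (2 * k) ?f =
       square_mat (2 * k) (\<lambda>i j. square_mat (2 * k) ?R $$ (block_permutation k p q i, j))"
      using * by (intro eq_matI) simp_all
    hence "Determinant.det (square_mat (2 * k) ?f) = signof (block_permutation k p q) * ?d"
      using Determinant.det_permute_rows[of "square_mat (2 * k) ?R" "2 * k", OF _ bp(1)] by simp
    hence "signof p * signof q * Determinant.det (square_mat (2 * k) ?f) = (signof p * signof p) * (signof q * signof q) * ?d"
      unfolding bp(2) by (simp only: mult_ac)
    also have "\<dots> = ?d" by (simp add: sign_def)
    finally show ?thesis by (simp add: det_square_mat sum_distrib_left mult_ac)
  qed
  hence "(\<Sum>p | p permutes {0..<k}. \<Sum>q | q permutes {0..<k}. \<Sum>r | r permutes {0..<2 * k}.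
      signof p * signof q * signof r *
        (\<Prod>a<2 * k. exp_coeff k a (r a + (if a < k then p a else q (a - k)))))
    = (\<Sum>p | p permutes {0..<k}. \<Sum>q | q permutes {0..<k}. ?d)"
    by (intro sum.cong refl) auto
  thus ?thesis by (simp add: card_permutations power2_eq_square det_exp_coeff)
qed

lemma Delta_eq_det: "Delta m z = Determinant.det (square_mat m (\<lambda>i j. z (Suc i) ^ j))"
proof -
  have "Delta m z = (\<Prod>j<m. \<Prod>i\<in>{1..<Suc j}. z (Suc j) - z i)"
    unfolding Delta_def by (rule prod.reindex_bij_witness[of _ Suc "\<lambda>j. j - 1"]) auto
  also have "\<dots> = (\<Prod>j<m. \<Prod>i<j. z (Suc j) - z (Suc i))"
    by (intro prod.cong refl prod.reindex_bij_witness[of _ Suc "\<lambda>j. j - 1"]) auto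
  finally show ?thesis by (simp add: det_vandermonde)
qed

lemma Delta_eq_sum:
  "Delta m z = (\<Sum>p | p permutes {0..<m}. signof p * (\<Prod>i<m. z (Suc i) ^ p i))"
  by (simp add: Delta_eq_det det_square_mat)

section \<open>Averages over the torus\<close>

definition circle_avg :: "nat \<Rightarrow> ((nat \<Rightarrow> real) \<Rightarrow> complex) \<Rightarrow> (nat \<Rightarrow> real) \<Rightarrow> complex" where
  "circle_avg j \<Phi> \<theta> = integral {0..1} (\<lambda>t. \<Phi> (\<theta>(j := t)))"

text \<open>The value is still a function of all angles, so that averages can be composed and
  interchanged; the coordinates outside \<open>1..n\<close> survive as parameters.\<close>

primrec torus_avg :: "nat \<Rightarrow> ((nat \<Rightarrow> real) \<Rightarrow> complex) \<Rightarrow> (nat \<Rightarrow> real) \<Rightarrow> complex" where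
  "torus_avg 0 \<Phi> = \<Phi>"
| "torus_avg (Suc n) \<Phi> = circle_avg (Suc n) (torus_avg n \<Phi>)"

lemma continuous_on_fun_upd:
  fixes f :: "'a::topological_space \<Rightarrow> nat \<Rightarrow> 'b::topological_space"
  assumes "continuous_on S f" "continuous_on S g"
  shows "continuous_on S (\<lambda>x. (f x)(j := g x))"
proof (rule continuous_on_coordinatewise_then_product)
  fix i
  have "continuous_on S (\<lambda>x. f x i)" using assms(1) by (rule continuous_on_product_then_coordinatewise)
  thus "continuous_on S (\<lambda>x. ((f x)(j := g x)) i)" using assms(2) by (cases "i = j") auto
qed

lemma continuous_circle_avg:
  assumes "continuous_on UNIV \<Phi>"
  shows "continuous_on UNIV (circle_avg j \<Phi>)"
proof -
  have "continuous_on (UNIV \<times> cbox 0 1) (\<lambda>(\<theta>, t). \<Phi> (\<theta>(j := t)))"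
    unfolding case_prod_unfold
    by (intro continuous_on_compose2[OF assms] continuous_on_fun_upd continuous_intros) auto
  from integral_continuous_on_param[OF this] show ?thesis
    unfolding circle_avg_def by simp
qed

lemma continuous_torus_avg:
  "continuous_on UNIV \<Phi> \<Longrightarrow> continuous_on UNIV (torus_avg n \<Phi>)"
  by (induction n) (auto intro: continuous_circle_avg)

lemma circle_avg_commute:
  assumes "continuous_on UNIV \<Phi>"
  shows "circle_avg i (circle_avg j \<Phi>) = circle_avg j (circle_avg i \<Phi>)"
proof (cases "i = j")
  case False
  show ?thesis
  proof
    fix \<theta>
    have "continuous_on (cbox (0, 0) (1, 1)) (\<lambda>(s, t). \<Phi> (\<theta>(i := s, j := t)))"
      unfolding case_prod_unfold
      by (intro continuous_on_compose2[OF assms] continuous_on_fun_upd continuous_intros) auto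
    from integral_swap_continuous[OF this]
    have "integral {0..1} (\<lambda>s. integral {0..1} (\<lambda>t. \<Phi> (\<theta>(i := s, j := t)))) =
          integral {0..1} (\<lambda>t. integral {0..1} (\<lambda>s. \<Phi> (\<theta>(i := s, j := t))))" by simp
    also have "\<dots> = integral {0..1} (\<lambda>t. integral {0..1} (\<lambda>s. \<Phi> (\<theta>(j := t, i := s))))"
      using False by (simp add: fun_upd_twist)
    finally show "circle_avg i (circle_avg j \<Phi>) \<theta> = circle_avg j (circle_avg i \<Phi>) \<theta>"
      unfolding circle_avg_def .
  qed
qed simp

lemma circle_avg_idem: "circle_avg j (circle_avg j \<Phi>) = circle_avg j \<Phi>"
  unfolding circle_avg_def by simp

lemma torus_avg_circle_avg_commute:
  "continuous_on UNIV \<Phi> \<Longrightarrow> torus_avg n (circle_avg j \<Phi>) = circle_avg j (torus_avg n \<Phi>)"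
  by (induction n) (simp_all add: circle_avg_commute continuous_torus_avg)

text \<open>Averages over different angles commute and averaging over one angle is idempotent, so an
  extra average is absorbed. This lets any variable be treated as the innermost one, where
  one-variable residue calculus applies.\<close>

lemma torus_avg_circle_avg:
  assumes "continuous_on UNIV \<Phi>" "j \<in> {1..n}"
  shows "torus_avg n (circle_avg j \<Phi>) = torus_avg n \<Phi>"
  using assms(2)
proof (induction n)
  case (Suc n)
  show ?case
  proof (cases "j = Suc n")
    case True
    thus ?thesis using assms(1) by (simp add: torus_avg_circle_avg_commute circle_avg_idem)
  next
    case False
    thus ?thesis using Suc by simp
  qed
qed simp

lemma torus_avg_fun_upd:
  "j \<notin> {1..n} \<Longrightarrow> torus_avg n \<Phi> (\<theta>(j := t)) = torus_avg n (\<lambda>\<theta>. \<Phi> (\<theta>(j := t))) \<theta>"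
proof (induction n arbitrary: \<theta>)
  case (Suc n)
  hence "torus_avg n \<Phi> (\<theta>(Suc n := s, j := t)) = torus_avg n (\<lambda>\<theta>. \<Phi> (\<theta>(j := t))) (\<theta>(Suc n := s))" for s
    by (intro Suc.IH) auto
  moreover have "\<theta>(j := t, Suc n := s) = \<theta>(Suc n := s, j := t)" for s
    using Suc.prems by (intro fun_upd_twist) auto
  ultimately show ?case by (simp only: torus_avg.simps circle_avg_def)
qed simp

lemma torus_avg_cmult: "torus_avg n (\<lambda>\<theta>. c * \<Phi> \<theta>) = (\<lambda>\<theta>. c * torus_avg n \<Phi> \<theta>)"
  by (induction n) (simp_all add: circle_avg_def fun_eq_iff)

lemma torus_avg_mult_outer:
  "j \<notin> {1..n} \<Longrightarrow> torus_avg n (\<lambda>\<theta>. \<Phi> \<theta> * g (\<theta> j)) = (\<lambda>\<theta>. torus_avg n \<Phi> \<theta> * g (\<theta> j))"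
  by (induction n) (auto simp: circle_avg_def fun_eq_iff)

lemma torus_avg_prod:
  "torus_avg n (\<lambda>\<theta>. \<Prod>a\<in>{1..n}. f a (\<theta> a)) \<theta> = (\<Prod>a\<in>{1..n}. integral {0..1} (f a))"
proof (induction n arbitrary: \<theta>)
  case (Suc n)
  have "torus_avg n (\<lambda>\<theta>. \<Prod>a\<in>{1..Suc n}. f a (\<theta> a)) =
      torus_avg n (\<lambda>\<theta>. (\<Prod>a\<in>{1..n}. f a (\<theta> a)) * f (Suc n) (\<theta> (Suc n)))"
    by simp
  also have "\<dots> = (\<lambda>\<theta>. torus_avg n (\<lambda>\<theta>. \<Prod>a\<in>{1..n}. f a (\<theta> a)) \<theta> * f (Suc n) (\<theta> (Suc n)))"
    by (rule torus_avg_mult_outer) simp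
  finally have "torus_avg n (\<lambda>\<theta>. \<Prod>a\<in>{1..Suc n}. f a (\<theta> a)) =
      (\<lambda>\<theta>. (\<Prod>a\<in>{1..n}. integral {0..1} (f a)) * f (Suc n) (\<theta> (Suc n)))"
    by (simp only: Suc.IH)
  thus ?case by (simp add: circle_avg_def)
qed simp

lemma circle_avg_add:
  assumes "continuous_on UNIV \<Phi>" "continuous_on UNIV \<Psi>"
  shows "circle_avg j (\<lambda>\<theta>. \<Phi> \<theta> + \<Psi> \<theta>) = (\<lambda>\<theta>. circle_avg j \<Phi> \<theta> + circle_avg j \<Psi> \<theta>)"
proof -
  have *: "(\<lambda>t. X (\<theta>(j := t))) integrable_on {0..1}" if "continuous_on UNIV X" for X :: "(nat \<Rightarrow> real) \<Rightarrow> complex" and \<theta>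
    by (intro integrable_continuous_interval continuous_on_compose2[OF that] continuous_on_fun_upd continuous_intros) auto
  show ?thesis unfolding circle_avg_def by (auto simp: fun_eq_iff integral_add * assms)
qed

lemma torus_avg_add:
  assumes "continuous_on UNIV \<Phi>" "continuous_on UNIV \<Psi>"
  shows "torus_avg n (\<lambda>\<theta>. \<Phi> \<theta> + \<Psi> \<theta>) = (\<lambda>\<theta>. torus_avg n \<Phi> \<theta> + torus_avg n \<Psi> \<theta>)"
  by (induction n) (simp_all add: circle_avg_add continuous_torus_avg assms)

lemma torus_avg_0: "torus_avg n (\<lambda>\<theta>. 0) = (\<lambda>\<theta>. 0)"
  by (induction n) (simp_all add: circle_avg_def fun_eq_iff)

lemma torus_avg_sum:
  assumes "finite I" "\<And>i. i \<in> I \<Longrightarrow> continuous_on UNIV (\<Phi> i)"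
  shows "torus_avg n (\<lambda>\<theta>. \<Sum>i\<in>I. \<Phi> i \<theta>) \<theta> = (\<Sum>i\<in>I. torus_avg n (\<Phi> i) \<theta>)"
  using assms
proof (induction I arbitrary: \<theta> rule: finite_induct)
  case (insert i I)
  have "torus_avg n (\<lambda>\<theta>. \<Phi> i \<theta> + (\<Sum>i\<in>I. \<Phi> i \<theta>)) = (\<lambda>\<theta>. torus_avg n (\<Phi> i) \<theta> + torus_avg n (\<lambda>\<theta>. \<Sum>i\<in>I. \<Phi> i \<theta>) \<theta>)"
    by (rule torus_avg_add) (auto intro!: continuous_intros insert.prems)
  thus ?case using insert by simp
qed (simp add: torus_avg_0)

section \<open>From contour integrals to averages over angles\<close>

lemma e_eq_cis: "e t = cis (2 * pi * t)"
  by (simp add: e_def cis_conv_exp mult_ac)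

lemma norm_e [simp]: "norm (e t) = 1" and e_nonzero [simp]: "e t \<noteq> 0"
  by (simp_all add: e_eq_cis)

lemma continuous_on_e [continuous_intros]:
  "continuous_on S f \<Longrightarrow> continuous_on S (\<lambda>x. e (f x))"
  unfolding e_def by (intro continuous_intros)

lemma contour_integral_circlepath_eq:
  "contour_integral (circlepath 0 r) f =
     2 * of_real pi * \<i> * integral {0..1} (\<lambda>t. of_real r * e t * f (of_real r * e t))"
proof -
  have "contour_integral (circlepath 0 r) f =
      integral {0..1} (\<lambda>t. 2 * of_real pi * \<i> * (of_real r * e t * f (of_real r * e t)))"
    unfolding contour_integral_integral vector_derivative_circlepath
    by (rule integral_cong) (simp add: circlepath e_def mult_ac)
  thus ?thesis by simp
qed

text \<open>The value 0 outside \<open>1..n\<close> agrees with the tuple from which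
  \<open>multi_circle_integral\<close> starts.\<close>

definition torus_point :: "nat \<Rightarrow> (nat \<Rightarrow> real) \<Rightarrow> (nat \<Rightarrow> real) \<Rightarrow> nat \<Rightarrow> complex" where
  "torus_point n r \<theta> = (\<lambda>j. if j \<in> {1..n} then of_real (r j) * e (\<theta> j) else 0)"

text \<open>Each variable contributes \<open>dz = 2 pi i z dt\<close>, whence the product of the
  coordinates. The base point \<open>\<theta>\<close> is arbitrary because only the angles
  \<open>1..n\<close> are read, and all of these are averaged out.\<close>

lemma multi_circle_integral_eq_torus_avg:
  "multi_circle_integral n r F = (2 * of_real pi * \<i>) ^ n *
     torus_avg n (\<lambda>\<theta>. (\<Prod>j\<in>{1..n}. torus_point n r \<theta> j) * F (torus_point n r \<theta>)) \<theta>"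
proof (induction n arbitrary: F \<theta>)
  case 0
  show ?case by (simp add: torus_point_def)
next
  case (Suc n)
  let ?c = "2 * of_real pi * \<i> :: complex"
  let ?Z = "torus_point (Suc n) r"
  let ?\<Phi> = "\<lambda>\<theta>. (\<Prod>j\<in>{1..Suc n}. ?Z \<theta> j) * F (?Z \<theta>)"
  have Z: "?Z (\<theta>(Suc n := t)) = (torus_point n r \<theta>)(Suc n := of_real (r (Suc n)) * e t)" for \<theta> t
    by (auto simp: torus_point_def fun_eq_iff)
  have "of_real (r (Suc n)) * e t * multi_circle_integral n r (\<lambda>z. F (z(Suc n := of_real (r (Suc n)) * e t)))
      = ?c ^ n * torus_avg n ?\<Phi> (\<theta>(Suc n := t))" for t
  proof -
    let ?w = "of_real (r (Suc n)) * e t"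
    have "torus_avg n ?\<Phi> (\<theta>(Suc n := t)) = torus_avg n (\<lambda>\<theta>. ?\<Phi> (\<theta>(Suc n := t))) \<theta>"
      by (rule torus_avg_fun_upd) simp
    also have "(\<lambda>\<theta>. ?\<Phi> (\<theta>(Suc n := t))) =
        (\<lambda>\<theta>. ?w * ((\<Prod>j\<in>{1..n}. torus_point n r \<theta> j) * F ((torus_point n r \<theta>)(Suc n := ?w))))"
    proof
      fix \<theta>
      have "(\<Prod>j\<in>{1..n}. ?Z (\<theta>(Suc n := t)) j) = (\<Prod>j\<in>{1..n}. torus_point n r \<theta> j)"
        by (rule prod.cong) (auto simp: Z)
      moreover have "?Z (\<theta>(Suc n := t)) (Suc n) = ?w" by (simp add: Z)
      ultimately show "?\<Phi> (\<theta>(Suc n := t)) =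
          ?w * ((\<Prod>j\<in>{1..n}. torus_point n r \<theta> j) * F ((torus_point n r \<theta>)(Suc n := ?w)))"
        by (simp only: prod.cl_ivl_Suc Z) (simp add: mult_ac)
    qed
    finally show ?thesis by (simp only: torus_avg_cmult Suc.IH[of _ \<theta>]) (simp add: mult_ac)
  qed
  thus ?case by (simp add: contour_integral_circlepath_eq circle_avg_def mult_ac)
qed

text \<open>The residue does not mention \<open>r\<close>: this is the source of the independence of
  the radii.\<close>

lemma circle_mean_eq_residue:
  assumes f: "f holomorphic_on ball 0 \<epsilon> - {0}" and r: "0 < r" "r < \<epsilon>"
  shows "integral {0..1} (\<lambda>t. f (of_real r * e t)) = residue (\<lambda>z. f z / z) 0"
proof -
  have "((\<lambda>z. f z / z) has_contour_integral 2 * pi * \<i> * residue (\<lambda>z. f z / z) 0) (circlepath 0 r)"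
    using r by (intro base_residue[of "ball 0 \<epsilon>"] holomorphic_intros f) auto
  hence "contour_integral (circlepath 0 r) (\<lambda>z. f z / z) = 2 * pi * \<i> * residue (\<lambda>z. f z / z) 0"
    by (rule contour_integral_unique)
  thus ?thesis using r by (simp add: contour_integral_circlepath_eq)
qed

section \<open>Independence of the radii\<close>

text \<open>Joint continuity serves the interchange of averages; holomorphy in one variable at a
  time, on the punctured disc, serves the residue theorem.\<close>

locale punctured_torus_function =
  fixes n :: nat and \<epsilon> :: real and F :: "(nat \<Rightarrow> complex) \<Rightarrow> complex"
  assumes cont: "continuous_on {z. \<forall>j\<in>{1..n}. z j \<noteq> 0 \<and> norm (z j) < \<epsilon>} F"
    and hol: "\<And>z j. \<forall>j\<in>{1..n}. z j \<noteq> 0 \<and> norm (z j) < \<epsilon> \<Longrightarrow> j \<in> {1..n} \<Longrightarrow>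
               (\<lambda>w. F (z(j := w))) holomorphic_on ball 0 \<epsilon> - {0}"
begin

lemma continuous_torus:
  assumes "\<And>j. j \<in> {1..n} \<Longrightarrow> 0 < r j \<and> r j < \<epsilon>"
  shows "continuous_on UNIV (\<lambda>\<theta>. F (torus_point n r \<theta>))"
proof (rule continuous_on_compose2[OF cont])
  show "continuous_on UNIV (torus_point n r)"
  proof (rule continuous_on_coordinatewise_then_product)
    fix i
    show "continuous_on UNIV (\<lambda>\<theta>. torus_point n r \<theta> i)"
      unfolding torus_point_def
      by (cases "i \<in> {1..n}") (auto intro!: continuous_intros continuous_on_product_coordinates)
  qed
  have "torus_point n r \<theta> j \<noteq> 0 \<and> norm (torus_point n r \<theta> j) < \<epsilon>" if "j \<in> {1..n}" for \<theta> j
    using assms[OF that] that by (simp add: torus_point_def norm_mult)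
  thus "torus_point n r ` UNIV \<subseteq> {z. \<forall>j\<in>{1..n}. z j \<noteq> 0 \<and> norm (z j) < \<epsilon>}" by blast
qed

text \<open>An extra innermost average over the angle \<open>j\<close> turns the integrand into a
  residue in that variable, which is the same for both radii; the extra average is then absorbed on
  both sides.\<close>

lemma torus_avg_radius_upd:
  assumes r: "\<And>j. j \<in> {1..n} \<Longrightarrow> 0 < r j \<and> r j < \<epsilon>" and j: "j \<in> {1..n}" and s: "0 < s" "s < \<epsilon>"
  shows "torus_avg n (\<lambda>\<theta>. F (torus_point n (r(j := s)) \<theta>)) = torus_avg n (\<lambda>\<theta>. F (torus_point n r \<theta>))"
proof -
  have r': "0 < (r(j := s)) i \<and> (r(j := s)) i < \<epsilon>" if "i \<in> {1..n}" for i using r[OF that] s by simp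
  have "circle_avg j (\<lambda>\<theta>. F (torus_point n (r(j := s)) \<theta>)) \<theta> = circle_avg j (\<lambda>\<theta>. F (torus_point n r \<theta>)) \<theta>" for \<theta>
  proof -
    let ?z = "torus_point n r \<theta>"
    have z: "?z i \<noteq> 0 \<and> norm (?z i) < \<epsilon>" if "i \<in> {1..n}" for i
      using r[OF that] that by (simp add: torus_point_def norm_mult)
    have up: "torus_point n (r(j := u)) (\<theta>(j := t)) = ?z(j := of_real u * e t)" for u t
      using j by (auto simp: torus_point_def fun_eq_iff)
    have "integral {0..1} (\<lambda>t. F (?z(j := of_real s * e t))) = integral {0..1} (\<lambda>t. F (?z(j := of_real (r j) * e t)))"
      using circle_mean_eq_residue[OF hol[of ?z j] s] circle_mean_eq_residue[OF hol[of ?z j]] r[OF j] z j by simp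
    thus ?thesis unfolding circle_avg_def up using up[of "r j"] by simp
  qed
  hence "circle_avg j (\<lambda>\<theta>. F (torus_point n (r(j := s)) \<theta>)) = circle_avg j (\<lambda>\<theta>. F (torus_point n r \<theta>))"
    by (rule ext)
  hence "torus_avg n (circle_avg j (\<lambda>\<theta>. F (torus_point n (r(j := s)) \<theta>))) = torus_avg n (circle_avg j (\<lambda>\<theta>. F (torus_point n r \<theta>)))"
    by simp
  moreover have "continuous_on UNIV (\<lambda>\<theta>. F (torus_point n (r(j := s)) \<theta>))"
    using r' by (rule continuous_torus)
  moreover have "continuous_on UNIV (\<lambda>\<theta>. F (torus_point n r \<theta>))"
    using r by (rule continuous_torus)
  ultimately show ?thesis using torus_avg_circle_avg[OF _ j] by metis
qed

lemma torus_avg_radius: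
  assumes r: "\<And>j. j \<in> {1..n} \<Longrightarrow> 0 < r j \<and> r j < \<epsilon>" and s: "\<And>j. j \<in> {1..n} \<Longrightarrow> 0 < s j \<and> s j < \<epsilon>"
  shows "torus_avg n (\<lambda>\<theta>. F (torus_point n s \<theta>)) = torus_avg n (\<lambda>\<theta>. F (torus_point n r \<theta>))"
proof -
  \<comment> \<open>The radii are exchanged one at a time: the first \<open>m\<close> have already
    been replaced.\<close>
  have "torus_avg n (\<lambda>\<theta>. F (torus_point n (\<lambda>j. if j \<le> m then s j else r j) \<theta>)) = torus_avg n (\<lambda>\<theta>. F (torus_point n r \<theta>))"
    if "m \<le> n" for m
    using that
  proof (induction m)
    case 0
    have "torus_point n (\<lambda>j. if j \<le> 0 then s j else r j) = torus_point n r"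
      by (auto simp: torus_point_def fun_eq_iff)
    thus ?case by simp
  next
    case (Suc m)
    let ?r = "\<lambda>j. if j \<le> m then s j else r j"
    have "(\<lambda>j. if j \<le> Suc m then s j else r j) = ?r(Suc m := s (Suc m))"
      by (auto simp: fun_eq_iff)
    moreover have "torus_avg n (\<lambda>\<theta>. F (torus_point n (?r(Suc m := s (Suc m))) \<theta>)) = torus_avg n (\<lambda>\<theta>. F (torus_point n ?r \<theta>))"
      by (rule torus_avg_radius_upd) (use r s[of "Suc m"] s Suc.prems in auto)
    ultimately show ?case using Suc by simp
  qed
  from this[of n] have "torus_avg n (\<lambda>\<theta>. F (torus_point n (\<lambda>j. if j \<le> n then s j else r j) \<theta>)) = torus_avg n (\<lambda>\<theta>. F (torus_point n r \<theta>))"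
    by simp
  moreover have "torus_point n (\<lambda>j. if j \<le> n then s j else r j) = torus_point n s"
    by (auto simp: torus_point_def fun_eq_iff)
  ultimately show ?thesis by simp
qed

text \<open>
  Coordinate \<open>0\<close> of \<open>\<theta>\<close>, over which \<open>torus_avg\<close> does not average, serves as the common radius.
\<close>
lemma torus_avg_shrink:
  assumes r: "\<And>j. j \<in> {1..n} \<Longrightarrow> 0 < r j \<and> r j < \<epsilon>" and "0 < \<delta>" "\<delta> \<le> \<epsilon>"
    and \<Phi>: "continuous_on UNIV \<Phi>"
    and eq: "\<And>\<rho> \<theta>. 0 < \<rho> \<Longrightarrow> \<rho> < \<delta> \<Longrightarrow> \<Phi> (\<theta>(0 := \<rho>)) = F (torus_point n (\<lambda>_. \<rho>) \<theta>)"
  shows "torus_avg n (\<lambda>\<theta>. F (torus_point n r \<theta>)) \<theta> = torus_avg n \<Phi> (\<theta>(0 := 0))"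
proof -
  let ?c = "torus_avg n (\<lambda>\<theta>. F (torus_point n r \<theta>)) \<theta>"
  \<comment> \<open>The average is constant for common radius in the open interval from 0 to
    \<open>\<delta>\<close>; continuity of the average of \<open>\<Phi>\<close> at radius 0 carries
    the constant over.\<close>
  have const: "torus_avg n \<Phi> (\<theta>(0 := \<rho>)) = ?c" if "0 < \<rho>" "\<rho> < \<delta>" for \<rho>
  proof -
    have "torus_avg n \<Phi> (\<theta>(0 := \<rho>)) = torus_avg n (\<lambda>\<theta>. F (torus_point n (\<lambda>_. \<rho>) \<theta>)) \<theta>"
      by (subst torus_avg_fun_upd) (use eq that in auto)
    also have "\<dots> = ?c" by (subst torus_avg_radius[of r]) (use r that \<open>\<delta> \<le> \<epsilon>\<close> in auto)
    finally show ?thesis .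
  qed
  have "continuous_on UNIV (\<lambda>\<rho>. torus_avg n \<Phi> (\<theta>(0 := \<rho>)))"
    by (intro continuous_on_compose2[OF continuous_torus_avg[OF \<Phi>]] continuous_on_fun_upd continuous_intros) auto
  hence "((\<lambda>\<rho>. torus_avg n \<Phi> (\<theta>(0 := \<rho>))) \<longlongrightarrow> torus_avg n \<Phi> (\<theta>(0 := 0))) (at_right 0)"
    by (auto simp: continuous_on_def intro: tendsto_within_subset)
  moreover have "((\<lambda>\<rho>. torus_avg n \<Phi> (\<theta>(0 := \<rho>))) \<longlongrightarrow> ?c) (at_right 0)"
    by (rule tendsto_eventually)
       (use \<open>0 < \<delta>\<close> const in \<open>auto simp: eventually_at_right_field intro!: exI[of _ \<delta>]\<close>)
  ultimately show ?thesis using tendsto_unique trivial_limit_at_right_real by metis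
qed

end

section \<open>The Euler product\<close>

text \<open>The M-test for products: \<open>norm ((\<Prod>k=m..n. f k x) - 1)\<close> is at most
  \<open>exp\<close> of the corresponding tail of \<open>M\<close>, minus 1, so the partial products
  are uniformly Cauchy.\<close>

lemma uniform_limit_prodinf_summable:
  fixes f :: "nat \<Rightarrow> 'a::topological_space \<Rightarrow> complex"
  assumes M: "summable M" and le: "\<And>n x. x \<in> X \<Longrightarrow> norm (f n x - 1) \<le> M n" and ne: "X \<noteq> {}"
  shows "uniform_limit X (\<lambda>N x. \<Prod>n<N. f n x) (\<lambda>x. \<Prod>n. f n x) sequentially"
proof -
  have M0: "M n \<ge> 0" for n using le ne norm_ge_zero order_trans by blast
  have bd: "(\<Prod>k\<in>K. 1 + norm (f k x - 1)) \<le> exp (\<Sum>k\<in>K. M k)" if "x \<in> X" for K x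
  proof -
    have "(\<Prod>k\<in>K. 1 + norm (f k x - 1)) \<le> exp (\<Sum>k\<in>K. norm (f k x - 1))"
      by (rule prod_le_exp_sum) simp
    also have "\<dots> \<le> exp (\<Sum>k\<in>K. M k)" using le[OF that] by (simp add: sum_mono)
    finally show ?thesis .
  qed
  have "uniformly_convergent_on X (\<lambda>N x. \<Prod>n<N. f n x)"
  proof (rule uniformly_convergent_prod_Cauchy)
    fix x m assume x: "x \<in> X"
    have "norm (\<Prod>k<m. f k x) \<le> (\<Prod>k<m. 1 + norm (f k x - 1))"
      unfolding prod_norm[symmetric]
    proof (intro prod_mono conjI)
      fix k
      have "norm (f k x) = norm (1 + (f k x - 1))" by simp
      also have "\<dots> \<le> 1 + norm (f k x - 1)" using norm_triangle_ineq[of 1 "f k x - 1"] by simp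
      finally show "norm (f k x) \<le> 1 + norm (f k x - 1)" .
    qed simp
    also have "\<dots> \<le> exp (\<Sum>k<m. M k)" by (rule bd[OF x])
    also have "\<dots> \<le> exp (suminf M)" using sum_le_suminf[OF M] M0 by simp
    finally show "norm (\<Prod>k<m. f k x) \<le> exp (suminf M)" .
  next
    fix \<epsilon> :: real assume \<epsilon>: "\<epsilon> > 0"
    \<comment> \<open>A tail sum below \<open>ln (1 + \<epsilon>)\<close> makes \<open>exp\<close>
      of it less than \<open>1 + \<epsilon>\<close>.\<close>
    hence "ln (1 + \<epsilon>) > 0" by simp
    then obtain N where N: "\<And>m n. m \<ge> N \<Longrightarrow> norm (\<Sum>k=m..n. M k) < ln (1 + \<epsilon>)"
      using M unfolding summable_Cauchy' by (metis summable_Cauchy atLeastLessThanSuc_atLeastAtMost M)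
    show "\<exists>M. \<forall>x\<in>X. \<forall>m\<ge>M. \<forall>n\<ge>m. dist (\<Prod>k=m..n. f k x) 1 < \<epsilon>"
    proof (intro exI[of _ N] ballI allI impI)
      fix x m n assume x: "x \<in> X" and m: "m \<ge> N"
      have "dist (\<Prod>k=m..n. f k x) 1 = norm ((\<Prod>k=m..n. 1 + (f k x - 1)) - 1)" by (simp add: dist_norm)
      also have "\<dots> \<le> (\<Prod>k=m..n. 1 + norm (f k x - 1)) - 1" by (rule norm_prod_minus1_le_prod_minus1)
      also have "\<dots> \<le> exp (\<Sum>k=m..n. M k) - 1" using bd[OF x] by simp
      also have "exp (\<Sum>k=m..n. M k) < exp (ln (1 + \<epsilon>))" using N[OF m, of n] by simp
      also have "exp (ln (1 + \<epsilon>)) - 1 = \<epsilon>" using \<epsilon> by simp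
      finally show "dist (\<Prod>k=m..n. f k x) 1 < \<epsilon>" by simp
    qed
  qed
  then obtain l where l: "uniform_limit X (\<lambda>N x. \<Prod>n<N. f n x) l sequentially"
    unfolding uniformly_convergent_on_def by blast
  have "l x = (\<Prod>n. f n x)" if x: "x \<in> X" for x
  proof -
    have "summable (\<lambda>n. norm (f n x - 1))"
      using M le[OF x] by (intro summable_comparison_test[OF _ M]) auto
    hence "convergent_prod (\<lambda>n. f n x)"
      by (intro abs_convergent_prod_imp_convergent_prod summable_imp_abs_convergent_prod)
    hence "(\<lambda>N. \<Prod>n<N. f n x) \<longlonglongrightarrow> (\<Prod>n. f n x)"
      using convergent_prod_LIMSEQ LIMSEQ_lessThan_iff_atMost by blast
    moreover have "(\<lambda>N. \<Prod>n<N. f n x) \<longlonglongrightarrow> l x" using tendsto_uniform_limitI[OF l x] .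
    ultimately show ?thesis by (rule LIMSEQ_unique[symmetric])
  qed
  thus ?thesis using l by (subst uniform_limit_cong'[of X _ "\<lambda>N x. \<Prod>n<N. f n x" _ l]) auto
qed

section \<open>Expansion of the local factors to second order, uniformly in all parameters\<close>

text \<open>Over the filter \<open>principal I\<close>, membership in \<open>O\<close> means one
  constant valid for every parameter in \<open>I\<close>. As \<open>\<delta>\<close> is at most 1,
  orders may be lowered at will.\<close>

lemma bigo_const_power_mono:
  assumes "\<And>i. i \<in> I \<Longrightarrow> 0 \<le> \<delta> i \<and> \<delta> i \<le> (1::real)" "m \<le> n"
    "f \<in> O[principal I](\<lambda>i. complex_of_real (\<delta> i) ^ n)"
  shows "f \<in> O[principal I](\<lambda>i. complex_of_real (\<delta> i) ^ m)"
proof (rule landau_o.big.trans[OF assms(3)])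
  show "(\<lambda>i. complex_of_real (\<delta> i) ^ n) \<in> O[principal I](\<lambda>i. complex_of_real (\<delta> i) ^ m)"
    by (rule bigoI[of _ 1]) (use assms(1,2) in \<open>auto simp: eventually_principal norm_power intro!: power_decreasing\<close>)
qed

text \<open>The main terms are the complete homogeneous symmetric polynomials of degrees 0, 1 and 2.
  The bound \<open>b < 1\<close>, uniform over \<open>I\<close>, keeps
  \<open>inverse (1 - x j i)\<close> below \<open>1 / (1 - b)\<close>.\<close>

lemma prod_inverse_one_minus_expansion:
  fixes x :: "nat \<Rightarrow> 'i \<Rightarrow> complex" and \<delta> :: "'i \<Rightarrow> real"
  assumes \<delta>: "\<And>i. i \<in> I \<Longrightarrow> 0 \<le> \<delta> i \<and> \<delta> i \<le> b" and b: "b < 1"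
    and x: "\<And>j i. j < n \<Longrightarrow> i \<in> I \<Longrightarrow> norm (x j i) \<le> \<delta> i"
  shows "(\<lambda>i. (\<Prod>j<n. inverse (1 - x j i)) - (1 + (\<Sum>j<n. x j i) + (\<Sum>j<n. \<Sum>l\<le>j. x l i * x j i)))
           \<in> O[principal I](\<lambda>i. complex_of_real (\<delta> i) ^ 3)"
  using x
proof (induction n)
  case 0
  show ?case by simp
next
  case (Suc n)
  let ?F = "principal I" and ?d = "\<lambda>d i. complex_of_real (\<delta> i) ^ d"
  let ?S1 = "\<lambda>i. \<Sum>j<n. x j i" and ?S2 = "\<lambda>i. \<Sum>j<n. \<Sum>l\<le>j. x l i * x j i"
  let ?E = "\<lambda>i. (\<Prod>j<n. inverse (1 - x j i)) - (1 + ?S1 i + ?S2 i)"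
  let ?y = "x n" and ?v = "\<lambda>i. inverse (1 - x n i)"
  have \<delta>1: "0 \<le> \<delta> i \<and> \<delta> i \<le> 1" if "i \<in> I" for i using \<delta>[OF that] b by linarith
  have mono: "f \<in> O[?F](?d m')" if "m' \<le> n'" "f \<in> O[?F](?d n')" for f m' n'
    using \<delta>1 that by (rule bigo_const_power_mono)
  have X: "x j \<in> O[?F](?d 1)" if "j < Suc n" for j
    by (rule bigoI[of _ 1]) (use Suc.prems[OF that] \<delta>1 in \<open>auto simp: eventually_principal\<close>)
  have XX: "(\<lambda>i. x l i * x j i) \<in> O[?F](?d 2)" if "j < Suc n" "l < Suc n" for j l
    using landau_o.big.mult[OF X[OF that(2)] X[OF that(1)]] by (simp add: power2_eq_square)
  have v: "?v \<in> O[?F](?d 0)"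
  proof (rule bigoI[of _ "1 / (1 - b)"])
    show "\<forall>\<^sub>F i in ?F. norm (?v i) \<le> 1 / (1 - b) * norm (?d 0 i)"
      unfolding eventually_principal
    proof
      fix i assume i: "i \<in> I"
      have "1 - b \<le> 1 - norm (x n i)" using Suc.prems[of n i] \<delta>[OF i] i by simp
      also have "\<dots> \<le> norm (1 - x n i)" using norm_triangle_ineq2[of 1 "x n i"] by simp
      finally show "norm (?v i) \<le> 1 / (1 - b) * norm (?d 0 i)"
        using b by (simp add: norm_inverse norm_divide inverse_eq_divide frac_le)
    qed
  qed
  have S1: "?S1 \<in> O[?F](?d 1)" by (rule big_sum_in_bigo) (use X in auto)
  have S2: "?S2 \<in> O[?F](?d 2)" by (intro big_sum_in_bigo) (use XX in auto)
  have y: "?y \<in> O[?F](?d 1)" by (rule X) simp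
  have y2: "(\<lambda>i. ?y i ^ 2) \<in> O[?F](?d 2)" using XX[of n n] by (simp add: power2_eq_square)
  have yv: "(\<lambda>i. ?y i ^ 3 * ?v i) \<in> O[?F](?d 3)"
    using landau_o.big.mult[OF landau_o.big.mult[OF y2 y] v] by (simp add: power3_eq_cube power2_eq_square mult_ac)
  have E: "?E \<in> O[?F](?d 3)" by (rule Suc.IH) (use Suc.prems in auto)
  have one: "(\<lambda>i. 1) \<in> O[?F](?d 0)" by simp
  have t1: "(\<lambda>i. ?E i * ?v i) \<in> O[?F](?d 3)" using landau_o.big.mult[OF E v] by simp
  have t2: "(\<lambda>i. (1 + ?S1 i + ?S2 i) * (?y i ^ 3 * ?v i)) \<in> O[?F](?d 3)"
  proof -
    have "(\<lambda>i. 1 + ?S1 i + ?S2 i) \<in> O[?F](?d 0)"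
      by (intro sum_in_bigo one mono[OF _ S1] mono[OF _ S2]) auto
    from landau_o.big.mult[OF this yv] show ?thesis by simp
  qed
  have t3: "(\<lambda>i. ?S1 i * ?y i ^ 2) \<in> O[?F](?d 3)"
    using landau_o.big.mult[OF S1 y2] by (simp add: power3_eq_cube power2_eq_square mult_ac)
  have t4: "(\<lambda>i. ?S2 i * ?y i) \<in> O[?F](?d 3)"
    using landau_o.big.mult[OF S2 y] by (simp add: power3_eq_cube power2_eq_square mult_ac)
  have t5: "(\<lambda>i. ?S2 i * ?y i ^ 2) \<in> O[?F](?d 3)"
  proof (rule mono[of _ 4])
    show "(\<lambda>i. ?S2 i * ?y i ^ 2) \<in> O[?F](?d 4)"
      using landau_o.big.mult[OF S2 y2] by (simp flip: power_add)
  qed simp_all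
  have "(\<lambda>i. ?E i * ?v i + (1 + ?S1 i + ?S2 i) * (?y i ^ 3 * ?v i) + ?S1 i * ?y i ^ 2 + ?S2 i * ?y i + ?S2 i * ?y i ^ 2) \<in> O[?F](?d 3)"
    by (intro sum_in_bigo(1) t1 t2 t3 t4 t5)
  moreover have "(\<Prod>j<Suc n. inverse (1 - x j i)) - (1 + (\<Sum>j<Suc n. x j i) + (\<Sum>j<Suc n. \<Sum>l\<le>j. x l i * x j i)) =
     ?E i * ?v i + (1 + ?S1 i + ?S2 i) * (?y i ^ 3 * ?v i) + ?S1 i * ?y i ^ 2 + ?S2 i * ?y i + ?S2 i * ?y i ^ 2"
    if i: "i \<in> I" for i
  proof -
    have "1 - ?y i \<noteq> 0" using Suc.prems[of n i] \<delta>[OF i] b i by auto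
    \<comment> \<open>The geometric series cut after degree 2, with its exact remainder. The terms
      of order 3 and above that this produces are those estimated in \<open>t1\<close> to
      \<open>t5\<close>.\<close>
    hence v3: "?v i = 1 + ?y i + ?y i ^ 2 + ?y i ^ 3 * ?v i"
      by (simp add: field_simps power3_eq_cube power2_eq_square)
    have l: "(\<Sum>l\<le>n. x l i * x n i) = ?S1 i * ?y i + ?y i ^ 2"
      by (simp add: lessThan_Suc_atMost[symmetric] sum_distrib_right power2_eq_square)
    have "(\<Prod>j<Suc n. inverse (1 - x j i)) = ?E i * ?v i + (1 + ?S1 i + ?S2 i) * ?v i"
      by (simp add: algebra_simps)
    also have "(1 + ?S1 i + ?S2 i) * ?v i = (1 + ?S1 i + ?S2 i) * (1 + ?y i + ?y i ^ 2 + ?y i ^ 3 * ?v i)"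
      using v3 by simp
    finally show ?thesis unfolding sum.lessThan_Suc l by (simp add: algebra_simps power2_eq_square)
  qed
  ultimately show ?case
    by (subst landau_o.big.in_cong[where g = "\<lambda>i. ?E i * ?v i + (1 + ?S1 i + ?S2 i) * (?y i ^ 3 * ?v i) + ?S1 i * ?y i ^ 2 + ?S2 i * ?y i + ?S2 i * ?y i ^ 2"])
       (auto simp: eventually_principal)
qed

text \<open>Each \<open>y j\<close> is already of second order, so products of two of them are of
  order 4 and only the linear terms count.\<close>

lemma prod_one_minus_expansion:
  fixes y :: "'a \<Rightarrow> 'i \<Rightarrow> complex" and \<delta> :: "'i \<Rightarrow> real"
  assumes \<delta>: "\<And>i. i \<in> I \<Longrightarrow> 0 \<le> \<delta> i \<and> \<delta> i \<le> 1" and "finite J"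
    and y: "\<And>j. j \<in> J \<Longrightarrow> y j \<in> O[principal I](\<lambda>i. complex_of_real (\<delta> i) ^ 2)"
  shows "(\<lambda>i. (\<Prod>j\<in>J. 1 - y j i) - (1 - (\<Sum>j\<in>J. y j i))) \<in> O[principal I](\<lambda>i. complex_of_real (\<delta> i) ^ 3)"
  using \<open>finite J\<close> y
proof (induction J rule: finite_induct)
  case (insert a J)
  let ?F = "principal I" and ?d = "\<lambda>d i. complex_of_real (\<delta> i) ^ d"
  let ?S = "\<lambda>i. \<Sum>j\<in>J. y j i" and ?E = "\<lambda>i. (\<Prod>j\<in>J. 1 - y j i) - (1 - (\<Sum>j\<in>J. y j i))"
  have mono: "f \<in> O[?F](?d m')" if "m' \<le> n'" "f \<in> O[?F](?d n')" for f m' n'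
    using \<delta> that by (rule bigo_const_power_mono)
  have ya: "y a \<in> O[?F](?d 2)" by (rule insert.prems) simp
  have E: "?E \<in> O[?F](?d 3)" by (rule insert.IH) (use insert.prems in auto)
  have S: "?S \<in> O[?F](?d 2)" by (rule big_sum_in_bigo) (use insert.prems in auto)
  have "(\<lambda>i. 1 - y a i) \<in> O[?F](?d 0)" by (intro sum_in_bigo mono[OF _ ya]) auto
  from landau_o.big.mult[OF E this] have t1: "(\<lambda>i. ?E i * (1 - y a i)) \<in> O[?F](?d 3)" by simp
  have t2: "(\<lambda>i. ?S i * y a i) \<in> O[?F](?d 3)"
  proof (rule mono[of _ 4])
    show "(\<lambda>i. ?S i * y a i) \<in> O[?F](?d 4)"
      using landau_o.big.mult[OF S ya] by (simp flip: power_add)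
  qed simp_all
  have "(\<lambda>i. ?E i * (1 - y a i) + ?S i * y a i) \<in> O[?F](?d 3)" by (intro sum_in_bigo t1 t2)
  moreover have "?E i * (1 - y a i) + ?S i * y a i =
     (\<Prod>j\<in>insert a J. 1 - y j i) - (1 - (\<Sum>j\<in>insert a J. y j i))" for i
    using insert.hyps by (simp add: algebra_simps)
  ultimately show ?case by (simp only:)
qed simp

text \<open>For use with powers of \<open>e \<theta>\<close> in \<open>X\<close> and of
  \<open>e (- \<theta>)\<close> in \<open>Y\<close>: among the terms of order at most 2 only 1 and
  \<open>X1 * Y1\<close> are then free of the angle and survive integration.\<close>

lemma pair_expansion:
  fixes \<delta> :: "'i \<Rightarrow> real"
  assumes \<delta>: "\<And>i. i \<in> I \<Longrightarrow> 0 \<le> \<delta> i \<and> \<delta> i \<le> 1"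
    and X: "(\<lambda>i. X i - (1 + X1 i + X2 i)) \<in> O[principal I](\<lambda>i. complex_of_real (\<delta> i) ^ 3)"
    and Y: "(\<lambda>i. Y i - (1 + Y1 i + Y2 i)) \<in> O[principal I](\<lambda>i. complex_of_real (\<delta> i) ^ 3)"
    and X1: "X1 \<in> O[principal I](\<lambda>i. complex_of_real (\<delta> i) ^ 1)"
    and Y1: "Y1 \<in> O[principal I](\<lambda>i. complex_of_real (\<delta> i) ^ 1)"
    and X2: "X2 \<in> O[principal I](\<lambda>i. complex_of_real (\<delta> i) ^ 2)"
    and Y2: "Y2 \<in> O[principal I](\<lambda>i. complex_of_real (\<delta> i) ^ 2)"
  shows "(\<lambda>i. X i * Y i - (1 + X1 i + Y1 i + X2 i + Y2 i + X1 i * Y1 i))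
           \<in> O[principal I](\<lambda>i. complex_of_real (\<delta> i) ^ 3)"
proof -
  let ?F = "principal I" and ?d = "\<lambda>d i. complex_of_real (\<delta> i) ^ d"
  have mono: "f \<in> O[?F](?d m')" if "m' \<le> n'" "f \<in> O[?F](?d n')" for f m' n'
    using \<delta> that by (rule bigo_const_power_mono)
  have one: "(\<lambda>i. 1) \<in> O[?F](?d 0)" by simp
  have a: "(\<lambda>i. 1 + X1 i + X2 i) \<in> O[?F](?d 0)"
    by (intro sum_in_bigo one mono[OF _ X1] mono[OF _ X2]) auto
  have "(\<lambda>i. (Y i - (1 + Y1 i + Y2 i)) + (1 + Y1 i + Y2 i)) \<in> O[?F](?d 0)"
    by (intro sum_in_bigo one mono[OF _ Y1] mono[OF _ Y2] mono[OF _ Y]) auto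
  hence b: "Y \<in> O[?F](?d 0)" by simp
  have t1: "(\<lambda>i. X1 i * Y2 i) \<in> O[?F](?d 3)" "(\<lambda>i. X2 i * Y1 i) \<in> O[?F](?d 3)"
    using landau_o.big.mult[OF X1 Y2] landau_o.big.mult[OF X2 Y1]
    by (simp_all add: power3_eq_cube power2_eq_square mult_ac)
  have t2: "(\<lambda>i. X2 i * Y2 i) \<in> O[?F](?d 3)"
  proof (rule mono[of _ 4])
    show "(\<lambda>i. X2 i * Y2 i) \<in> O[?F](?d 4)"
      using landau_o.big.mult[OF X2 Y2] by (simp flip: power_add)
  qed simp_all
  have t3: "(\<lambda>i. (X i - (1 + X1 i + X2 i)) * Y i) \<in> O[?F](?d 3)"
    "(\<lambda>i. (1 + X1 i + X2 i) * (Y i - (1 + Y1 i + Y2 i))) \<in> O[?F](?d 3)"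
    using landau_o.big.mult[OF X b] landau_o.big.mult[OF a Y] by simp_all
  have "(\<lambda>i. X1 i * Y2 i + X2 i * Y1 i + X2 i * Y2 i + (X i - (1 + X1 i + X2 i)) * Y i
     + (1 + X1 i + X2 i) * (Y i - (1 + Y1 i + Y2 i))) \<in> O[?F](?d 3)"
    by (intro sum_in_bigo(1) t1 t2 t3)
  moreover have "X1 i * Y2 i + X2 i * Y1 i + X2 i * Y2 i + (X i - (1 + X1 i + X2 i)) * Y i
     + (1 + X1 i + X2 i) * (Y i - (1 + Y1 i + Y2 i)) = X i * Y i - (1 + X1 i + Y1 i + X2 i + Y2 i + X1 i * Y1 i)" for i
    by (simp add: algebra_simps)
  ultimately show ?thesis by (simp only:)
qed

lemma e_minus: "e (- t) = inverse (e t)"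
  by (simp add: e_def exp_minus)

lemma integral_e_power:
  fixes m :: nat
  assumes "m > 0"
  shows "integral {0..1} (\<lambda>t. e t ^ m) = 0" "integral {0..1} (\<lambda>t. e (- t) ^ m) = 0"
proof -
  have *: "integral {0..1} (\<lambda>t. exp (2 * of_real pi * \<i> * c * of_real t)) = 0"
    if c: "c \<in> {of_nat m, - of_nat m}" for c :: complex
  proof -
    let ?a = "2 * of_real pi * \<i> * c"
    have a: "?a \<noteq> 0" using c assms by auto
    have "((\<lambda>t. exp (?a * of_real t)) has_integral (exp (?a * of_real 1) / ?a - exp (?a * of_real 0) / ?a)) {0..1}"
    proof (rule fundamental_theorem_of_calculus)
      fix t :: real
      have "((\<lambda>z. exp (?a * z) / ?a) has_field_derivative exp (?a * of_real t)) (at (of_real t))"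
        using a by (auto intro!: derivative_eq_intros)
      from has_vector_derivative_real_field[OF this]
      show "((\<lambda>t. exp (?a * of_real t) / ?a) has_vector_derivative exp (?a * of_real t)) (at t within {0..1})" .
    qed simp
    moreover have "exp ?a = 1"
    proof -
      obtain n where "c = of_int n" using c by (metis insertE of_int_minus of_int_of_nat_eq singletonD)
      thus ?thesis by (auto simp: exp_eq_1)
    qed
    ultimately show ?thesis by (simp add: integral_unique)
  qed
  have "e t ^ m = exp (2 * of_real pi * \<i> * of_nat m * of_real t)" for t
    by (simp add: e_def exp_of_nat_mult[symmetric] mult_ac)
  thus "integral {0..1} (\<lambda>t. e t ^ m) = 0" using *[of "of_nat m"] by simp
  have "e (- t) ^ m = exp (2 * of_real pi * \<i> * (- of_nat m) * of_real t)" for t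
    by (simp add: e_def exp_of_nat_mult[symmetric] mult_ac)
  thus "integral {0..1} (\<lambda>t. e (- t) ^ m) = 0" using *[of "- of_nat m"] by simp
qed

lemma norm_inverse_nat_powr:
  "p > 0 \<Longrightarrow> norm (1 / of_nat p powr s :: complex) = real p powr (- Re s)"
  using norm_of_real_powr[of "real p" s] by (simp add: norm_divide powr_minus field_simps)

text \<open>
  In the region \<open>|z\<^sub>j| \<le> 1 / 12\<close> all of \<open>p powr (- 1 / 2 \<plusminus> z\<^sub>j)\<close> are bounded by
  \<open>\<delta> = p powr (- 5 / 12)\<close>. The terms of order \<open>\<delta>\<^sup>2\<close> of the integral cancel against those of the
  product in front of it, and what remains is of order \<open>\<delta>\<^sup>3\<close>, which is summable over \<open>p\<close>.
\<close>
lemma local_factor_estimate: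
  obtains C where "C > 0"
    "\<And>p z. p \<ge> 2 \<Longrightarrow> (\<forall>j\<in>{1..2 * k}. norm (z j) \<le> 1 / 12) \<Longrightarrow>
       norm (local_factor k z p - 1) \<le> C * real p powr (- 5 / 4)"
proof -
  \<comment> \<open>The angle is one of the parameters, so that the constants are uniform in it and
    the estimate can be integrated.\<close>
  define I where "I = {(p :: nat, z :: nat \<Rightarrow> complex, \<theta> :: real). p \<ge> 2 \<and> (\<forall>j\<in>{1..2 * k}. norm (z j) \<le> 1 / 12)}"
  define \<delta> where "\<delta> i = real (fst i) powr (- 5 / 12)" for i :: "nat \<times> (nat \<Rightarrow> complex) \<times> real"
  define b where "b = (2 :: real) powr (- 5 / 12)"
  have b: "b < 1" unfolding b_def by (rule powr_less_one) auto
  have \<delta>b: "0 \<le> \<delta> i \<and> \<delta> i \<le> b" if "i \<in> I" for i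
    using that unfolding \<delta>_def b_def I_def by (auto intro!: powr_mono2')
  have \<delta>1: "0 \<le> \<delta> i \<and> \<delta> i \<le> 1" if "i \<in> I" for i using \<delta>b[OF that] b by linarith
  let ?F = "principal I" and ?d = "\<lambda>d i. complex_of_real (\<delta> i) ^ d"
  have mono: "f \<in> O[?F](?d m')" if "m' \<le> n'" "f \<in> O[?F](?d n')" for f m' n'
    using \<delta>1 that by (rule bigo_const_power_mono)
  define q where "q j i = 1 / of_nat (fst i) powr (1/2 + fst (snd i) (Suc j))" for j and i :: "nat \<times> (nat \<Rightarrow> complex) \<times> real"
  define q' where "q' j i = 1 / of_nat (fst i) powr (1/2 - fst (snd i) (k + Suc j))" for j and i :: "nat \<times> (nat \<Rightarrow> complex) \<times> real"
  define u where "u i = e (snd (snd i))" for i :: "nat \<times> (nat \<Rightarrow> complex) \<times> real"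
  define u' where "u' i = e (- snd (snd i))" for i :: "nat \<times> (nat \<Rightarrow> complex) \<times> real"
  have q: "norm (q j i) \<le> \<delta> i" "norm (q' j i) \<le> \<delta> i" if "i \<in> I" "j < k" for i j
  proof -
    obtain p z \<theta> where i: "i = (p, z, \<theta>)" by (cases i)
    have p: "p \<ge> 2" and "norm (z (Suc j)) \<le> 1 / 12" "norm (z (k + Suc j)) \<le> 1 / 12"
      using that by (auto simp: I_def i)
    hence "\<bar>Re (z (Suc j))\<bar> \<le> 1 / 12" "\<bar>Re (z (k + Suc j))\<bar> \<le> 1 / 12"
      using abs_Re_le_cmod order_trans by blast+
    hence "- Re (1/2 + z (Suc j)) \<le> - 5 / 12" "- Re (1/2 - z (k + Suc j)) \<le> - 5 / 12" by auto
    moreover have "real p powr s \<le> real p powr (- 5 / 12)" if "s \<le> - 5 / 12" for s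
      using p that by (intro powr_mono) auto
    ultimately show "norm (q j i) \<le> \<delta> i" "norm (q' j i) \<le> \<delta> i"
      unfolding q_def q'_def \<delta>_def i fst_conv snd_conv using p
      by (simp_all only: norm_inverse_nat_powr[OF less_le_trans[OF zero_less_numeral p]])
  qed
  have nu: "norm (u i) = 1" "norm (u' i) = 1" "u i * u' i = 1" for i
    by (simp_all add: u_def u'_def e_minus norm_inverse)
  define X1 where "X1 i = (\<Sum>j<k. u i * q j i)" for i
  define Y1 where "Y1 i = (\<Sum>j<k. u' i * q' j i)" for i
  define X2 where "X2 i = (\<Sum>j<k. \<Sum>l\<le>j. (u i * q l i) * (u i * q j i))" for i
  define Y2 where "Y2 i = (\<Sum>j<k. \<Sum>l\<le>j. (u' i * q' l i) * (u' i * q' j i))" for i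
  define XY where "XY i = (\<Prod>j<k. inverse (1 - u i * q j i)) * (\<Prod>j<k. inverse (1 - u' i * q' j i))" for i
  have uq: "norm (u i * q j i) \<le> \<delta> i" "norm (u' i * q' j i) \<le> \<delta> i" if "i \<in> I" "j < k" for i j
    using q[OF that] by (simp_all add: norm_mult nu)
  have O1: "(\<lambda>i. u i * q j i) \<in> O[?F](?d 1)" "(\<lambda>i. u' i * q' j i) \<in> O[?F](?d 1)" if "j < k" for j
    by (rule bigoI[of _ 1]; use uq[OF _ that] \<delta>1 in \<open>auto simp: eventually_principal\<close>)+
  have O11: "X1 \<in> O[?F](?d 1)" "Y1 \<in> O[?F](?d 1)"
    unfolding X1_def Y1_def by (rule big_sum_in_bigo; use O1 in auto)+
  have O22: "X2 \<in> O[?F](?d 2)" "Y2 \<in> O[?F](?d 2)"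
    unfolding X2_def Y2_def using landau_o.big.mult[OF O1(1) O1(1)] landau_o.big.mult[OF O1(2) O1(2)]
    by (intro big_sum_in_bigo; simp add: power2_eq_square)+
  have XE: "(\<lambda>i. (\<Prod>j<k. inverse (1 - u i * q j i)) - (1 + X1 i + X2 i)) \<in> O[?F](?d 3)"
    unfolding X1_def X2_def using \<delta>b b uq(1) by (rule prod_inverse_one_minus_expansion)
  have YE: "(\<lambda>i. (\<Prod>j<k. inverse (1 - u' i * q' j i)) - (1 + Y1 i + Y2 i)) \<in> O[?F](?d 3)"
    unfolding Y1_def Y2_def using \<delta>b b uq(2) by (rule prod_inverse_one_minus_expansion)
  have "(\<lambda>i. XY i - (1 + X1 i + Y1 i + X2 i + Y2 i + X1 i * Y1 i)) \<in> O[?F](?d 3)"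
    unfolding XY_def using \<delta>1 XE YE O11 O22 by (rule pair_expansion)
  then obtain C where C: "C > 0" "\<And>i. i \<in> I \<Longrightarrow> norm (XY i - (1 + X1 i + Y1 i + X2 i + Y2 i + X1 i * Y1 i)) \<le> C * norm (?d 3 i)"
    by (elim landau_o.bigE) (auto simp: eventually_principal)
  \<comment> \<open>The second-order term on both sides: the integral is \<open>1 + T\<close> and
    the product in front of it is \<open>1 - T\<close>, each up to third order.\<close>
  define T where "T i = (\<Sum>(j, l)\<in>{..<k} \<times> {..<k}. q j i * q' l i)" for i
  define J where "J i = integral {0..1} (\<lambda>\<theta>. XY (fst i, fst (snd i), \<theta>))" for i :: "nat \<times> (nat \<Rightarrow> complex) \<times> real"
  have "norm (J i - (1 + T i)) \<le> C * norm (?d 3 i)" if iI: "i \<in> I" for i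
  proof -
    obtain p z \<theta>0 where i: "i = (p, z, \<theta>0)" by (cases i)
    have mem: "(p, z, \<theta>) \<in> I" for \<theta> using iI by (simp add: I_def i)
    define a1 where "a1 = (\<Sum>j<k. q j i)"
    define b1 where "b1 = (\<Sum>j<k. q' j i)"
    define a2 where "a2 = (\<Sum>j<k. \<Sum>l\<le>j. q l i * q j i)"
    define b2 where "b2 = (\<Sum>j<k. \<Sum>l\<le>j. q' l i * q' j i)"
    let ?M = "\<lambda>\<theta>. 1 + e \<theta> ^ 1 * a1 + e (- \<theta>) ^ 1 * b1 + e \<theta> ^ 2 * a2 + e (- \<theta>) ^ 2 * b2 + a1 * b1"
    have T: "T i = a1 * b1"
      by (simp add: T_def a1_def b1_def sum_product sum.cartesian_product)
    have qi: "q j (p, z, \<theta>) = q j i" "q' j (p, z, \<theta>) = q' j i" for j \<theta> by (simp_all add: q_def q'_def i)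
    have M: "1 + X1 (p, z, \<theta>) + Y1 (p, z, \<theta>) + X2 (p, z, \<theta>) + Y2 (p, z, \<theta>) + X1 (p, z, \<theta>) * Y1 (p, z, \<theta>) = ?M \<theta>" for \<theta>
    proof -
      have "X1 (p, z, \<theta>) = e \<theta> * a1" "Y1 (p, z, \<theta>) = e (- \<theta>) * b1"
        "X2 (p, z, \<theta>) = e \<theta> ^ 2 * a2" "Y2 (p, z, \<theta>) = e (- \<theta>) ^ 2 * b2"
        by (simp_all add: X1_def Y1_def X2_def Y2_def qi a1_def b1_def a2_def b2_def u_def u'_def
             sum_distrib_left power2_eq_square mult_ac)
      moreover have "e \<theta> * e (- \<theta>) = 1" by (simp add: e_minus)
      hence "(e \<theta> * a1) * (e (- \<theta>) * b1) = a1 * b1" by (metis mult.assoc mult.commute mult.left_commute mult_1)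
      ultimately show ?thesis by simp
    qed
    have cont: "continuous_on {0..1} (\<lambda>\<theta>. XY (p, z, \<theta>))"
    proof -
      have "1 - u (p, z, \<theta>) * q j (p, z, \<theta>) \<noteq> 0" "1 - u' (p, z, \<theta>) * q' j (p, z, \<theta>) \<noteq> 0" if "j < k" for j \<theta>
        using uq[OF mem that, of \<theta>] \<delta>b[OF mem, of \<theta>] b by auto
      moreover have "p \<noteq> 0" using iI by (auto simp: I_def i)
      ultimately show ?thesis unfolding XY_def u_def u'_def q_def q'_def
        by (auto intro!: continuous_intros)
    qed
    have contM: "continuous_on {0..1} ?M" by (intro continuous_intros)
    have "integral {0..1} ?M = 1 + integral {0..1} (\<lambda>\<theta>. e \<theta> ^ 1) * a1 + integral {0..1} (\<lambda>\<theta>. e (- \<theta>) ^ 1) * b1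
        + integral {0..1} (\<lambda>\<theta>. e \<theta> ^ 2) * a2 + integral {0..1} (\<lambda>\<theta>. e (- \<theta>) ^ 2) * b2 + a1 * b1"
      by (subst integral_add, (intro integrable_continuous_interval continuous_intros)+)+ simp
    also have "\<dots> = 1 + T i" by (simp only: integral_e_power T) simp
    finally have iM: "integral {0..1} ?M = 1 + T i" .
    have Ji: "J i = integral {0..1} (\<lambda>\<theta>. XY (p, z, \<theta>))" by (simp add: J_def i)
    have "J i - (1 + T i) = integral {0..1} (\<lambda>\<theta>. XY (p, z, \<theta>) - ?M \<theta>)"
      unfolding iM[symmetric] Ji
      by (rule integral_diff[symmetric]; intro integrable_continuous_interval cont contM)
    also have "norm \<dots> \<le> C * norm (?d 3 i) * (1 - 0)"
    proof (rule integral_bound)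
      show "continuous_on {0..1} (\<lambda>\<theta>. XY (p, z, \<theta>) - ?M \<theta>)" by (intro continuous_on_diff cont contM)
      fix \<theta> :: real
      show "norm (XY (p, z, \<theta>) - ?M \<theta>) \<le> C * norm (?d 3 i)"
        using C(2)[OF mem, of \<theta>] unfolding M by (simp add: \<delta>_def i)
    qed simp
    finally show ?thesis by simp
  qed
  hence J: "(\<lambda>i. J i - (1 + T i)) \<in> O[?F](?d 3)"
    by (intro bigoI[of _ C]) (auto simp: eventually_principal)
  have qq: "(\<lambda>i. q j i * q' l i) \<in> O[?F](?d 2)" if "j < k" "l < k" for j l
  proof -
    have "q j \<in> O[?F](?d 1)" "q' l \<in> O[?F](?d 1)"
      by (rule bigoI[of _ 1]; use q that \<delta>1 in \<open>auto simp: eventually_principal\<close>)+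
    from landau_o.big.mult[OF this] show ?thesis by (simp add: power2_eq_square)
  qed
  have T: "T \<in> O[?F](?d 2)"
    unfolding T_def by (rule big_sum_in_bigo) (use qq in auto)
  define Pr where "Pr i = (\<Prod>(j, l)\<in>{..<k} \<times> {..<k}. 1 - q j i * q' l i)" for i
  have Pr: "(\<lambda>i. Pr i - (1 - T i)) \<in> O[?F](?d 3)"
    unfolding Pr_def T_def case_prod_unfold
    by (rule prod_one_minus_expansion[OF \<delta>1]) (use qq in auto)
  have one: "(\<lambda>i. 1) \<in> O[?F](?d 0)" by simp
  have t1: "(\<lambda>i. T i * T i) \<in> O[?F](?d 3)"
  proof (rule mono[of _ 4])
    show "(\<lambda>i. T i * T i) \<in> O[?F](?d 4)"
      using landau_o.big.mult[OF T T] by (simp flip: power_add)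
  qed simp_all
  have "(\<lambda>i. (J i - (1 + T i)) + (1 + T i)) \<in> O[?F](?d 0)"
    by (intro sum_in_bigo one mono[OF _ T] mono[OF _ J]) auto
  hence "J \<in> O[?F](?d 0)" by simp
  from landau_o.big.mult[OF Pr this] have t2: "(\<lambda>i. (Pr i - (1 - T i)) * J i) \<in> O[?F](?d 3)" by simp
  have "(\<lambda>i. 1 - T i) \<in> O[?F](?d 0)" by (intro sum_in_bigo one mono[OF _ T]) auto
  from landau_o.big.mult[OF this J] have t3: "(\<lambda>i. (1 - T i) * (J i - (1 + T i))) \<in> O[?F](?d 3)" by simp
  \<comment> \<open>By \<open>(1 - T) * (1 + T) = 1 - T * T\<close> this combination is
    \<open>Pr * J - 1\<close>; the last term is even of order 4.\<close>
  have "(\<lambda>i. (Pr i - (1 - T i)) * J i + (1 - T i) * (J i - (1 + T i)) - T i * T i) \<in> O[?F](?d 3)"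
    by (intro sum_in_bigo t1 t2 t3)
  hence "(\<lambda>i. Pr i * J i - 1) \<in> O[?F](?d 3)" by (simp add: algebra_simps)
  then obtain C where C: "C > 0" "\<And>i. i \<in> I \<Longrightarrow> norm (Pr i * J i - 1) \<le> C * norm (?d 3 i)"
    by (elim landau_o.bigE) (auto simp: eventually_principal)
  show thesis
  proof (rule that[OF C(1)])
    fix p :: nat and z :: "nat \<Rightarrow> complex"
    assume p: "p \<ge> 2" and z: "\<forall>j\<in>{1..2 * k}. norm (z j) \<le> 1 / 12"
    \<comment> \<open>The angle 0 is a placeholder: neither \<open>Pr\<close> nor \<open>J\<close>
      depends on the third component.\<close>
    have mem: "(p, z, 0) \<in> I" using p z by (simp add: I_def)
    have qq: "q j (p, z, 0) * q' l (p, z, 0) = 1 / of_nat p powr (1 + z (Suc j) - z (k + Suc l))" for j l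
    proof -
      have "(of_nat p :: complex) powr (1/2 + z (Suc j)) * of_nat p powr (1/2 - z (k + Suc l)) = of_nat p powr (1 + z (Suc j) - z (k + Suc l))"
        by (simp flip: powr_add add: add_diff_eq)
      thus ?thesis by (simp add: q_def q'_def)
    qed
    have sh: "(\<Prod>i\<in>{1..k}. f i) = (\<Prod>j<k. f (Suc j))" for f :: "nat \<Rightarrow> complex"
      by (rule prod.reindex_bij_witness[of _ Suc "\<lambda>j. j - 1"]) auto
    have "local_factor k z p = Pr (p, z, 0) * J (p, z, 0)"
      unfolding local_factor_def Pr_def J_def XY_def sh prod.cartesian_product[symmetric] qq
      by (simp add: q_def q'_def u_def u'_def prod.distrib)
    hence "norm (local_factor k z p - 1) \<le> C * norm (?d 3 (p, z, 0))" using C(2)[OF mem] by simp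
    also have "norm (?d 3 (p, z, 0)) = real p powr (- 5 / 4)"
      using p by (simp add: \<delta>_def norm_power powr_power)
    finally show "norm (local_factor k z p - 1) \<le> C * real p powr (- 5 / 4)" .
  qed
qed

section \<open>Continuity and separate holomorphy of the Euler product\<close>

text \<open>What differentiation under the integral sign asks for, bundled in a form closed under
  products, so that it has to be checked only for single factors.\<close>

definition differentiable_param :: "complex set \<Rightarrow> (complex \<Rightarrow> real \<Rightarrow> complex) \<Rightarrow> bool" where
  "differentiable_param U f \<longleftrightarrow> continuous_on (U \<times> {0..1}) (\<lambda>(w, t). f w t) \<and>
     (\<exists>f'. continuous_on (U \<times> {0..1}) (\<lambda>(w, t). f' w t) \<and>
       (\<forall>w\<in>U. \<forall>t\<in>{0..1}. ((\<lambda>w. f w t) has_field_derivative f' w t) (at w within U)))"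

lemma differentiable_param_mult:
  assumes "differentiable_param U f" "differentiable_param U g"
  shows "differentiable_param U (\<lambda>w t. f w t * g w t)"
proof -
  obtain f' where f: "continuous_on (U \<times> {0..1}) (\<lambda>(w, t). f w t)" "continuous_on (U \<times> {0..1}) (\<lambda>(w, t). f' w t)"
     "\<forall>w\<in>U. \<forall>t\<in>{0..1}. ((\<lambda>w. f w t) has_field_derivative f' w t) (at w within U)"
    using assms(1) unfolding differentiable_param_def by blast
  obtain g' where g: "continuous_on (U \<times> {0..1}) (\<lambda>(w, t). g w t)" "continuous_on (U \<times> {0..1}) (\<lambda>(w, t). g' w t)"
     "\<forall>w\<in>U. \<forall>t\<in>{0..1}. ((\<lambda>w. g w t) has_field_derivative g' w t) (at w within U)"
    using assms(2) unfolding differentiable_param_def by blast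
  show ?thesis unfolding differentiable_param_def
  proof (intro conjI exI[of _ "\<lambda>w t. f w t * g' w t + f' w t * g w t"] ballI)
    show "continuous_on (U \<times> {0..1}) (\<lambda>(w, t). f w t * g w t)"
      using f(1) g(1) unfolding case_prod_unfold by (intro continuous_intros)
    show "continuous_on (U \<times> {0..1}) (\<lambda>(w, t). f w t * g' w t + f' w t * g w t)"
      using f(1,2) g(1,2) unfolding case_prod_unfold by (intro continuous_intros)
    fix w and t :: real assume "w \<in> U" "t \<in> {0..1}"
    thus "((\<lambda>w. f w t * g w t) has_field_derivative f w t * g' w t + f' w t * g w t) (at w within U)"
      using f(3) g(3) by (intro DERIV_mult') auto
  qed
qed

lemma differentiable_param_const:
  "continuous_on {0..1} c \<Longrightarrow> differentiable_param U (\<lambda>w. c)"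
  unfolding differentiable_param_def case_prod_unfold
  by (auto intro!: exI[of _ "\<lambda>w t. 0"] continuous_intros continuous_on_compose2[of "{0..1}" c])

lemma differentiable_param_prod:
  assumes "finite J" "\<And>j. j \<in> J \<Longrightarrow> differentiable_param U (f j)"
  shows "differentiable_param U (\<lambda>w t. \<Prod>j\<in>J. f j w t)"
  using assms
proof (induction J rule: finite_induct)
  case empty
  show ?case using differentiable_param_const[of "\<lambda>_. 1"] by simp
next
  case (insert j J)
  thus ?case using differentiable_param_mult[of U "f j" "\<lambda>w t. \<Prod>j\<in>J. f j w t"] by simp
qed

lemma holomorphic_integral_param:
  assumes "differentiable_param U f" "convex U"
  shows "(\<lambda>w. integral {0..1} (f w)) holomorphic_on U"
proof -
  obtain f' where f: "continuous_on (U \<times> {0..1}) (\<lambda>(w, t). f w t)" "continuous_on (U \<times> {0..1}) (\<lambda>(w, t). f' w t)"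
     "\<forall>w\<in>U. \<forall>t\<in>{0..1}. ((\<lambda>w. f w t) has_field_derivative f' w t) (at w within U)"
    using assms(1) unfolding differentiable_param_def by blast
  have "f w integrable_on {0..1}" if "w \<in> U" for w
    by (intro integrable_continuous_interval continuous_on_compose2[OF f(1), of _ "\<lambda>t. (w, t)", simplified] continuous_intros)
       (use that in auto)
  thus ?thesis
    using leibniz_rule_holomorphic[of U 0 1 f f'] f assms(2) by simp
qed

lemma norm_e_div_powr_less_1:
  assumes "p \<ge> (2::nat)" "norm s \<le> 1 / 12"
  shows "norm (e t / of_nat p powr (1/2 + s)) < 1"
proof -
  have "\<bar>Re s\<bar> \<le> 1 / 12" using assms(2) abs_Re_le_cmod order_trans by blast
  hence "- Re (1/2 + s) < 0" by simp
  hence "real p powr (- Re (1/2 + s)) < 1" using assms(1) by (intro powr_less_one) auto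
  thus ?thesis
    using norm_inverse_nat_powr[of p "1/2 + s"] assms(1) by (simp add: norm_divide)
qed

lemma one_minus_e_div_powr_nonzero:
  assumes "p \<ge> (2::nat)" "norm s \<le> 1 / 12"
  shows "1 - e t / of_nat p powr (1/2 + s) \<noteq> 0"
  using norm_e_div_powr_less_1[OF assms, of t] by auto

text \<open>\<open>P w\<close> stands for \<open>of_nat p powr (1/2 + w)\<close> or
  \<open>of_nat p powr (1/2 - w)\<close>; both satisfy \<open>P' = L * P\<close>, with
  \<open>L\<close> the logarithm of \<open>p\<close> or its negative.\<close>

lemma has_field_derivative_inverse_one_minus:
  fixes P :: "complex \<Rightarrow> complex"
  assumes "(P has_field_derivative L * P w) (at w within U)" "P w \<noteq> 0" "1 - E / P w \<noteq> 0"
  shows "((\<lambda>w. inverse (1 - E / P w)) has_field_derivative - (E * L / P w) / (1 - E / P w)\<^sup>2) (at w within U)"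
proof -
  have "((\<lambda>w. E / P w) has_field_derivative - (E * L / P w)) (at w within U)"
    by (rule derivative_eq_intros assms(1,2) refl)+ (use assms(2) in \<open>simp add: field_simps\<close>)
  hence "((\<lambda>w. 1 - E / P w) has_field_derivative E * L / P w) (at w within U)"
    using DERIV_diff[OF DERIV_const[of 1 "at w within U"]] by fastforce
  from DERIV_inverse'[OF this assms(3)] show ?thesis
    by (simp add: power2_eq_square divide_inverse mult_ac)
qed

lemma differentiable_param_factor:
  assumes p: "p \<ge> (2::nat)" and U: "U \<subseteq> cball 0 (1 / 12)"
  shows "differentiable_param U (\<lambda>w t. inverse (1 - e (c * t) / of_nat p powr (1/2 + w)))"
    and "differentiable_param U (\<lambda>w t. inverse (1 - e (c * t) / of_nat p powr (1/2 - w)))"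
proof -
  have nz: "1 - e t / of_nat p powr (1/2 + w) \<noteq> 0" "1 - e t / of_nat p powr (1/2 - w) \<noteq> 0" if "w \<in> U" for w t
    using one_minus_e_div_powr_nonzero[OF p, of w t] one_minus_e_div_powr_nonzero[OF p, of "- w" t] that U by auto
  have p0: "of_nat p \<noteq> (0::complex)" using p by auto
  show "differentiable_param U (\<lambda>w t. inverse (1 - e (c * t) / of_nat p powr (1/2 + w)))"
    unfolding differentiable_param_def
  proof (intro conjI ballI
     exI[of _ "\<lambda>w t. - (e (c * t) * Ln (of_nat p) / of_nat p powr (1/2 + w)) / (1 - e (c * t) / of_nat p powr (1/2 + w))\<^sup>2"])
    fix w and t :: real assume w: "w \<in> U"
    show "((\<lambda>w. inverse (1 - e (c * t) / of_nat p powr (1/2 + w))) has_field_derivative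
       - (e (c * t) * Ln (of_nat p) / of_nat p powr (1/2 + w)) / (1 - e (c * t) / of_nat p powr (1/2 + w))\<^sup>2) (at w within U)"
    proof (rule has_field_derivative_inverse_one_minus)
      show "((\<lambda>w. of_nat p powr (1/2 + w)) has_field_derivative Ln (of_nat p) * of_nat p powr (1/2 + w)) (at w within U)"
        by (rule DERIV_chain'[OF _ has_field_derivative_powr_right[OF p0], THEN DERIV_cong]) (auto intro!: derivative_eq_intros)
    qed (use p0 nz(1)[OF w] in auto)
  qed (use nz p0 in \<open>auto simp: case_prod_unfold intro!: continuous_intros\<close>)
  show "differentiable_param U (\<lambda>w t. inverse (1 - e (c * t) / of_nat p powr (1/2 - w)))"
    unfolding differentiable_param_def
  proof (intro conjI ballI
     exI[of _ "\<lambda>w t. - (e (c * t) * (- Ln (of_nat p)) / of_nat p powr (1/2 - w)) / (1 - e (c * t) / of_nat p powr (1/2 - w))\<^sup>2"])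
    fix w and t :: real assume w: "w \<in> U"
    show "((\<lambda>w. inverse (1 - e (c * t) / of_nat p powr (1/2 - w))) has_field_derivative
       - (e (c * t) * (- Ln (of_nat p)) / of_nat p powr (1/2 - w)) / (1 - e (c * t) / of_nat p powr (1/2 - w))\<^sup>2) (at w within U)"
    proof (rule has_field_derivative_inverse_one_minus)
      show "((\<lambda>w. of_nat p powr (1/2 - w)) has_field_derivative (- Ln (of_nat p)) * of_nat p powr (1/2 - w)) (at w within U)"
        by (rule DERIV_chain'[OF _ has_field_derivative_powr_right[OF p0], THEN DERIV_cong]) (auto intro!: derivative_eq_intros)
    qed (use p0 nz(2)[OF w] in auto)
  qed (use nz p0 in \<open>auto simp: case_prod_unfold intro!: continuous_intros\<close>)
qed

lemma continuous_on_coordinate [continuous_intros]: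
  fixes S :: "(nat \<Rightarrow> 'b::topological_space) set"
  shows "continuous_on S (\<lambda>z. z i)"
  by (rule continuous_on_product_then_coordinatewise) (rule continuous_on_id)

lemma continuous_on_fst_coordinate [continuous_intros]:
  fixes S :: "((nat \<Rightarrow> 'b::topological_space) \<times> 'c::topological_space) set"
  shows "continuous_on S (\<lambda>z. fst z i)"
  by (rule continuous_on_product_then_coordinatewise) (intro continuous_intros)

lemma continuous_local_factor:
  assumes p: "p \<ge> 2"
  shows "continuous_on {z. \<forall>j\<in>{1..2 * k}. norm (z j) \<le> 1 / 12} (\<lambda>z. local_factor k z p)"
proof -
  let ?\<Omega> = "{z. \<forall>j\<in>{1..2 * k}. norm (z j) \<le> 1 / 12}"
  have p0: "of_nat p \<noteq> (0::complex)" using p by auto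
  have nz: "1 - e t / of_nat p powr (1/2 + z j) \<noteq> 0" "1 - e t / of_nat p powr (1/2 - z (k + j)) \<noteq> 0"
    if "z \<in> ?\<Omega>" "j \<in> {1..k}" for z j t
    using one_minus_e_div_powr_nonzero[OF p, of "z j" t] one_minus_e_div_powr_nonzero[OF p, of "- z (k + j)" t] that by auto
  have "continuous_on (?\<Omega> \<times> cbox 0 1) (\<lambda>(z, \<theta>). \<Prod>j\<in>{1..k}.
        inverse (1 - e \<theta> / of_nat p powr (1/2 + z j)) * inverse (1 - e (- \<theta>) / of_nat p powr (1/2 - z (k + j))))"
    unfolding case_prod_unfold
    by (intro continuous_intros) (use nz p0 in auto)
  hence "continuous_on ?\<Omega> (\<lambda>z. integral (cbox 0 1) (\<lambda>\<theta>. \<Prod>j\<in>{1..k}.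
        inverse (1 - e \<theta> / of_nat p powr (1/2 + z j)) * inverse (1 - e (- \<theta>) / of_nat p powr (1/2 - z (k + j)))))"
    by (rule integral_continuous_on_param)
  thus ?thesis unfolding local_factor_def cbox_interval
    by (intro continuous_intros) (use p0 in auto)
qed

lemma holomorphic_local_factor:
  assumes p: "p \<ge> 2" and z: "\<forall>j\<in>{1..2 * k}. norm (z j) \<le> 1 / 12"
  shows "(\<lambda>w. local_factor k (z(l := w)) p) holomorphic_on ball 0 (1 / 12)"
proof -
  let ?U = "ball 0 (1 / 12) :: complex set"
  have p0: "of_nat p \<noteq> (0::complex)" using p by auto
  have co: "(\<lambda>w. (z(l := w)) j) holomorphic_on ?U" for j
    by (cases "j = l") auto
  have "differentiable_param ?U (\<lambda>w \<theta>. \<Prod>j\<in>{1..k}.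
        inverse (1 - e \<theta> / of_nat p powr (1/2 + (z(l := w)) j)) * inverse (1 - e (- \<theta>) / of_nat p powr (1/2 - (z(l := w)) (k + j))))"
  proof (intro differentiable_param_prod differentiable_param_mult)
    fix j assume j: "j \<in> {1..k}"
    show "differentiable_param ?U (\<lambda>w \<theta>. inverse (1 - e \<theta> / of_nat p powr (1/2 + (z(l := w)) j)))"
    proof (cases "j = l")
      case True
      thus ?thesis using differentiable_param_factor(1)[OF p ball_subset_cball, where c = 1] by simp
    next
      case False
      have "1 - e t / of_nat p powr (1/2 + z j) \<noteq> 0" for t
        using one_minus_e_div_powr_nonzero[OF p, of "z j" t] z j by auto
      thus ?thesis using False p0 by (auto intro!: differentiable_param_const continuous_intros)
    qed
    show "differentiable_param ?U (\<lambda>w \<theta>. inverse (1 - e (- \<theta>) / of_nat p powr (1/2 - (z(l := w)) (k + j))))"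
    proof (cases "k + j = l")
      case True
      thus ?thesis using differentiable_param_factor(2)[OF p ball_subset_cball, where c = "-1"] by simp
    next
      case False
      have "1 - e t / of_nat p powr (1/2 - z (k + j)) \<noteq> 0" for t
        using one_minus_e_div_powr_nonzero[OF p, of "- z (k + j)" t] z j by auto
      thus ?thesis using False p0 by (auto intro!: differentiable_param_const continuous_intros)
    qed
  qed simp
  hence "(\<lambda>w. integral {0..1} (\<lambda>\<theta>. \<Prod>j\<in>{1..k}.
        inverse (1 - e \<theta> / of_nat p powr (1/2 + (z(l := w)) j)) * inverse (1 - e (- \<theta>) / of_nat p powr (1/2 - (z(l := w)) (k + j))))) holomorphic_on ?U"
    by (rule holomorphic_integral_param) simp
  thus ?thesis unfolding local_factor_def
    by (intro holomorphic_intros co) (use p0 in auto)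
qed

text \<open>The bound \<open>C * real p powr (- 5 / 4)\<close> dominates all factors at once. The
  uniform limit transports continuity and holomorphy to \<open>A k\<close>. The second statement is
  convergence in the strict sense, with nonzero limit of the tail products, as required for
  \<open>has_prod\<close>.\<close>

lemma Euler_product_uniform_limit:
  "uniform_limit {z. \<forall>j\<in>{1..2 * k}. norm (z j) \<le> 1 / 12}
     (\<lambda>N z. \<Prod>p<N. if prime p then local_factor k z p else 1) (A k) sequentially"
  and Euler_product_0_convergent: "convergent_prod (\<lambda>p. if prime p then local_factor k (\<lambda>_. 0) p else 1)"
proof -
  let ?\<Omega> = "{z :: nat \<Rightarrow> complex. \<forall>j\<in>{1..2 * k}. norm (z j) \<le> 1 / 12}"
  obtain C where C: "C > 0" "\<And>p z. p \<ge> 2 \<Longrightarrow> (\<forall>j\<in>{1..2 * k}. norm (z j) \<le> 1 / 12) \<Longrightarrow>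
       norm (local_factor k z p - 1) \<le> C * real p powr (- 5 / 4)"
    by (rule local_factor_estimate[of k]) (rule that)
  have le: "norm ((if prime p then local_factor k z p else 1) - 1) \<le> C * real p powr (- 5 / 4)" if "z \<in> ?\<Omega>" for z p
    using C(2)[OF prime_ge_2_nat, of p z] C(1) that by (cases "prime p") simp_all
  have sm: "summable (\<lambda>p. C * real p powr (- 5 / 4))"
    by (intro summable_mult) (simp add: summable_real_powr_iff)
  have "(\<lambda>_. 0) \<in> ?\<Omega>" by simp
  hence "?\<Omega> \<noteq> {}" by (metis empty_iff)
  from uniform_limit_prodinf_summable[OF sm le this]
  show "uniform_limit ?\<Omega> (\<lambda>N z. \<Prod>p<N. if prime p then local_factor k z p else 1) (A k) sequentially"
    unfolding A_def .
  have "summable (\<lambda>p. norm ((if prime p then local_factor k (\<lambda>_. 0) p else 1) - 1))"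
    by (rule summable_comparison_test[OF _ sm]) (use le[OF \<open>(\<lambda>_. 0) \<in> ?\<Omega>\<close>] in auto)
  thus "convergent_prod (\<lambda>p. if prime p then local_factor k (\<lambda>_. 0) p else 1)"
    by (intro abs_convergent_prod_imp_convergent_prod summable_imp_abs_convergent_prod)
qed

lemma continuous_A:
  "continuous_on {z. \<forall>j\<in>{1..2 * k}. norm (z j) \<le> 1 / 12} (A k)"
proof (rule uniform_limit_theorem[OF _ Euler_product_uniform_limit])
  have "continuous_on {z. \<forall>j\<in>{1..2 * k}. norm (z j) \<le> 1 / 12} (\<lambda>z. if prime p then local_factor k z p else 1)" for p
    using continuous_local_factor[OF prime_ge_2_nat, of p k] by (cases "prime p") simp_all
  thus "\<forall>\<^sub>F N in sequentially. continuous_on {z. \<forall>j\<in>{1..2 * k}. norm (z j) \<le> 1 / 12}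
     (\<lambda>z. \<Prod>p<N. if prime p then local_factor k z p else 1)"
    by (intro always_eventually allI continuous_on_prod)
qed simp

lemma holomorphic_A:
  assumes z: "\<forall>j\<in>{1..2 * k}. norm (z j) \<le> 1 / 12"
  shows "(\<lambda>w. A k (z(l := w))) holomorphic_on ball 0 (1 / 12)"
proof (rule holomorphic_uniform_sequence)
  fix N
  have "(\<lambda>w. if prime p then local_factor k (z(l := w)) p else 1) holomorphic_on ball 0 (1 / 12)" for p
    using holomorphic_local_factor[OF prime_ge_2_nat z, of p l] by (cases "prime p") simp_all
  thus "(\<lambda>w. \<Prod>p<N. if prime p then local_factor k (z(l := w)) p else 1) holomorphic_on ball 0 (1 / 12)"
    by (intro holomorphic_on_prod)
next
  fix x :: complex assume "x \<in> ball 0 (1 / 12)"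
  then obtain d where d: "d > 0" "cball x d \<subseteq> ball 0 (1 / 12)"
    using open_contains_cball[of "ball 0 (1 / 12) :: complex set"] open_ball by blast
  have "uniform_limit (cball x d) (\<lambda>N w. \<Prod>p<N. if prime p then local_factor k (z(l := w)) p else 1)
      (\<lambda>w. A k (z(l := w))) sequentially"
    unfolding uniform_limit_iff
  proof (intro allI impI)
    fix \<epsilon> :: real assume \<epsilon>: "\<epsilon> > 0"
    have mem: "z(l := w) \<in> {z. \<forall>j\<in>{1..2 * k}. norm (z j) \<le> 1 / 12}" if "w \<in> cball x d" for w
    proof -
      have "w \<in> ball 0 (1 / 12)" using that d(2) by blast
      thus ?thesis using z by auto
    qed
    show "\<forall>\<^sub>F N in sequentially. \<forall>w\<in>cball x d.
       dist (\<Prod>p<N. if prime p then local_factor k (z(l := w)) p else 1) (A k (z(l := w))) < \<epsilon>"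
      using Euler_product_uniform_limit[of k, unfolded uniform_limit_iff, rule_format, OF \<epsilon>]
      by eventually_elim (use mem in blast)
  qed
  thus "\<exists>d>0. cball x d \<subseteq> ball 0 (1 / 12) \<and> uniform_limit (cball x d)
     (\<lambda>N w. \<Prod>p<N. if prime p then local_factor k (z(l := w)) p else 1) (\<lambda>w. A k (z(l := w))) sequentially"
    using d by blast
qed simp

section \<open>The local factors at the origin\<close>

lemma higher_deriv_eq:
  assumes "open S" "\<And>m u. u \<in> S \<Longrightarrow> (g m has_field_derivative g (Suc m) u) (at u)" "u \<in> S"
  shows "(deriv ^^ m) (g 0) u = g m u"
  using assms(3)
proof (induction m arbitrary: u)
  case (Suc m)
  have "deriv ((deriv ^^ m) (g 0)) u = deriv (g m) u"
    using Suc assms(1) by (intro deriv_cong_ev eventually_mono[OF eventually_nhds_in_open[of S]]) auto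
  also have "\<dots> = g (Suc m) u" using assms(2)[OF Suc.prems] by (rule DERIV_imp_deriv)
  finally show ?case by simp
qed simp

text \<open>Cauchy's formula for derivatives in the angle variable; the extra factor
  \<open>of_real r * e t\<close> comes from \<open>dz = 2 pi i z dt\<close>.\<close>

lemma circle_mean_higher_deriv:
  assumes "f holomorphic_on S" "open S" "cball 0 r \<subseteq> S" "norm w < r"
  shows "integral {0..1} (\<lambda>t. of_real r * e t * (f (of_real r * e t) / (of_real r * e t - w) ^ Suc m))
     = (deriv ^^ m) f w / fact m"
proof -
  have "((\<lambda>u. f u / (u - w) ^ Suc m) has_contour_integral (2 * pi * \<i>) / fact m * (deriv ^^ m) f w) (circlepath 0 r)"
  proof (rule Cauchy_has_contour_integral_higher_derivative_circlepath)
    show "continuous_on (cball 0 r) f"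
      using assms(1,3) by (intro holomorphic_on_imp_continuous_on) (rule holomorphic_on_subset)
    have "ball 0 r \<subseteq> S" using assms(3) ball_subset_cball by blast
    with assms(1) show "f holomorphic_on ball 0 r" by (rule holomorphic_on_subset)
  qed (use assms(4) in simp)
  hence "contour_integral (circlepath 0 r) (\<lambda>u. f u / (u - w) ^ Suc m) = (2 * pi * \<i>) / fact m * (deriv ^^ m) f w"
    by (rule contour_integral_unique)
  thus ?thesis by (simp add: contour_integral_circlepath_eq field_simps del: power_Suc)
qed

lemma inverse_power_higher_deriv:
  fixes X :: complex
  assumes "X * u \<noteq> 1"
  shows "(deriv ^^ m) (\<lambda>u. inverse (1 - X * u) ^ Suc n) u = fact m * of_nat ((n + m) choose m) * X ^ m * inverse (1 - X * u) ^ Suc (n + m)"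
proof -
  let ?g = "\<lambda>m u. fact m * of_nat ((n + m) choose m) * X ^ m * inverse (1 - X * u) ^ Suc (n + m)"
  have "(deriv ^^ m) (?g 0) u = ?g m u"
  proof (rule higher_deriv_eq[where S = "{u. X * u \<noteq> 1}" and g = ?g])
    show "open {u. X * u \<noteq> 1}" by (intro open_Collect_neq continuous_intros)
    fix m u assume "u \<in> {u. X * u \<noteq> 1}"
    hence nz: "1 - X * u \<noteq> 0" by auto
    have "Suc m * ((n + Suc m) choose Suc m) = Suc (n + m) * ((n + m) choose m)"
      using Suc_times_binomial_eq[of "n + m" m] by (simp add: mult.commute)
    hence "of_nat (Suc m) * of_nat ((n + Suc m) choose Suc m) = (of_nat (Suc (n + m)) * of_nat ((n + m) choose m) :: complex)"
      by (metis of_nat_mult)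
    hence c: "fact (Suc m) * of_nat ((n + Suc m) choose Suc m) = (fact m * of_nat ((n + m) choose m) * of_nat (Suc (n + m)) :: complex)"
      by (simp add: mult_ac)
    have "((\<lambda>u. inverse (1 - X * u)) has_field_derivative X * inverse (1 - X * u) ^ 2) (at u)"
      using nz by (auto intro!: derivative_eq_intros simp: power2_eq_square divide_inverse)
    from DERIV_power[OF this, of "Suc (n + m)"]
    have "((\<lambda>u. inverse (1 - X * u) ^ Suc (n + m)) has_field_derivative
        of_nat (Suc (n + m)) * X * inverse (1 - X * u) ^ Suc (n + Suc m)) (at u)"
      by (simp add: power2_eq_square mult_ac)
    from DERIV_cmult[OF this, of "fact m * of_nat ((n + m) choose m) * X ^ m"]
    show "(?g m has_field_derivative ?g (Suc m) u) (at u)"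
      unfolding c by (simp add: mult_ac)
  qed (use assms in simp)
  thus ?thesis by simp
qed

text \<open>Expand \<open>(n + m) choose m\<close> by Vandermonde's identity and use \<open>(n
  choose m) * (m choose j) = (n choose j) * ((n - j) choose (m - j))\<close>. After interchanging
  the sums, the sum over \<open>m\<close> is \<open>y ^ j * (y + (1 - y)) ^ (n - j)\<close>.\<close>

lemma sum_binomial_square:
  fixes y :: "'a::comm_ring_1"
  shows "(\<Sum>m\<le>n. of_nat (n choose m) * of_nat ((n + m) choose m) * y ^ m * (1 - y) ^ (n - m)) =
         (\<Sum>j\<le>n. (of_nat (n choose j))\<^sup>2 * y ^ j)"
proof -
  have "of_nat (n choose m) * of_nat ((n + m) choose m) * y ^ m * (1 - y) ^ (n - m) =
     (\<Sum>j\<le>m. (of_nat (n choose j))\<^sup>2 * (of_nat ((n - j) choose (m - j)) * y ^ m * (1 - y) ^ (n - m)))" if "m \<le> n" for m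
  proof -
    have "(n choose m) * ((n + m) choose m) = (\<Sum>j\<le>m. (n choose m) * ((n choose j) * (m choose (m - j))))"
      by (simp add: vandermonde[symmetric] sum_distrib_left)
    also have "\<dots> = (\<Sum>j\<le>m. (n choose j)\<^sup>2 * ((n - j) choose (m - j)))"
    proof (rule sum.cong)
      fix j assume "j \<in> {..m}"
      hence "(n choose m) * (m choose (m - j)) = (n choose j) * ((n - j) choose (m - j))"
        using choose_mult[of j m n] that by (simp add: binomial_symmetric[of j m])
      thus "(n choose m) * ((n choose j) * (m choose (m - j))) = (n choose j)\<^sup>2 * ((n - j) choose (m - j))"
        by (simp add: power2_eq_square mult_ac)
    qed simp
    finally have c: "(n choose m) * ((n + m) choose m) = (\<Sum>j\<le>m. (n choose j)\<^sup>2 * ((n - j) choose (m - j)))" .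
    have "of_nat (n choose m) * of_nat ((n + m) choose m) =
       ((\<Sum>j\<le>m. (of_nat (n choose j))\<^sup>2 * of_nat ((n - j) choose (m - j))) :: 'a)"
      using arg_cong[OF c, of "of_nat :: nat \<Rightarrow> 'a"] by simp
    thus ?thesis by (simp only: sum_distrib_right mult.assoc)
  qed
  hence "(\<Sum>m\<le>n. of_nat (n choose m) * of_nat ((n + m) choose m) * y ^ m * (1 - y) ^ (n - m)) =
     (\<Sum>m\<le>n. \<Sum>j\<le>m. (of_nat (n choose j))\<^sup>2 * (of_nat ((n - j) choose (m - j)) * y ^ m * (1 - y) ^ (n - m)))"
    by (intro sum.cong) auto
  also have "\<dots> = (\<Sum>j\<le>n. \<Sum>m=j..n. (of_nat (n choose j))\<^sup>2 * (of_nat ((n - j) choose (m - j)) * y ^ m * (1 - y) ^ (n - m)))"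
    by (simp add: sum.Sigma) (rule sum.reindex_bij_witness[of _ prod.swap prod.swap]; auto)
  also have "\<dots> = (\<Sum>j\<le>n. (of_nat (n choose j))\<^sup>2 * y ^ j)"
  proof (rule sum.cong)
    fix j assume j: "j \<in> {..n}"
    have "(\<Sum>m=j..n. of_nat ((n - j) choose (m - j)) * y ^ m * (1 - y) ^ (n - m)) =
       (\<Sum>i\<le>n - j. of_nat ((n - j) choose i) * y ^ (i + j) * (1 - y) ^ (n - j - i))"
      by (rule sum.reindex_bij_witness[of _ "\<lambda>i. i + j" "\<lambda>m. m - j"]) (use j in auto)
    also have "\<dots> = (\<Sum>i\<le>n - j. y ^ j * (of_nat ((n - j) choose i) * y ^ i * (1 - y) ^ (n - j - i)))"
      by (simp add: power_add mult_ac)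
    also have "\<dots> = y ^ j * (y + (1 - y)) ^ (n - j)"
      unfolding binomial_ring sum_distrib_left ..
    finally have "(\<Sum>m=j..n. of_nat ((n - j) choose (m - j)) * y ^ m * (1 - y) ^ (n - m)) = y ^ j" by simp
    thus "(\<Sum>m=j..n. (of_nat (n choose j))\<^sup>2 * (of_nat ((n - j) choose (m - j)) * y ^ m * (1 - y) ^ (n - m)))
        = (of_nat (n choose j))\<^sup>2 * y ^ j"
      by (simp flip: sum_distrib_left)
  qed simp
  finally show ?thesis .
qed

text \<open>
  With \<open>u = e \<theta>\<close> the integral is the residue at \<open>X\<close> of
  \<open>u ^ n (1 - X u) ^ (- n - 1) (u - X) ^ (- n - 1)\<close>, and \<open>u ^ n\<close> is expanded in powers of \<open>u - X\<close>.
\<close>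
lemma circle_mean_inverse_powers:
  fixes X :: complex
  assumes X: "norm X < 1"
  shows "integral {0..1} (\<lambda>\<theta>. (inverse (1 - e \<theta> * X) * inverse (1 - e (- \<theta>) * X)) ^ Suc n) =
    (\<Sum>m\<le>n. of_nat (n choose m) * of_nat ((n + m) choose m) * (X ^ 2) ^ m * inverse (1 - X ^ 2) ^ Suc (n + m))"
proof -
  let ?g = "\<lambda>u. inverse (1 - X * u) ^ Suc n"
  have nz: "1 - X * e \<theta> \<noteq> 0" "e \<theta> - X \<noteq> 0" for \<theta>
  proof -
    have "norm (X * e \<theta>) < 1" using X by (simp add: norm_mult)
    thus "1 - X * e \<theta> \<noteq> 0" by auto
    show "e \<theta> - X \<noteq> 0" using X by auto
  qed
  have eq: "(inverse (1 - e \<theta> * X) * inverse (1 - e (- \<theta>) * X)) ^ Suc n =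
     (\<Sum>m\<le>n. of_nat (n choose m) * X ^ m * (of_real 1 * e \<theta> * (?g (of_real 1 * e \<theta>) / (of_real 1 * e \<theta> - X) ^ Suc m)))" for \<theta>
  proof -
    let ?u = "e \<theta>"
    have "inverse (1 - e (- \<theta>) * X) = ?u * inverse (?u - X)"
      using nz[of \<theta>] by (simp add: e_minus field_simps)
    hence "(inverse (1 - e \<theta> * X) * inverse (1 - e (- \<theta>) * X)) ^ Suc n = ?g ?u * (?u * ?u ^ n) * inverse (?u - X) ^ Suc n"
      by (simp add: power_mult_distrib mult_ac)
    also have "?u ^ n = (\<Sum>m\<le>n. of_nat (n choose m) * X ^ m * (?u - X) ^ (n - m))"
      using binomial_ring[of X "?u - X" n] by simp
    also have "?g ?u * (?u * (\<Sum>m\<le>n. of_nat (n choose m) * X ^ m * (?u - X) ^ (n - m))) * inverse (?u - X) ^ Suc n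
       = (\<Sum>m\<le>n. of_nat (n choose m) * X ^ m * (?u * (?g ?u * ((?u - X) ^ (n - m) * inverse (?u - X) ^ Suc n))))"
      by (simp add: sum_distrib_left sum_distrib_right mult_ac)
    also have "\<dots> = (\<Sum>m\<le>n. of_nat (n choose m) * X ^ m * (?u * (?g ?u / (?u - X) ^ Suc m)))"
    proof (rule sum.cong)
      fix m assume "m \<in> {..n}"
      hence "(?u - X) ^ Suc n = (?u - X) ^ (n - m) * (?u - X) ^ Suc m" by (simp flip: power_add)
      hence "(?u - X) ^ (n - m) * inverse (?u - X) ^ Suc n = inverse ((?u - X) ^ Suc m)"
        using nz(2)[of \<theta>] by (simp only: power_inverse inverse_mult_distrib) (simp add: field_simps)
      thus "of_nat (n choose m) * X ^ m * (?u * (?g ?u * ((?u - X) ^ (n - m) * inverse (?u - X) ^ Suc n)))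
         = of_nat (n choose m) * X ^ m * (?u * (?g ?u / (?u - X) ^ Suc m))"
        by (simp only: divide_inverse)
    qed simp
    finally show ?thesis by simp
  qed
  have hol: "?g holomorphic_on {u. X * u \<noteq> 1}" by (intro holomorphic_intros) auto
  have op: "open {u. X * u \<noteq> 1}" by (intro open_Collect_neq continuous_intros)
  have sub: "cball 0 1 \<subseteq> {u. X * u \<noteq> 1}"
  proof
    fix u :: complex assume "u \<in> cball 0 1"
    hence "norm (X * u) < 1" using X mult_left_le[of "norm u" "norm X"] by (simp add: norm_mult)
    thus "u \<in> {u. X * u \<noteq> 1}" by auto
  qed
  have "X \<in> cball 0 1" using X by simp
  with sub have X2: "X * X \<noteq> 1" by blast
  have int: "(\<lambda>\<theta>. of_real 1 * e \<theta> * (?g (of_real 1 * e \<theta>) / (of_real 1 * e \<theta> - X) ^ Suc m)) integrable_on {0..1}" for m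
    by (intro integrable_continuous_interval continuous_intros) (use nz in \<open>auto simp del: power_Suc\<close>)
  have "integral {0..1} (\<lambda>\<theta>. (inverse (1 - e \<theta> * X) * inverse (1 - e (- \<theta>) * X)) ^ Suc n) =
     (\<Sum>m\<le>n. integral {0..1} (\<lambda>\<theta>. of_nat (n choose m) * X ^ m * (of_real 1 * e \<theta> * (?g (of_real 1 * e \<theta>) / (of_real 1 * e \<theta> - X) ^ Suc m))))"
    unfolding eq by (intro integral_sum integrable_on_mult_right int) simp
  also have "\<dots> = (\<Sum>m\<le>n. of_nat (n choose m) * X ^ m * ((deriv ^^ m) ?g X / fact m))"
    unfolding integral_mult_right circle_mean_higher_deriv[OF hol op sub X] ..
  also have "\<dots> = (\<Sum>m\<le>n. of_nat (n choose m) * of_nat ((n + m) choose m) * (X ^ 2) ^ m * inverse (1 - X ^ 2) ^ Suc (n + m))"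
    unfolding inverse_power_higher_deriv[OF X2]
    by (intro sum.cong refl) (simp add: power2_eq_square power_mult_distrib mult_ac)
  finally show ?thesis .
qed

text \<open>At the origin all \<open>k\<close> factors of the integrand coincide, so the integral is
  the mean of a \<open>k\<close>-th power, known as a residue; \<open>sum_binomial_square\<close>
  brings it into the required shape.\<close>

lemma local_factor_0:
  assumes k: "k \<ge> 1" and p: "p \<ge> 2"
  shows "local_factor k (\<lambda>_. 0) p = (1 - 1 / of_nat p) ^ ((k - 1)\<^sup>2) *
           (\<Sum>m\<in>{0..k - 1}. (of_nat ((k - 1) choose m))\<^sup>2 / of_nat p ^ m)"
proof -
  obtain n where n: "k = Suc n" using k by (cases k) auto
  define X where "X = 1 / (of_nat p powr (1/2) :: complex)"
  define y where "y = 1 / (of_nat p :: complex)"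
  have p0: "of_nat p \<noteq> (0::complex)" using p by auto
  have XX: "X ^ 2 = y"
  proof -
    have "(of_nat p powr (1/2) :: complex) * of_nat p powr (1/2) = of_nat p"
      using p0 by (simp flip: powr_add)
    thus ?thesis by (simp add: X_def y_def power2_eq_square)
  qed
  have X: "norm X < 1" using norm_e_div_powr_less_1[OF p, of 0 0] by (simp add: X_def norm_divide)
  have y1: "1 - y \<noteq> 0"
  proof -
    have "norm y < 1" using X by (simp flip: XX add: norm_power power_less_one_iff)
    thus ?thesis by auto
  qed
  have "local_factor k (\<lambda>_. 0) p = (1 - y) ^ (k * k) *
     integral {0..1} (\<lambda>\<theta>. (inverse (1 - e \<theta> * X) * inverse (1 - e (- \<theta>) * X)) ^ Suc n)"
  proof -
    have "(\<Prod>i\<in>{1..k}. \<Prod>j\<in>{1..k}. 1 - 1 / of_nat p powr (1 + 0 - 0)) = (1 - y) ^ (k * k)"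
      using p0 by (simp add: y_def power_mult)
    moreover have "(\<Prod>j\<in>{1..k}. inverse (1 - e \<theta> / of_nat p powr (1/2 + 0)) * inverse (1 - e (- \<theta>) / of_nat p powr (1/2 - 0)))
       = (inverse (1 - e \<theta> * X) * inverse (1 - e (- \<theta>) * X)) ^ Suc n" for \<theta>
      by (simp add: X_def n)
    ultimately show ?thesis unfolding local_factor_def by simp
  qed
  also have "\<dots> = (\<Sum>m\<le>n. of_nat (n choose m) * of_nat ((n + m) choose m) * y ^ m * ((1 - y) ^ (k * k) * inverse (1 - y) ^ Suc (n + m)))"
    unfolding circle_mean_inverse_powers[OF X] XX by (simp add: sum_distrib_left mult_ac)
  also have "\<dots> = (\<Sum>m\<le>n. (1 - y) ^ (n\<^sup>2) * (of_nat (n choose m) * of_nat ((n + m) choose m) * y ^ m * (1 - y) ^ (n - m)))"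
  proof (rule sum.cong)
    fix m assume "m \<in> {..n}"
    \<comment> \<open>With \<open>k = n + 1\<close>, the \<open>k * k\<close> factors
      \<open>1 - y\<close> clear the denominator and leave the exponent \<open>n\<^sup>2\<close> in
      front and \<open>n - m\<close> inside the sum.\<close>
    hence "k * k = n\<^sup>2 + (n - m) + Suc (n + m)" by (simp add: n power2_eq_square)
    hence "(1 - y) ^ (k * k) * inverse (1 - y) ^ Suc (n + m) = (1 - y) ^ (n\<^sup>2) * (1 - y) ^ (n - m) * ((1 - y) ^ Suc (n + m) * inverse (1 - y) ^ Suc (n + m))"
      by (simp only: power_add mult.assoc)
    also have "(1 - y) ^ Suc (n + m) * inverse (1 - y) ^ Suc (n + m) = 1"
      by (simp only: power_mult_distrib[symmetric] right_inverse[OF y1] power_one)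
    finally show "of_nat (n choose m) * of_nat ((n + m) choose m) * y ^ m * ((1 - y) ^ (k * k) * inverse (1 - y) ^ Suc (n + m))
       = (1 - y) ^ (n\<^sup>2) * (of_nat (n choose m) * of_nat ((n + m) choose m) * y ^ m * (1 - y) ^ (n - m))"
      by (simp only: mult_ac mult_1_right mult_1)
  qed simp
  also have "\<dots> = (1 - y) ^ (n\<^sup>2) * (\<Sum>m\<le>n. (of_nat (n choose m))\<^sup>2 * y ^ m)"
    unfolding sum_distrib_left[symmetric] sum_binomial_square ..
  finally show ?thesis by (simp add: n y_def power_divide atLeast0AtMost)
qed

text \<open>The nonvanishing ensures that the degree of the polynomial does not drop: a convergent
  product is 0 only if one of its factors is.\<close>

lemma A_0_has_prod:
  assumes k: "k \<ge> 1"
  shows "(\<lambda>p. if prime p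
              then (1 - 1 / of_nat p) ^ ((k - 1)\<^sup>2) *
                   (\<Sum>m\<in>{0..k - 1}. (of_nat ((k - 1) choose m))\<^sup>2 / of_nat p ^ m)
              else 1) has_prod A k (\<lambda>_. 0)"
    and "A k (\<lambda>_. 0) \<noteq> 0"
proof -
  let ?f = "\<lambda>p. if prime p
              then (1 - 1 / of_nat p) ^ ((k - 1)\<^sup>2) *
                   (\<Sum>m\<in>{0..k - 1}. (of_nat ((k - 1) choose m))\<^sup>2 / of_nat p ^ m)
              else (1 :: complex)"
  have f: "?f = (\<lambda>p. if prime p then local_factor k (\<lambda>_. 0) p else 1)"
    using local_factor_0[OF k prime_ge_2_nat] by auto
  show *: "?f has_prod A k (\<lambda>_. 0)"
    unfolding f A_def using Euler_product_0_convergent[of k] by (rule convergent_prod_has_prod)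
  have "?f p \<noteq> 0" for p
  proof (cases "prime p")
    case True
    hence p: "p \<ge> 2" by (rule prime_ge_2_nat)
    \<comment> \<open>Over the reals all terms are positive, which excludes cancellation.\<close>
    have "(\<Sum>m\<in>{0..k - 1}. (of_nat ((k - 1) choose m))\<^sup>2 / of_nat p ^ m :: complex) =
        of_real (\<Sum>m\<in>{0..k - 1}. (of_nat ((k - 1) choose m))\<^sup>2 / of_nat p ^ m)" by simp
    moreover have "(\<Sum>m\<in>{0..k - 1}. (of_nat ((k - 1) choose m))\<^sup>2 / of_nat p ^ m :: real) > 0"
      using p by (intro sum_pos) (auto intro!: divide_pos_pos)
    ultimately have "(\<Sum>m\<in>{0..k - 1}. (of_nat ((k - 1) choose m))\<^sup>2 / of_nat p ^ m :: complex) \<noteq> 0"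
      by (simp only: of_real_eq_0_iff)
    moreover have "1 - 1 / of_nat p \<noteq> (0 :: complex)" using p by (auto simp: field_simps)
    ultimately show ?thesis using True by simp
  qed simp
  note ne = this
  show "A k (\<lambda>_. 0) \<noteq> 0"
  proof
    assume "A k (\<lambda>_. 0) = 0"
    with has_prod_eq_0_iff[OF *] have "0 \<in> range ?f" by (rule iffD1)
    then obtain p where "0 = ?f p" by (rule rangeE)
    from ne[of p] this[symmetric] show False by (rule notE)
  qed
qed

section \<open>The leading coefficient\<close>

definition linear_form :: "nat \<Rightarrow> (nat \<Rightarrow> complex) \<Rightarrow> complex" where
  "linear_form k z = (\<Sum>j\<in>{1..k}. z j - z (k + j))"

text \<open>The differences between the two blocks of variables in one of the two factors
  \<open>Delta (2 * k) z\<close> cancel the poles of zeta, which leaves the two small Vandermonde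
  determinants. The exponent is \<open>2 * k - 1\<close> because \<open>dz\<close> supplies one
  factor \<open>z j\<close>.\<close>

definition Delta_kernel :: "nat \<Rightarrow> (nat \<Rightarrow> complex) \<Rightarrow> complex" where
  "Delta_kernel k z = Delta (2 * k) z * Delta k z * Delta k (\<lambda>i. z (k + i)) / (\<Prod>j\<in>{1..2 * k}. z j ^ (2 * k - 1))"

lemma prod_lessThan_add: "(\<Prod>a<m + n. f a) = (\<Prod>a<m. f a) * (\<Prod>i<n. f (m + i) :: 'a::comm_monoid_mult)" for m n :: nat
  by (induction n) (simp_all add: mult.assoc)

lemma prod_atLeast1_atMost: "(\<Prod>j\<in>{1..n}. f j) = (\<Prod>a<n. f (Suc a))" for n :: nat
  by (rule prod.reindex_bij_witness[of _ Suc "\<lambda>j. j - 1"]) auto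

lemma sum_atLeast1_atMost: "(\<Sum>j\<in>{1..n}. f j) = (\<Sum>a<n. f (Suc a))" for n :: nat
  by (rule sum.reindex_bij_witness[of _ Suc "\<lambda>j. j - 1"]) auto

text \<open>The mean picks out a Taylor coefficient of \<open>exp (c * z)\<close>. For
  \<open>d >= n\<close> the integrand is an entire function with a zero at 0, so its mean is
  0.\<close>

lemma circle_mean_exp_power:
  assumes "n \<ge> 1"
  shows "integral {0..1} (\<lambda>t. e t ^ d * exp (c * e t) / e t ^ (n - 1)) =
     (if d < n then c ^ (n - 1 - d) / fact (n - 1 - d) else 0)"
proof (cases "d < n")
  case True
  define m where "m = n - 1 - d"
  have "n - 1 = d + m" using True by (simp add: m_def)
  hence "(\<lambda>t. e t ^ d * exp (c * e t) / e t ^ (n - 1)) =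
      (\<lambda>t. of_real 1 * e t * (exp (c * (of_real 1 * e t)) / (of_real 1 * e t - 0) ^ Suc m))"
    by (simp add: power_add fun_eq_iff)
  moreover have "(deriv ^^ m) (\<lambda>u. exp (c * u)) 0 = c ^ m"
  proof -
    let ?g = "\<lambda>m u. c ^ m * exp (c * u)"
    have "(deriv ^^ m) (?g 0) 0 = ?g m 0"
      by (rule higher_deriv_eq[where S = UNIV and g = ?g]) (auto intro!: derivative_eq_intros)
    thus ?thesis by simp
  qed
  moreover have "(\<lambda>u. exp (c * u)) holomorphic_on UNIV" by (intro holomorphic_intros)
  ultimately show ?thesis using True circle_mean_higher_deriv[of "\<lambda>u. exp (c * u)" UNIV 1 0 m]
    by (simp add: m_def)
next
  case False
  hence "d = n - 1 + Suc (d - n)" using assms by simp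
  hence *: "e t ^ d = e t ^ (n - 1) * (e t * e t ^ (d - n))" for t
    by (metis power_Suc power_add)
  have "(\<lambda>t. e t ^ d * exp (c * e t) / e t ^ (n - 1)) =
      (\<lambda>t. of_real 1 * e t * ((of_real 1 * e t) ^ Suc (d - n) * exp (c * (of_real 1 * e t)) / (of_real 1 * e t - 0) ^ Suc 0))"
    unfolding * by (simp add: fun_eq_iff)
  moreover have "(\<lambda>u. u ^ Suc (d - n) * exp (c * u)) holomorphic_on UNIV" by (intro holomorphic_intros)
  ultimately show ?thesis using False circle_mean_higher_deriv[of "\<lambda>u. u ^ Suc (d - n) * exp (c * u)" UNIV 1 0 0]
    by simp
qed

lemma sum_product3:
  fixes f :: "_ \<Rightarrow> 'a::comm_semiring_0"
  shows "(\<Sum>p\<in>S. f p) * ((\<Sum>q\<in>T. g q) * ((\<Sum>r\<in>U. h r) * c)) =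
     (\<Sum>p\<in>S. \<Sum>q\<in>T. \<Sum>r\<in>U. f p * (g q * (h r * c)))"
  by (subst sum_distrib_right, intro sum.cong refl, subst sum_distrib_right, subst sum_distrib_left,
      intro sum.cong refl, subst sum_distrib_right, subst sum_distrib_left, subst sum_distrib_left) simp

text \<open>Each Vandermonde determinant is a signed sum over permutations: \<open>p\<close> and
  \<open>q\<close> for the two blocks, \<open>r\<close> for all variables. Every term then splits
  into factors of one variable each.\<close>

lemma Delta_kernel_exp_expansion:
  assumes k: "k \<ge> 1"
  shows "Delta_kernel k z * exp (linear_form k z / 2) =
    (\<Sum>p | p permutes {0..<k}. \<Sum>q | q permutes {0..<k}. \<Sum>r | r permutes {0..<2 * k}.
       signof p * signof q * signof r *
       (\<Prod>a<2 * k. z (Suc a) ^ (r a + (if a < k then p a else q (a - k))) *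
          exp ((if a < k then 1/2 else - 1/2) * z (Suc a)) / z (Suc a) ^ (2 * k - 1)))"
proof -
  have E: "exp (linear_form k z / 2) = (\<Prod>a<2 * k. exp ((if a < k then 1/2 else - 1/2) * z (Suc a)))"
  proof -
    have "linear_form k z / 2 = (\<Sum>a<k. (1/2) * z (Suc a)) + (\<Sum>a<k. (- 1/2) * z (Suc (k + a)))"
      unfolding linear_form_def sum_atLeast1_atMost
      by (simp add: sum_subtractf sum_divide_distrib[symmetric] sum_negf diff_divide_distrib)
    hence "exp (linear_form k z / 2) = (\<Prod>a<k. exp ((1/2) * z (Suc a))) * (\<Prod>a<k. exp ((- 1/2) * z (Suc (k + a))))"
      by (simp only: exp_add exp_sum finite_lessThan)
    thus ?thesis by (simp add: mult_2 prod_lessThan_add)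
  qed
  have S: "(\<Prod>i<k. z (Suc i) ^ p i) * (\<Prod>i<k. z (k + Suc i) ^ q i) =
     (\<Prod>a<2 * k. z (Suc a) ^ (if a < k then p a else q (a - k)))" for p q :: "nat \<Rightarrow> nat"
    by (simp add: mult_2 prod_lessThan_add)
  have "Delta_kernel k z * exp (linear_form k z / 2) =
     (\<Sum>p | p permutes {0..<k}. signof p * (\<Prod>i<k. z (Suc i) ^ p i)) *
     ((\<Sum>q | q permutes {0..<k}. signof q * (\<Prod>i<k. z (k + Suc i) ^ q i)) *
     ((\<Sum>r | r permutes {0..<2 * k}. signof r * (\<Prod>a<2 * k. z (Suc a) ^ r a)) *
      ((\<Prod>a<2 * k. exp ((if a < k then 1/2 else - 1/2) * z (Suc a))) / (\<Prod>a<2 * k. z (Suc a) ^ (2 * k - 1)))))"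
    unfolding Delta_kernel_def Delta_eq_sum E prod_atLeast1_atMost by (simp add: mult_ac)
  also have "\<dots> = (\<Sum>p | p permutes {0..<k}. \<Sum>q | q permutes {0..<k}. \<Sum>r | r permutes {0..<2 * k}.
       (signof p * (\<Prod>i<k. z (Suc i) ^ p i)) * ((signof q * (\<Prod>i<k. z (k + Suc i) ^ q i)) *
       ((signof r * (\<Prod>a<2 * k. z (Suc a) ^ r a)) *
      ((\<Prod>a<2 * k. exp ((if a < k then 1/2 else - 1/2) * z (Suc a))) / (\<Prod>a<2 * k. z (Suc a) ^ (2 * k - 1))))))"
    by (rule sum_product3)
  also have "\<dots> = (\<Sum>p | p permutes {0..<k}. \<Sum>q | q permutes {0..<k}. \<Sum>r | r permutes {0..<2 * k}.
       signof p * signof q * signof r *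
       (\<Prod>a<2 * k. z (Suc a) ^ (r a + (if a < k then p a else q (a - k))) *
          exp ((if a < k then 1/2 else - 1/2) * z (Suc a)) / z (Suc a) ^ (2 * k - 1)))"
  proof (intro sum.cong refl)
    fix p q r :: "nat \<Rightarrow> nat"
    let ?E = "\<Prod>a<2 * k. exp ((if a < k then 1/2 else - 1/2) * z (Suc a))"
    let ?D = "\<Prod>a<2 * k. z (Suc a) ^ (2 * k - 1)"
    have "(\<Prod>a<2 * k. z (Suc a) ^ (r a + (if a < k then p a else q (a - k))) *
          exp ((if a < k then 1/2 else - 1/2) * z (Suc a)) / z (Suc a) ^ (2 * k - 1))
      = (\<Prod>a<2 * k. z (Suc a) ^ r a) * ((\<Prod>i<k. z (Suc i) ^ p i) * (\<Prod>i<k. z (k + Suc i) ^ q i)) * ?E / ?D"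
      unfolding S by (simp only: power_add prod.distrib prod_dividef)
    thus "(signof p * (\<Prod>i<k. z (Suc i) ^ p i)) * ((signof q * (\<Prod>i<k. z (k + Suc i) ^ q i)) *
       ((signof r * (\<Prod>a<2 * k. z (Suc a) ^ r a)) * (?E / ?D))) =
       signof p * signof q * signof r *
       (\<Prod>a<2 * k. z (Suc a) ^ (r a + (if a < k then p a else q (a - k))) *
          exp ((if a < k then 1/2 else - 1/2) * z (Suc a)) / z (Suc a) ^ (2 * k - 1))"
      by (simp only: mult_ac times_divide_eq_right times_divide_eq_left)
  qed
  finally show ?thesis .
qed

text \<open>After the expansion the average of each term is a product of one-variable means, and
  these are the values of \<open>exp_coeff\<close>.\<close>

lemma torus_avg_Delta_kernel_exp:
  assumes k: "k \<ge> 1"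
  shows "torus_avg (2 * k) (\<lambda>\<theta>. Delta_kernel k (torus_point (2 * k) (\<lambda>_. 1) \<theta>) * exp (linear_form k (torus_point (2 * k) (\<lambda>_. 1) \<theta>) / 2)) \<theta>
     = (fact k)\<^sup>2 * (\<Prod>l<k. fact l / fact (k + l))"
proof -
  let ?h = "\<lambda>p q r a t. e t ^ (r (a - 1) + (if a - 1 < k then p (a - 1) else q (a - 1 - k))) *
          exp ((if a - 1 < k then 1/2 else - 1/2) * e t) / e t ^ (2 * k - 1)"
  let ?f = "\<lambda>p q r \<theta>. signof p * signof q * signof r * (\<Prod>a\<in>{1..2 * k}. ?h p q r a (\<theta> a))"
  have cont: "continuous_on UNIV (?f p q r)" for p q r :: "nat \<Rightarrow> nat"
    by (intro continuous_intros) auto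
  have "(\<lambda>\<theta>. Delta_kernel k (torus_point (2 * k) (\<lambda>_. 1) \<theta>) * exp (linear_form k (torus_point (2 * k) (\<lambda>_. 1) \<theta>) / 2)) =
     (\<lambda>\<theta>. \<Sum>p | p permutes {0..<k}. \<Sum>q | q permutes {0..<k}. \<Sum>r | r permutes {0..<2 * k}. ?f p q r \<theta>)"
    unfolding Delta_kernel_exp_expansion[OF k] prod_atLeast1_atMost
    by (intro ext sum.cong prod.cong refl arg_cong2[where f = times]) (simp add: torus_point_def)
  hence "torus_avg (2 * k) (\<lambda>\<theta>. Delta_kernel k (torus_point (2 * k) (\<lambda>_. 1) \<theta>) * exp (linear_form k (torus_point (2 * k) (\<lambda>_. 1) \<theta>) / 2)) \<theta>
    = torus_avg (2 * k) (\<lambda>\<theta>. \<Sum>p | p permutes {0..<k}. \<Sum>q | q permutes {0..<k}. \<Sum>r | r permutes {0..<2 * k}. ?f p q r \<theta>) \<theta>"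
    by simp
  also have "\<dots> = (\<Sum>p | p permutes {0..<k}. \<Sum>q | q permutes {0..<k}. \<Sum>r | r permutes {0..<2 * k}. torus_avg (2 * k) (?f p q r) \<theta>)"
    by (subst torus_avg_sum, simp add: finite_permutations, intro continuous_on_sum cont, rule sum.cong[OF refl])+ simp
  also have "\<dots> = (\<Sum>p | p permutes {0..<k}. \<Sum>q | q permutes {0..<k}. \<Sum>r | r permutes {0..<2 * k}.
      signof p * signof q * signof r *
        (\<Prod>a<2 * k. exp_coeff k a (r a + (if a < k then p a else q (a - k)))))"
  proof (intro sum.cong refl)
    fix p q r :: "nat \<Rightarrow> nat"
    have "torus_avg (2 * k) (?f p q r) \<theta> = signof p * signof q * signof r * (\<Prod>a\<in>{1..2 * k}. integral {0..1} (?h p q r a))"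
      by (simp only: torus_avg_cmult torus_avg_prod[where f = "?h p q r"])
    also have "(\<Prod>a\<in>{1..2 * k}. integral {0..1} (?h p q r a)) =
      (\<Prod>a<2 * k. exp_coeff k a (r a + (if a < k then p a else q (a - k))))"
      unfolding prod_atLeast1_atMost
      by (rule prod.cong[OF refl], subst circle_mean_exp_power) (use k in \<open>auto simp: exp_coeff_def\<close>)
    finally show "torus_avg (2 * k) (?f p q r) \<theta> = signof p * signof q * signof r *
        (\<Prod>a<2 * k. exp_coeff k a (r a + (if a < k then p a else q (a - k))))" .
  qed
  finally show ?thesis unfolding sum_permutations_exp_coeff .
qed

section \<open>Regularity and homogeneity of the kernel\<close>

lemma continuous_Delta:
  "(\<And>i. continuous_on S (\<lambda>x. f x i)) \<Longrightarrow> continuous_on S (\<lambda>x. Delta m (f x))"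
  unfolding Delta_def by (intro continuous_intros)

lemma continuous_linear_form:
  "(\<And>i. continuous_on S (\<lambda>x. f x i)) \<Longrightarrow> continuous_on S (\<lambda>x. linear_form k (f x))"
  unfolding linear_form_def by (intro continuous_intros)

lemma continuous_Delta_kernel:
  assumes "\<And>i. continuous_on S (\<lambda>x. f x i)" "\<And>x j. x \<in> S \<Longrightarrow> j \<in> {1..2 * k} \<Longrightarrow> f x j \<noteq> 0"
  shows "continuous_on S (\<lambda>x. Delta_kernel k (f x))"
  unfolding Delta_kernel_def using assms by (intro continuous_intros continuous_Delta) auto

lemma holomorphic_Delta:
  "(\<And>i. (\<lambda>w. f w i) holomorphic_on S) \<Longrightarrow> (\<lambda>w. Delta m (f w)) holomorphic_on S"
  unfolding Delta_def by (intro holomorphic_intros)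

lemma holomorphic_linear_form:
  "(\<And>i. (\<lambda>w. f w i) holomorphic_on S) \<Longrightarrow> (\<lambda>w. linear_form k (f w)) holomorphic_on S"
  unfolding linear_form_def by (intro holomorphic_intros)

lemma holomorphic_Delta_kernel:
  assumes "\<And>i. (\<lambda>w. f w i) holomorphic_on S" "\<And>x j. x \<in> S \<Longrightarrow> j \<in> {1..2 * k} \<Longrightarrow> f x j \<noteq> 0"
  shows "(\<lambda>w. Delta_kernel k (f w)) holomorphic_on S"
  unfolding Delta_kernel_def using assms by (intro holomorphic_intros holomorphic_Delta) auto

lemma Delta_scale: "Delta m (\<lambda>i. c * z i) = c ^ (\<Sum>j\<in>{1..m}. j - 1) * Delta m z"
proof -
  have "Delta m (\<lambda>i. c * z i) = (\<Prod>j\<in>{1..m}. c ^ (j - 1) * (\<Prod>i\<in>{1..<j}. z j - z i))"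
    unfolding Delta_def by (simp add: right_diff_distrib[symmetric] prod.distrib)
  thus ?thesis by (simp add: Delta_def prod.distrib power_sum)
qed

lemma linear_form_scale: "linear_form k (\<lambda>i. c * z i) = c * linear_form k z"
  by (simp add: linear_form_def sum_distrib_left right_diff_distrib)

lemma Delta_kernel_scale:
  assumes "c \<noteq> 0"
  shows "c ^ (k\<^sup>2) * Delta_kernel k (\<lambda>i. c * z i) = Delta_kernel k z"
proof -
  \<comment> \<open>Degrees are compared after doubling, which avoids division of natural
    numbers.\<close>
  have d: "2 * (\<Sum>j\<in>{1..m}. j - 1) = m * (m - 1)" for m :: nat
    by (induction m) (auto simp: algebra_simps)
  have "2 * (k\<^sup>2 + ((\<Sum>j\<in>{1..2 * k}. j - 1) + (\<Sum>j\<in>{1..k}. j - 1) + (\<Sum>j\<in>{1..k}. j - 1)))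
     = 2 * k\<^sup>2 + 2 * k * (2 * k - 1) + 2 * (k * (k - 1))"
    unfolding d[of k, symmetric] d[of "2 * k", symmetric] by simp
  also have "\<dots> = 2 * (2 * k * (2 * k - 1))"
    by (cases k) (auto simp: power2_eq_square algebra_simps)
  finally have "k\<^sup>2 + ((\<Sum>j\<in>{1..2 * k}. j - 1) + (\<Sum>j\<in>{1..k}. j - 1) + (\<Sum>j\<in>{1..k}. j - 1)) = 2 * k * (2 * k - 1)"
    unfolding mult_cancel1 by (elim disjE) simp_all
  hence E: "k\<^sup>2 + ((\<Sum>j\<in>{1..2 * k}. j - 1) + (\<Sum>j\<in>{1..k}. j - 1) + (\<Sum>j\<in>{1..k}. j - 1)) = (2 * k - 1) * (2 * k)"
    by (simp only: mult.commute[of "2 * k"])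
  have "c ^ (k\<^sup>2) * Delta_kernel k (\<lambda>i. c * z i) =
     c ^ (k\<^sup>2 + ((\<Sum>j\<in>{1..2 * k}. j - 1) + (\<Sum>j\<in>{1..k}. j - 1) + (\<Sum>j\<in>{1..k}. j - 1))) / c ^ ((2 * k - 1) * (2 * k)) * Delta_kernel k z"
    unfolding Delta_kernel_def
    by (simp add: Delta_scale[of _ c] Delta_scale[of _ c "\<lambda>i. z (k + i)"] power_mult_distrib prod.distrib power_add power_mult[symmetric] del: One_nat_def)
  thus ?thesis using assms unfolding E by simp
qed

lemma torus_point_eq_scale:
  "torus_point n (\<lambda>_. r) \<theta> = (\<lambda>i. of_real r * torus_point n (\<lambda>_. 1) \<theta> i)"
  by (auto simp: torus_point_def)

lemma continuous_torus_point:
  "continuous_on S (\<lambda>\<theta>. torus_point n r \<theta> i)"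
  unfolding torus_point_def by (cases "i \<in> {1..n}") (auto intro!: continuous_intros)

text \<open>The function \<open>g\<close> allows one argument to cover two cases:
  \<open>g = 1\<close> for the terms of the exponential series, and the entire factor in the
  remainder of that series.\<close>

locale kernel_integrand =
  fixes k :: nat and \<epsilon> :: real and H :: "(nat \<Rightarrow> complex) \<Rightarrow> complex" and g :: "complex \<Rightarrow> complex"
  assumes k: "k \<ge> 1" and eps: "\<epsilon> > 0"
    and contH: "continuous_on {z. \<forall>j\<in>{1..2 * k}. norm (z j) < \<epsilon>} H"
    and holH: "\<And>z l. \<forall>j\<in>{1..2 * k}. norm (z j) < \<epsilon> \<Longrightarrow> (\<lambda>w. H (z(l := w))) holomorphic_on ball 0 \<epsilon>"
    and g: "g holomorphic_on UNIV"
begin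

definition integrand :: "nat \<Rightarrow> (nat \<Rightarrow> complex) \<Rightarrow> complex" where
  "integrand m z = H z * Delta_kernel k z * linear_form k z ^ m * g (linear_form k z)"

lemma punctured_torus_function_integrand: "punctured_torus_function (2 * k) \<epsilon> (integrand m)"
proof
  have contg: "continuous_on UNIV g" using g by (rule holomorphic_on_imp_continuous_on)
  let ?S = "{z :: nat \<Rightarrow> complex. \<forall>j\<in>{1..2 * k}. z j \<noteq> 0 \<and> norm (z j) < \<epsilon>}"
  have "continuous_on ?S H" by (rule continuous_on_subset[OF contH]) auto
  moreover have "continuous_on ?S (Delta_kernel k)"
    by (rule continuous_Delta_kernel[of _ "\<lambda>z. z"]) (auto intro!: continuous_intros)
  moreover have lf: "continuous_on ?S (linear_form k)"
    by (rule continuous_linear_form[of _ "\<lambda>z. z"]) (intro continuous_intros)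
  moreover have "continuous_on ?S (\<lambda>z. g (linear_form k z))"
    by (rule continuous_on_compose2[OF contg lf]) simp
  ultimately show "continuous_on ?S (integrand m)"
    unfolding integrand_def by (intro continuous_intros)
next
  fix z :: "nat \<Rightarrow> complex" and j
  assume z: "\<forall>j\<in>{1..2 * k}. z j \<noteq> 0 \<and> norm (z j) < \<epsilon>" and j: "j \<in> {1..2 * k}"
  let ?S = "ball 0 \<epsilon> - {0 :: complex}"
  have co: "(\<lambda>w. (z(j := w)) i) holomorphic_on ?S" for i by (cases "i = j") auto
  have "(\<lambda>w. H (z(j := w))) holomorphic_on ?S"
    by (rule holomorphic_on_subset[OF holH]) (use z in auto)
  moreover have "(\<lambda>w. Delta_kernel k (z(j := w))) holomorphic_on ?S"
    by (rule holomorphic_Delta_kernel[OF co]) (use z in auto)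
  moreover have lf: "(\<lambda>w. linear_form k (z(j := w))) holomorphic_on ?S"
    by (rule holomorphic_linear_form[OF co])
  moreover have "(\<lambda>w. g (linear_form k (z(j := w)))) holomorphic_on ?S"
    using holomorphic_on_compose_gen[OF lf g] by (simp add: o_def)
  ultimately show "(\<lambda>w. integrand m (z(j := w))) holomorphic_on ?S"
    unfolding integrand_def by (intro holomorphic_intros)
qed

lemma continuous_integrand:
  "(\<And>j. j \<in> {1..2 * k} \<Longrightarrow> 0 < r j \<and> r j < \<epsilon>) \<Longrightarrow>
     continuous_on UNIV (\<lambda>\<theta>. integrand m (torus_point (2 * k) r \<theta>))"
  by (rule punctured_torus_function.continuous_torus[OF punctured_torus_function_integrand])

lemma torus_avg_integrand_radius:
  "(\<And>j. j \<in> {1..2 * k} \<Longrightarrow> 0 < r j \<and> r j < \<epsilon>) \<Longrightarrow> (\<And>j. j \<in> {1..2 * k} \<Longrightarrow> 0 < s j \<and> s j < \<epsilon>) \<Longrightarrow>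
     torus_avg (2 * k) (\<lambda>\<theta>. integrand m (torus_point (2 * k) s \<theta>)) =
     torus_avg (2 * k) (\<lambda>\<theta>. integrand m (torus_point (2 * k) r \<theta>))"
  by (rule punctured_torus_function.torus_avg_radius[OF punctured_torus_function_integrand])

text \<open>
  \<open>Delta_kernel\<close> is homogeneous of degree \<open>- k\<^sup>2\<close>, so for \<open>m \<ge> k\<^sup>2\<close> the integrand stays bounded as
  all radii shrink to \<open>0\<close> together.
\<close>
lemma torus_avg_integrand:
  assumes m: "m \<ge> k\<^sup>2" and r: "\<And>j. j \<in> {1..2 * k} \<Longrightarrow> 0 < r j \<and> r j < \<epsilon>"
  shows "torus_avg (2 * k) (\<lambda>\<theta>. integrand m (torus_point (2 * k) r \<theta>)) (\<lambda>_. 0) =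
     H (\<lambda>_. 0) * g 0 * 0 ^ (m - k\<^sup>2) *
     torus_avg (2 * k) (\<lambda>\<theta>. Delta_kernel k (torus_point (2 * k) (\<lambda>_. 1) \<theta>) * linear_form k (torus_point (2 * k) (\<lambda>_. 1) \<theta>) ^ m) (\<lambda>_. 0)"
proof -
  \<comment> \<open>The common radius, clamped to the interval from 0 to
    \<open>\<epsilon> / 2\<close>: this makes \<open>\<Phi>\<close> continuous everywhere and keeps
    the argument of \<open>H\<close> in its domain.\<close>
  define c :: "(nat \<Rightarrow> real) \<Rightarrow> complex" where "c \<theta> = of_real (max 0 (min (\<theta> 0) (\<epsilon> / 2)))" for \<theta>
  let ?T = "torus_point (2 * k) (\<lambda>_. 1)"
  define \<Phi> where "\<Phi> \<theta> = (H (\<lambda>i. c \<theta> * ?T \<theta> i) * g (c \<theta> * linear_form k (?T \<theta>)) * c \<theta> ^ (m - k\<^sup>2)) *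
     (Delta_kernel k (?T \<theta>) * linear_form k (?T \<theta>) ^ m)" for \<theta>
  have cc: "continuous_on UNIV c" unfolding c_def by (intro continuous_intros)
  have contg: "continuous_on UNIV g" using g by (rule holomorphic_on_imp_continuous_on)
  have contT: "continuous_on UNIV (\<lambda>\<theta>. linear_form k (?T \<theta>))"
    by (intro continuous_linear_form continuous_torus_point)
  have nc: "norm (c \<theta> * ?T \<theta> i) < \<epsilon>" for \<theta> i
    using eps by (auto simp: c_def torus_point_def norm_mult)
  have contH': "continuous_on UNIV (\<lambda>\<theta>. H (\<lambda>i. c \<theta> * ?T \<theta> i))"
    by (rule continuous_on_compose2[OF contH])
       (use nc in \<open>auto intro!: continuous_on_coordinatewise_then_product continuous_intros cc continuous_torus_point\<close>)
  have contg': "continuous_on UNIV (\<lambda>\<theta>. g (c \<theta> * linear_form k (?T \<theta>)))"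
    by (rule continuous_on_compose2[OF contg]) (auto intro!: continuous_intros cc contT)
  have contD: "continuous_on UNIV (\<lambda>\<theta>. Delta_kernel k (?T \<theta>))"
    by (rule continuous_Delta_kernel[OF continuous_torus_point]) (auto simp: torus_point_def)
  have cont: "continuous_on UNIV \<Phi>"
    unfolding \<Phi>_def by (intro continuous_intros cc contH' contg' contT contD)
  have "torus_avg (2 * k) (\<lambda>\<theta>. integrand m (torus_point (2 * k) r \<theta>)) (\<lambda>_. 0) = torus_avg (2 * k) \<Phi> ((\<lambda>_. 0)(0 := 0))"
  proof (rule punctured_torus_function.torus_avg_shrink[OF punctured_torus_function_integrand r _ _ cont])
    fix \<rho> :: real and \<theta> :: "nat \<Rightarrow> real"
    assume \<rho>: "0 < \<rho>" "\<rho> < \<epsilon> / 2"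
    have c: "c (\<theta>(0 := \<rho>)) = of_real \<rho>" using \<rho> by (simp add: c_def)
    have T: "?T (\<theta>(0 := \<rho>)) = ?T \<theta>" by (auto simp: torus_point_def)
    have "Delta_kernel k (?T \<theta>) * of_real \<rho> ^ (m - k\<^sup>2) = Delta_kernel k (\<lambda>i. of_real \<rho> * ?T \<theta> i) * of_real \<rho> ^ m"
    proof -
      have "Delta_kernel k (?T \<theta>) * of_real \<rho> ^ (m - k\<^sup>2) =
         Delta_kernel k (\<lambda>i. of_real \<rho> * ?T \<theta> i) * (of_real \<rho> ^ (k\<^sup>2) * of_real \<rho> ^ (m - k\<^sup>2))"
        using Delta_kernel_scale[of "of_real \<rho>" k "?T \<theta>"] \<rho> by (simp add: mult_ac)
      also have "of_real \<rho> ^ (k\<^sup>2) * of_real \<rho> ^ (m - k\<^sup>2) = (of_real \<rho> ^ m :: complex)"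
        using m by (simp flip: power_add)
      finally show ?thesis .
    qed
    thus "\<Phi> (\<theta>(0 := \<rho>)) = integrand m (torus_point (2 * k) (\<lambda>_. \<rho>) \<theta>)"
      unfolding \<Phi>_def integrand_def torus_point_eq_scale[of _ \<rho>] linear_form_scale c T
      by (simp add: power_mult_distrib mult_ac)
  qed (use eps in auto)
  also have "\<dots> = torus_avg (2 * k) (\<lambda>\<theta>. \<Phi> (\<theta>(0 := 0))) (\<lambda>_. 0)"
    by (rule torus_avg_fun_upd) simp
  \<comment> \<open>The power \<open>0 ^ (m - k\<^sup>2)\<close> is 1 for
    \<open>m = k\<^sup>2\<close> and 0 for larger \<open>m\<close>; so the limit is the leading term
    in the first case and vanishes in the second.\<close>
  also have "(\<lambda>\<theta>. \<Phi> (\<theta>(0 := 0))) = (\<lambda>\<theta>. (H (\<lambda>_. 0) * g 0 * 0 ^ (m - k\<^sup>2)) * (Delta_kernel k (?T \<theta>) * linear_form k (?T \<theta>) ^ m))"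
  proof
    fix \<theta> :: "nat \<Rightarrow> real"
    have "c (\<theta>(0 := 0)) = 0" using eps by (simp add: c_def)
    moreover have "?T (\<theta>(0 := 0)) = ?T \<theta>" by (auto simp: torus_point_def)
    ultimately show "\<Phi> (\<theta>(0 := 0)) = (H (\<lambda>_. 0) * g 0 * 0 ^ (m - k\<^sup>2)) * (Delta_kernel k (?T \<theta>) * linear_form k (?T \<theta>) ^ m)"
      unfolding \<Phi>_def by simp
  qed
  finally show ?thesis by (simp only: torus_avg_cmult)
qed

end

text \<open>The quotient of the tail of the exponential series by \<open>w ^ N\<close>, given as a
  power series so that it is entire also at \<open>w = 0\<close>.\<close>

definition exp_remainder :: "nat \<Rightarrow> complex \<Rightarrow> complex" where
  "exp_remainder N w = (\<Sum>i. 1 / fact (i + N) * w ^ i)"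

lemma exp_eq_sum_remainder: "exp w = (\<Sum>m<N. w ^ m / fact m) + w ^ N * exp_remainder N w"
  and exp_remainder_holomorphic: "exp_remainder N holomorphic_on UNIV"
proof -
  have sm: "summable (\<lambda>i. 1 / fact (i + N) * w ^ i)" for w :: complex
  proof (rule summable_comparison_test)
    show "summable (\<lambda>i. norm w ^ i / fact i)" using summable_exp[of "norm w"] by (simp add: field_simps)
    have "(fact i :: real) \<le> fact (i + N)" for i by (rule fact_mono) simp
    thus "\<exists>M. \<forall>i\<ge>M. norm (1 / fact (i + N) * w ^ i) \<le> norm w ^ i / fact i"
      by (auto simp: norm_mult norm_divide norm_power intro!: frac_le)
  qed
  have "exp w = (\<Sum>i. w ^ i / fact i)"
    unfolding exp_def by (simp add: scaleR_conv_of_real divide_inverse mult.commute)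
  also have "\<dots> = (\<Sum>i. w ^ (i + N) / fact (i + N)) + (\<Sum>m<N. w ^ m / fact m)"
    by (rule suminf_split_initial_segment) (use summable_exp[of w] in \<open>simp add: divide_inverse mult.commute\<close>)
  also have "(\<Sum>i. w ^ (i + N) / fact (i + N)) = (\<Sum>i. w ^ N * (1 / fact (i + N) * w ^ i))"
    by (simp add: power_add mult_ac)
  also have "\<dots> = w ^ N * exp_remainder N w"
    unfolding exp_remainder_def by (rule suminf_mult[OF sm])
  finally show "exp w = (\<Sum>m<N. w ^ m / fact m) + w ^ N * exp_remainder N w" by simp
  show "exp_remainder N holomorphic_on UNIV"
    unfolding exp_remainder_def[abs_def] holomorphic_on_open[OF open_UNIV]
    using termdiffs_strong_converges_everywhere[OF sm] by blast
qed

section \<open>Cancellation of the poles of zeta\<close>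

lemma Delta_lessThan: "Delta m z = (\<Prod>a<m. \<Prod>b<a. z (Suc a) - z (Suc b))"
  unfolding Delta_eq_det det_vandermonde ..

lemma Delta_split:
  "Delta (2 * k) z = Delta k z * Delta k (\<lambda>i. z (k + i)) * (\<Prod>i\<in>{1..k}. \<Prod>j\<in>{1..k}. z (k + j) - z i)"
proof -
  have "Delta (2 * k) z = Delta k z * (\<Prod>a<k. (\<Prod>b<k. z (k + Suc a) - z (Suc b)) * (\<Prod>b<a. z (k + Suc a) - z (k + Suc b)))"
    unfolding Delta_lessThan mult_2 prod_lessThan_add by simp
  also have "(\<Prod>a<k. (\<Prod>b<k. z (k + Suc a) - z (Suc b)) * (\<Prod>b<a. z (k + Suc a) - z (k + Suc b)))
     = (\<Prod>a<k. \<Prod>b<k. z (k + Suc a) - z (Suc b)) * Delta k (\<lambda>i. z (k + i))"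
    by (simp add: prod.distrib Delta_lessThan)
  also have "(\<Prod>a<k. \<Prod>b<k. z (k + Suc a) - z (Suc b)) = (\<Prod>i\<in>{1..k}. \<Prod>j\<in>{1..k}. z (k + j) - z i)"
    unfolding prod_atLeast1_atMost by (rule prod.swap)
  finally show ?thesis by (simp add: mult_ac)
qed

text \<open>If two variables of different blocks coincide, both sides are 0, whatever
  \<open>zeta 1\<close> is. Otherwise each factor \<open>z (k + j) - z i\<close> turns one zeta
  factor into \<open>- W\<close>.\<close>

lemma zeta_prod_Delta:
  assumes W: "\<And>s. s \<noteq> 1 \<Longrightarrow> W s = (s - 1) * zeta s"
  shows "(\<Prod>i\<in>{1..k}. \<Prod>j\<in>{1..k}. zeta (1 + z i - z (k + j))) * (Delta (2 * k) z)\<^sup>2 =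
    (- 1) ^ k * (\<Prod>i\<in>{1..k}. \<Prod>j\<in>{1..k}. W (1 + z i - z (k + j))) *
    (Delta (2 * k) z * Delta k z * Delta k (\<lambda>i. z (k + i)))"
proof (cases "\<exists>i\<in>{1..k}. \<exists>j\<in>{1..k}. z (k + j) = z i")
  case True
  hence "(\<Prod>i\<in>{1..k}. \<Prod>j\<in>{1..k}. z (k + j) - z i) = 0"
    by (auto simp: prod_zero_iff)
  hence "Delta (2 * k) z = 0" by (simp add: Delta_split)
  thus ?thesis by simp
next
  case False
  have "(\<Prod>i\<in>{1..k}. \<Prod>j\<in>{1..k}. zeta (1 + z i - z (k + j))) * (\<Prod>i\<in>{1..k}. \<Prod>j\<in>{1..k}. z (k + j) - z i)
     = (\<Prod>i\<in>{1..k}. \<Prod>j\<in>{1..k}. zeta (1 + z i - z (k + j)) * (z (k + j) - z i))"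
    by (simp add: prod.distrib)
  also have "\<dots> = (\<Prod>i\<in>{1..k}. \<Prod>j\<in>{1..k}. (- 1) * W (1 + z i - z (k + j)))"
  proof (intro prod.cong refl)
    fix i j assume "i \<in> {1..k}" "j \<in> {1..k}"
    hence "z i \<noteq> z (k + j)" using False by metis
    hence "1 + z i - z (k + j) \<noteq> 1" by (simp add: diff_eq_eq)
    from W[OF this] show "zeta (1 + z i - z (k + j)) * (z (k + j) - z i) = (- 1) * W (1 + z i - z (k + j))"
      by (simp add: algebra_simps)
  qed
  also have "\<dots> = ((- 1) ^ k) ^ k * (\<Prod>i\<in>{1..k}. \<Prod>j\<in>{1..k}. W (1 + z i - z (k + j)))"
    unfolding prod.distrib by simp
  \<comment> \<open>There are \<open>k\<^sup>2\<close> signs, and \<open>k\<^sup>2\<close> has the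
    parity of \<open>k\<close>.\<close>
  also have "((- 1) ^ k) ^ k = ((- 1) ^ k :: complex)"
    by (cases "even k") auto
  finally have *: "(\<Prod>i\<in>{1..k}. \<Prod>j\<in>{1..k}. zeta (1 + z i - z (k + j))) * (\<Prod>i\<in>{1..k}. \<Prod>j\<in>{1..k}. z (k + j) - z i)
     = (- 1) ^ k * (\<Prod>i\<in>{1..k}. \<Prod>j\<in>{1..k}. W (1 + z i - z (k + j)))" .
  have "(Delta (2 * k) z)\<^sup>2 = (\<Prod>i\<in>{1..k}. \<Prod>j\<in>{1..k}. z (k + j) - z i) * (Delta (2 * k) z * Delta k z * Delta k (\<lambda>i. z (k + i)))"
    unfolding power2_eq_square by (subst (1) Delta_split) (simp only: mult_ac)
  thus ?thesis unfolding mult.assoc[symmetric] *[symmetric] by (simp only: mult.assoc)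
qed

text \<open>The sign left by the zeta factors cancels the \<open>(- 1) ^ k\<close> in
  \<open>P\<close>, and the powers of \<open>2 pi i\<close> cancel as well.\<close>

lemma P_eq_torus_avg:
  assumes k: "k \<ge> 1" and W: "\<And>s. s \<noteq> 1 \<Longrightarrow> W s = (s - 1) * zeta s"
    and r: "\<And>j. j \<in> {1..2 * k} \<Longrightarrow> 0 < r j"
  shows "P k r x = 1 / (fact k)\<^sup>2 * torus_avg (2 * k) (\<lambda>\<theta>.
     A k (torus_point (2 * k) r \<theta>) *
     (\<Prod>i\<in>{1..k}. \<Prod>j\<in>{1..k}. W (1 + torus_point (2 * k) r \<theta> i - torus_point (2 * k) r \<theta> (k + j))) *
     Delta_kernel k (torus_point (2 * k) r \<theta>) * exp (of_real x / 2 * linear_form k (torus_point (2 * k) r \<theta>))) (\<lambda>_. 0)"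
proof -
  let ?T = "torus_point (2 * k) r"
  let ?F = "\<lambda>z. A k z * (\<Prod>i\<in>{1..k}. \<Prod>j\<in>{1..k}. W (1 + z i - z (k + j))) * Delta_kernel k z * exp (of_real x / 2 * linear_form k z)"
  have eq: "(\<Prod>j\<in>{1..2 * k}. ?T \<theta> j) * P_integrand k x (?T \<theta>) = (- 1) ^ k * ?F (?T \<theta>)" for \<theta>
  proof -
    define z where "z = ?T \<theta>"
    have zd: "(\<Prod>i\<in>{1..k}. \<Prod>j\<in>{1..k}. zeta (1 + z i - z (k + j))) * (Delta (2 * k) z)\<^sup>2 =
        (- 1) ^ k * (\<Prod>i\<in>{1..k}. \<Prod>j\<in>{1..k}. W (1 + z i - z (k + j))) *
        (Delta (2 * k) z * Delta k z * Delta k (\<lambda>i. z (k + i)))"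
      using W by (rule zeta_prod_Delta)
    have nz: "z j \<noteq> 0" if "j \<in> {1..2 * k}" for j
      using r[OF that] that by (auto simp: z_def torus_point_def)
    have "(\<Prod>j\<in>{1..2 * k}. z j ^ (2 * k)) = (\<Prod>j\<in>{1..2 * k}. z j) * (\<Prod>j\<in>{1..2 * k}. z j ^ (2 * k - 1))"
      unfolding prod.distrib[symmetric] using k by (intro prod.cong refl) (simp flip: power_Suc)
    moreover have "(\<Prod>j\<in>{1..2 * k}. z j) \<noteq> 0" using nz by (simp add: prod_zero_iff)
    ultimately have q: "(\<Prod>j\<in>{1..2 * k}. z j) * (u / (\<Prod>j\<in>{1..2 * k}. z j ^ (2 * k))) = u / (\<Prod>j\<in>{1..2 * k}. z j ^ (2 * k - 1))" for u
      by simp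
    have "(\<Prod>j\<in>{1..2 * k}. z j) * P_integrand k x z =
       A k z * ((\<Prod>i\<in>{1..k}. \<Prod>j\<in>{1..k}. zeta (1 + z i - z (k + j))) * (Delta (2 * k) z)\<^sup>2) / (\<Prod>j\<in>{1..2 * k}. z j ^ (2 * k - 1)) * exp (of_real x / 2 * linear_form k z)"
      unfolding P_integrand_def G_def linear_form_def mult.assoc[symmetric]
      by (subst q[symmetric]) (simp only: mult_ac times_divide_eq_right times_divide_eq_left)
    also have "\<dots> = (- 1) ^ k * ?F z"
      unfolding zd Delta_kernel_def by (simp only: mult_ac times_divide_eq_right times_divide_eq_left)
    finally show ?thesis by (simp only: z_def)
  qed
  have "((- 1) ^ k * (- 1) ^ k :: complex) = 1" by (simp flip: power_mult_distrib)
  moreover have "(2 * of_real pi * \<i>) ^ (2 * k) \<noteq> (0 :: complex)" by simp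
  ultimately show ?thesis
    unfolding P_def multi_circle_integral_eq_torus_avg[where \<theta> = "\<lambda>_. 0"] eq torus_avg_cmult
    by (simp add: field_simps)
qed

section \<open>Polynomiality and the leading coefficient\<close>

text \<open>The terms of order up to \<open>k\<^sup>2\<close> are moved to the fixed radii
  \<open>s\<close>, so that the coefficients on the right do not depend on \<open>r\<close>.\<close>

lemma torus_avg_kernel_exp:
  fixes x :: complex
  assumes k: "k \<ge> 1" and eps: "\<epsilon> > 0"
    and contH: "continuous_on {z. \<forall>j\<in>{1..2 * k}. norm (z j) < \<epsilon>} H"
    and holH: "\<And>z l. \<forall>j\<in>{1..2 * k}. norm (z j) < \<epsilon> \<Longrightarrow> (\<lambda>w. H (z(l := w))) holomorphic_on ball 0 \<epsilon>"
    and r: "\<And>j. j \<in> {1..2 * k} \<Longrightarrow> 0 < r j \<and> r j < \<epsilon>" and s: "\<And>j. j \<in> {1..2 * k} \<Longrightarrow> 0 < s j \<and> s j < \<epsilon>"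
  shows "torus_avg (2 * k) (\<lambda>\<theta>. H (torus_point (2 * k) r \<theta>) * Delta_kernel k (torus_point (2 * k) r \<theta>) *
       exp (x / 2 * linear_form k (torus_point (2 * k) r \<theta>))) (\<lambda>_. 0) =
     (\<Sum>m\<le>k\<^sup>2. (x / 2) ^ m / fact m * torus_avg (2 * k) (\<lambda>\<theta>. H (torus_point (2 * k) s \<theta>) *
        Delta_kernel k (torus_point (2 * k) s \<theta>) * linear_form k (torus_point (2 * k) s \<theta>) ^ m) (\<lambda>_. 0))"
proof -
  let ?T = "torus_point (2 * k) r" and ?N = "Suc (k\<^sup>2)"
  let ?R = "\<lambda>w. exp_remainder ?N (x / 2 * w)"
  interpret one: kernel_integrand k \<epsilon> H "\<lambda>_. 1"
    by unfold_locales (use k eps contH holH in auto)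
  have "?R holomorphic_on UNIV"
  proof -
    have "(\<lambda>w. x / 2 * w) holomorphic_on UNIV" by (intro holomorphic_intros)
    from holomorphic_on_compose_gen[OF this exp_remainder_holomorphic] show ?thesis by (simp add: o_def)
  qed
  then interpret rem: kernel_integrand k \<epsilon> H ?R
    by unfold_locales (use k eps contH holH in auto)
  have split: "H z * Delta_kernel k z * exp (x / 2 * linear_form k z) =
     (\<Sum>m<?N. (x / 2) ^ m / fact m * one.integrand m z) + (x / 2) ^ ?N * rem.integrand ?N z" for z
    unfolding exp_eq_sum_remainder[of "x / 2 * linear_form k z" ?N] one.integrand_def rem.integrand_def
    by (simp only: ring_distribs sum_distrib_left power_mult_distrib mult_1_right)
       (simp add: mult_ac del: power_Suc)
  have "torus_avg (2 * k) (\<lambda>\<theta>. H (?T \<theta>) * Delta_kernel k (?T \<theta>) * exp (x / 2 * linear_form k (?T \<theta>))) (\<lambda>_. 0)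
    = torus_avg (2 * k) (\<lambda>\<theta>. \<Sum>m<?N. (x / 2) ^ m / fact m * one.integrand m (?T \<theta>)) (\<lambda>_. 0)
      + (x / 2) ^ ?N * torus_avg (2 * k) (\<lambda>\<theta>. rem.integrand ?N (?T \<theta>)) (\<lambda>_. 0)"
  proof -
    have "continuous_on UNIV (\<lambda>\<theta>. \<Sum>m<?N. (x / 2) ^ m / fact m * one.integrand m (?T \<theta>))"
      by (intro continuous_intros one.continuous_integrand[OF r])
    moreover have "continuous_on UNIV (\<lambda>\<theta>. (x / 2) ^ ?N * rem.integrand ?N (?T \<theta>))"
      by (intro continuous_intros rem.continuous_integrand[OF r])
    ultimately show ?thesis unfolding split by (simp only: torus_avg_add torus_avg_cmult)
  qed
  \<comment> \<open>The power is \<open>k\<^sup>2 + 1\<close>, one above the critical one, so a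
    factor \<open>0 ^ 1\<close> appears in the limit.\<close>
  also have "torus_avg (2 * k) (\<lambda>\<theta>. rem.integrand ?N (?T \<theta>)) (\<lambda>_. 0) = 0"
    by (subst rem.torus_avg_integrand) (use r in auto)
  also have "torus_avg (2 * k) (\<lambda>\<theta>. \<Sum>m<?N. (x / 2) ^ m / fact m * one.integrand m (?T \<theta>)) (\<lambda>_. 0) =
     (\<Sum>m<?N. (x / 2) ^ m / fact m * torus_avg (2 * k) (\<lambda>\<theta>. one.integrand m (?T \<theta>)) (\<lambda>_. 0))"
  proof -
    have "continuous_on UNIV (\<lambda>\<theta>. (x / 2) ^ m / fact m * one.integrand m (?T \<theta>))" for m
      by (intro continuous_intros one.continuous_integrand[OF r]) auto
    hence "torus_avg (2 * k) (\<lambda>\<theta>. \<Sum>m<?N. (x / 2) ^ m / fact m * one.integrand m (?T \<theta>)) (\<lambda>_. 0) =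
       (\<Sum>m<?N. torus_avg (2 * k) (\<lambda>\<theta>. (x / 2) ^ m / fact m * one.integrand m (?T \<theta>)) (\<lambda>_. 0))"
      by (intro torus_avg_sum finite_lessThan)
    thus ?thesis by (simp only: torus_avg_cmult)
  qed
  also have "\<dots> = (\<Sum>m<?N. (x / 2) ^ m / fact m * torus_avg (2 * k) (\<lambda>\<theta>. one.integrand m (torus_point (2 * k) s \<theta>)) (\<lambda>_. 0))"
    using one.torus_avg_integrand_radius[OF s r] by simp
  finally show ?thesis unfolding one.integrand_def lessThan_Suc_atMost by simp
qed

text \<open>Doubling all radii multiplies the average by 2 to the power \<open>m - k^2\<close>, by
  homogeneity, and leaves it unchanged, by independence of the radii.\<close>

lemma torus_avg_kernel_low_power:
  assumes k: "k \<ge> 1" and m: "m \<noteq> k\<^sup>2"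
  shows "torus_avg (2 * k) (\<lambda>\<theta>. Delta_kernel k (torus_point (2 * k) (\<lambda>_. 1) \<theta>) * linear_form k (torus_point (2 * k) (\<lambda>_. 1) \<theta>) ^ m) (\<lambda>_. 0) = 0"
proof -
  \<comment> \<open>The bound 3 admits both radii, 1 and 2, used below.\<close>
  interpret kernel_integrand k 3 "\<lambda>_. 1" "\<lambda>_. 1"
    by unfold_locales (use k in auto)
  let ?T = "\<lambda>r. torus_point (2 * k) (\<lambda>_. r)"
  let ?J = "\<lambda>r. torus_avg (2 * k) (\<lambda>\<theta>. integrand m (?T r \<theta>)) (\<lambda>_. 0)"
  have "2 ^ (k\<^sup>2) * integrand m (?T 2 \<theta>) = 2 ^ m * integrand m (?T 1 \<theta>)" for \<theta>
    unfolding torus_point_eq_scale[of _ 2] integrand_def linear_form_scale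
    using Delta_kernel_scale[of 2 k "?T 1 \<theta>"] by (simp add: power_mult_distrib mult_ac)
  hence "torus_avg (2 * k) (\<lambda>\<theta>. 2 ^ (k\<^sup>2) * integrand m (?T 2 \<theta>)) (\<lambda>_. 0) = torus_avg (2 * k) (\<lambda>\<theta>. 2 ^ m * integrand m (?T 1 \<theta>)) (\<lambda>_. 0)"
    by simp
  hence "2 ^ (k\<^sup>2) * ?J 2 = 2 ^ m * ?J 1" by (simp only: torus_avg_cmult)
  moreover have "?J 2 = ?J 1" by (subst torus_avg_integrand_radius[of "\<lambda>_. 1"]) auto
  moreover have "(2 :: complex) ^ (k\<^sup>2) \<noteq> 2 ^ m"
  proof
    assume "(2 :: complex) ^ (k\<^sup>2) = 2 ^ m"
    hence "norm ((2 :: complex) ^ (k\<^sup>2)) = norm ((2 :: complex) ^ m)" by simp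
    hence "(2 :: real) ^ (k\<^sup>2) = 2 ^ m" by (simp add: norm_power)
    thus False using m by simp
  qed
  ultimately have "?J 1 = 0" by simp
  thus ?thesis by (simp add: integrand_def)
qed

text \<open>The expansion of the average of the kernel times
  \<open>exp (linear_form k z / 2)\<close> has a single nonzero term, that of order
  \<open>k\<^sup>2\<close>, so the known value of the whole determines it.\<close>

lemma torus_avg_kernel_top_power:
  assumes k: "k \<ge> 1"
  shows "torus_avg (2 * k) (\<lambda>\<theta>. Delta_kernel k (torus_point (2 * k) (\<lambda>_. 1) \<theta>) * linear_form k (torus_point (2 * k) (\<lambda>_. 1) \<theta>) ^ (k\<^sup>2)) (\<lambda>_. 0)
    = 2 ^ (k\<^sup>2) * fact (k\<^sup>2) * ((fact k)\<^sup>2 * (\<Prod>l<k. fact l / fact (k + l)))"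
proof -
  let ?T = "torus_point (2 * k) (\<lambda>_. 1)"
  let ?J = "\<lambda>m. torus_avg (2 * k) (\<lambda>\<theta>. Delta_kernel k (?T \<theta>) * linear_form k (?T \<theta>) ^ m) (\<lambda>_. 0)"
  have "(\<Sum>m\<le>k\<^sup>2. (1 / 2) ^ m / fact m * ?J m) = (fact k)\<^sup>2 * (\<Prod>l<k. fact l / fact (k + l))"
    using torus_avg_kernel_exp[of k 2 "\<lambda>_. 1" "\<lambda>_. 1" "\<lambda>_. 1" 1] torus_avg_Delta_kernel_exp[OF k] k by simp
  moreover have "(\<Sum>m\<le>k\<^sup>2. (1 / 2) ^ m / fact m * ?J m) = (\<Sum>m\<in>{k\<^sup>2}. (1 / 2) ^ m / fact m * ?J m)"
    by (rule sum.mono_neutral_right) (use torus_avg_kernel_low_power[OF k] in auto)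
  ultimately show ?thesis by (simp add: field_simps)
qed

lemma poly_monom_sum_over_power_tendsto:
  fixes q :: "nat \<Rightarrow> complex"
  shows "((\<lambda>x :: real. (\<Sum>m\<le>N. q m * of_real x ^ m) / of_real x ^ N) \<longlongrightarrow> q N) at_top"
proof -
  have "((\<lambda>x :: real. q m * of_real x ^ m / of_real x ^ N) \<longlongrightarrow> (if m = N then q N else 0)) at_top" if "m \<le> N" for m
  proof (cases "m = N")
    case True
    have "\<forall>\<^sub>F x :: real in at_top. q m * of_real x ^ m / of_real x ^ N = q N"
      using eventually_gt_at_top[of "0 :: real"] by eventually_elim (use True in simp)
    thus ?thesis using True by (simp add: tendsto_eventually)
  next
    case False
    hence "((\<lambda>x :: real. inverse (x ^ (N - m))) \<longlongrightarrow> 0) at_top"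
      using that by (intro tendsto_inverse_0_at_top filterlim_pow_at_top filterlim_ident) auto
    from tendsto_mult[OF tendsto_const[of "q m"] tendsto_of_real[OF this]]
    have "((\<lambda>x :: real. q m * of_real (inverse (x ^ (N - m)))) \<longlongrightarrow> 0) at_top" by simp
    moreover have "\<forall>\<^sub>F x :: real in at_top. q m * of_real (inverse (x ^ (N - m))) = q m * of_real x ^ m / of_real x ^ N"
      using eventually_gt_at_top[of "0 :: real"]
    proof eventually_elim
      case (elim x)
      have "of_real x ^ N = (of_real x ^ (N - m) * of_real x ^ m :: complex)" using that by (simp flip: power_add)
      thus ?case using elim by (simp add: field_simps)
    qed
    ultimately show ?thesis using False by (simp add: tendsto_cong)
  qed
  hence "((\<lambda>x :: real. \<Sum>m\<le>N. q m * of_real x ^ m / of_real x ^ N) \<longlongrightarrow> (\<Sum>m\<le>N. if m = N then q N else 0)) at_top"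
    by (intro tendsto_sum) auto
  thus ?thesis by (simp add: sum_divide_distrib)
qed

text \<open>Small circles are circles of arbitrary, possibly different, radii below one bound;
  \<open>Q\<close> is chosen before the radii, so the polynomial is the same for all of
  them.\<close>

theorem mainTheorem1:
  fixes k :: nat
  assumes "k \<ge> 1"
  defines "a \<equiv> A k (\<lambda>_. 0)"
  defines "c \<equiv> a * (\<Prod>l\<in>{0..k - 1}. fact l / fact (k + l))"
  shows "(\<lambda>p. if prime p
              then (1 - 1 / of_nat p) ^ ((k - 1)\<^sup>2) *
                   (\<Sum>m\<in>{0..k - 1}. (of_nat ((k - 1) choose m))\<^sup>2 / of_nat p ^ m)
              else 1) has_prod a
    \<and> (\<exists>\<epsilon>>0. \<exists>Q :: complex poly. degree Q = k\<^sup>2 \<and> lead_coeff Q = c \<and>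
         (\<forall>r :: nat \<Rightarrow> real. (\<forall>j\<in>{1..2 * k}. 0 < r j \<and> r j < \<epsilon>) \<longrightarrow>
            (\<forall>x :: real. P k r x = poly Q (of_real x)) \<and>
            ((\<lambda>x :: real. P k r x / of_real x ^ (k\<^sup>2)) \<longlongrightarrow> c) at_top))"
proof -
  obtain W where W: "W holomorphic_on UNIV" "W 1 = 1" "\<And>s. s \<noteq> 1 \<Longrightarrow> W s = (s - 1) * zeta s"
    using zeta_times_minus_one_entire by blast
  define H where "H z = A k z * (\<Prod>i\<in>{1..k}. \<Prod>j\<in>{1..k}. W (1 + z i - z (k + j)))" for z
  have contW: "continuous_on UNIV W" using W(1) by (rule holomorphic_on_imp_continuous_on)
  have contH: "continuous_on {z. \<forall>j\<in>{1..2 * k}. norm (z j) < 1 / 12} H"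
  proof -
    let ?S = "{z :: nat \<Rightarrow> complex. \<forall>j\<in>{1..2 * k}. norm (z j) < 1 / 12}"
    have "continuous_on ?S (A k)" by (rule continuous_on_subset[OF continuous_A[of k]]) (auto simp: less_imp_le)
    moreover have "continuous_on ?S (\<lambda>z. W (1 + z i - z (k + j)))" for i j
      by (rule continuous_on_compose2[OF contW]) (auto intro!: continuous_intros)
    ultimately show ?thesis unfolding H_def by (intro continuous_intros)
  qed
  have holH: "(\<lambda>w. H (z(l := w))) holomorphic_on ball 0 (1 / 12)"
    if z: "\<forall>j\<in>{1..2 * k}. norm (z j) < 1 / 12" for z l
  proof -
    have co: "(\<lambda>w. (z(l := w)) i) holomorphic_on ball 0 (1 / 12)" for i by (cases "i = l") auto
    have "(\<lambda>w. A k (z(l := w))) holomorphic_on ball 0 (1 / 12)"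
      by (rule holomorphic_A) (use z in \<open>auto simp: less_imp_le\<close>)
    moreover have "(\<lambda>w. W (1 + (z(l := w)) i - (z(l := w)) (k + j))) holomorphic_on ball 0 (1 / 12)" for i j
    proof -
      have "(\<lambda>w. 1 + (z(l := w)) i - (z(l := w)) (k + j)) holomorphic_on ball 0 (1 / 12)"
        by (intro holomorphic_intros co)
      from holomorphic_on_compose_gen[OF this W(1)] show ?thesis by (simp add: o_def)
    qed
    ultimately show ?thesis unfolding H_def by (intro holomorphic_intros)
  qed
  define N where "N = k\<^sup>2"
  \<comment> \<open>An arbitrary fixed radius below 1/12 at which the coefficients are evaluated
    once and for all.\<close>
  let ?s = "\<lambda>_ :: nat. 1 / 24 :: real"
  define J where "J m = torus_avg (2 * k) (\<lambda>\<theta>. H (torus_point (2 * k) ?s \<theta>) *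
        Delta_kernel k (torus_point (2 * k) ?s \<theta>) * linear_form k (torus_point (2 * k) ?s \<theta>) ^ m) (\<lambda>_. 0)" for m
  define q where "q m = J m / (2 ^ m * fact m * (fact k)\<^sup>2)" for m
  define Q where "Q = (\<Sum>m\<le>N. monom (q m) m)"
  have P_eq: "P k r x = (\<Sum>m\<le>N. q m * of_real x ^ m)"
    if r: "\<And>j. j \<in> {1..2 * k} \<Longrightarrow> 0 < r j \<and> r j < 1 / 12" for r and x :: real
  proof -
    have "P k r x = 1 / (fact k)\<^sup>2 * torus_avg (2 * k) (\<lambda>\<theta>. H (torus_point (2 * k) r \<theta>) *
       Delta_kernel k (torus_point (2 * k) r \<theta>) * exp (of_real x / 2 * linear_form k (torus_point (2 * k) r \<theta>))) (\<lambda>_. 0)"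
      unfolding H_def by (rule P_eq_torus_avg) (use assms(1) W(3) r in auto)
    also have "torus_avg (2 * k) (\<lambda>\<theta>. H (torus_point (2 * k) r \<theta>) *
       Delta_kernel k (torus_point (2 * k) r \<theta>) * exp (of_real x / 2 * linear_form k (torus_point (2 * k) r \<theta>))) (\<lambda>_. 0)
       = (\<Sum>m\<le>N. (of_real x / 2) ^ m / fact m * J m)"
      unfolding J_def N_def
    proof (rule torus_avg_kernel_exp[where \<epsilon> = "1 / 12"])
      show "(\<lambda>w. H (z(l := w))) holomorphic_on ball 0 (1 / 12)"
        if "\<forall>j\<in>{1..2 * k}. norm (z j) < 1 / 12" for z l using that by (rule holH)
    qed (use assms(1) contH r in auto)
    finally show ?thesis
      by (simp add: q_def sum_distrib_left power_divide field_simps)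
  qed
  have "J N = H (\<lambda>_. 0) * (2 ^ N * fact N * ((fact k)\<^sup>2 * (\<Prod>l<k. fact l / fact (k + l))))"
  proof -
    interpret kernel_integrand k "1 / 12" H "\<lambda>_. 1"
    proof
      show "(\<lambda>w. H (z(l := w))) holomorphic_on ball 0 (1 / 12)"
        if "\<forall>j\<in>{1..2 * k}. norm (z j) < 1 / 12" for z l using that by (rule holH)
    qed (use assms(1) contH in auto)
    show ?thesis
      using torus_avg_integrand[of N ?s] torus_avg_kernel_top_power[OF assms(1)]
      by (simp add: J_def integrand_def N_def)
  qed
  moreover have "H (\<lambda>_. 0) = a" by (simp add: H_def a_def W(2))
  moreover have "{0..k - 1} = {..<k}" using assms(1) by auto
  ultimately have qN: "q N = c" by (simp add: q_def c_def)
  have "c \<noteq> 0" using A_0_has_prod(2)[OF assms(1)] by (simp add: c_def a_def prod_zero_iff)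
  have coeff: "coeff Q n = (if n \<le> N then q n else 0)" for n
    by (simp add: Q_def coeff_sum)
  have deg: "degree Q = N"
  proof (rule antisym)
    show "degree Q \<le> N" by (rule degree_le) (simp add: coeff)
    show "N \<le> degree Q" using \<open>c \<noteq> 0\<close> by (intro le_degree) (simp add: coeff qN)
  qed
  have polyQ: "poly Q x = (\<Sum>m\<le>N. q m * x ^ m)" for x
    by (simp add: Q_def poly_sum poly_monom)
  show ?thesis
  proof (intro conjI exI[of _ "1 / 12"] exI[of _ Q] allI impI)
    show "(\<lambda>p. if prime p
              then (1 - 1 / of_nat p) ^ ((k - 1)\<^sup>2) *
                   (\<Sum>m\<in>{0..k - 1}. (of_nat ((k - 1) choose m))\<^sup>2 / of_nat p ^ m)
              else 1) has_prod a"
      unfolding a_def by (rule A_0_has_prod(1)[OF assms(1)])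
    show "degree Q = k\<^sup>2" using deg by (simp add: N_def)
    show "lead_coeff Q = c" by (simp add: deg coeff qN)
    fix r :: "nat \<Rightarrow> real" assume r: "\<forall>j\<in>{1..2 * k}. 0 < r j \<and> r j < 1 / 12"
    have Pr: "P k r x = (\<Sum>m\<le>N. q m * of_real x ^ m)" for x by (rule P_eq) (use r in blast)
    show "P k r x = poly Q (of_real x)" for x by (simp add: Pr polyQ)
    show "((\<lambda>x :: real. P k r x / of_real x ^ (k\<^sup>2)) \<longlongrightarrow> c) at_top"
      using poly_monom_sum_over_power_tendsto[of q N] by (simp add: Pr N_def qN[unfolded N_def])
  qed simp
qed

end
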